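(* Let $K_\lambda G$ be an infinite twisted group algebra of a group $G$ over a field $K$ such that $\operatorname{char}(K)$ does not divide the order of any element of $t(G)$. If $K_\lambda t(G)$ contains only a finite number of idempotents, then $U(K_\lambda G)$ is an $FC$-group if and only if $G$ is an $FC$-group and the following conditions are satisfied: 1. all idempotents of $K_\lambda t(G)$ are central in $K_\lambda G$; 2. $\{\lambda_{h,h^{-1}}^{-1}\lambda_{h^{-1},g}\lambda_{h^{-1}g,h}\mid h\in G\}$ is a finite set for every $g\in G$; 3. $K_\lambda t(G)$ is a direct sum of a finite number of fields; 4. if $K_\lambda t(G)$ is infinite then it is central in $K_\lambda G$.
   Context: Let $G$ be a group, $K$ a field, $U(K)=K\setminus\{0\}$, and $\lambda:G\times G\to U(K)$, $(g,h)\mapsto\lambda_{g,h}$, a $2$-cocycle with respect to the trivial action of $G$, i.e. $\lambda_{g,h}\lambda_{gh,k}=\lambda_{h,k}\lambda_{g,hk}$ for all $g,h,k\in G$. The twisted group algebra $K_\lambda G$ is the associative $K$-algebra with $K$-basis $\{u_g\mid g\in G\}$ and multiplication determined by $u_gu_h=\lambda_{g,h}u_{gh}$ and distributivity. $U(K_\lambda G)$ is its group of units. An $FC$-group is a group in which every conjugacy class is finite. $t(G)$ is the set of elements of finite order of $G$ (a subgroup when $G$ is an $FC$-group), and $K_\lambda t(G)$ is the $K$-span of $\{u_g\mid g\in t(G)\}$ in $K_\lambda G$ (a subalgebra when $t(G)$ is a subgroup). *)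

theory Defs
  imports "HOL-Algebra.Algebra" "HOL-Library.Poly_Mapping"
begin

definition FC_group :: "('a, 'm) monoid_scheme \<Rightarrow> bool" where
  "FC_group G \<longleftrightarrow> group G \<and>
     (\<forall>x\<in>carrier G. finite {h \<otimes>\<^bsub>G\<^esub> x \<otimes>\<^bsub>G\<^esub> inv\<^bsub>G\<^esub> h | h. h \<in> carrier G})"

definition torsion :: "('a, 'm) monoid_scheme \<Rightarrow> 'a set" where
  "torsion G = {x \<in> carrier G. \<exists>n::nat. n > 0 \<and> x [^]\<^bsub>G\<^esub> n = \<one>\<^bsub>G\<^esub>}"

definition two_cocycle :: "('g, 'm) monoid_scheme \<Rightarrow> ('g \<Rightarrow> 'g \<Rightarrow> 'k::field) \<Rightarrow> bool" where
  "two_cocycle G lam \<longleftrightarrow>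
     (\<forall>g\<in>carrier G. \<forall>h\<in>carrier G. lam g h \<noteq> 0) \<and>
     (\<forall>g\<in>carrier G. \<forall>h\<in>carrier G. \<forall>k\<in>carrier G.
        lam g h * lam (g \<otimes>\<^bsub>G\<^esub> h) k = lam h k * lam g (h \<otimes>\<^bsub>G\<^esub> k))"

text \<open>
  Elements are the finitely supported functions from the carrier of \<open>G\<close> to the field; the basis
  element \<open>u\<^sub>g\<close> is \<open>Poly_Mapping.single g 1\<close>. The cocycle need not be normalised, so the identity
  is \<open>u\<^sub>1\<close> scaled by the inverse of \<open>lam 1 1\<close>, not \<open>u\<^sub>1\<close> itself.
\<close>

definition twisted_group_algebra ::
    "('g, 'm) monoid_scheme \<Rightarrow> ('g \<Rightarrow> 'g \<Rightarrow> 'k::field) \<Rightarrow> ('g \<Rightarrow>\<^sub>0 'k) ring" where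
  "twisted_group_algebra G lam =
     \<lparr>carrier = {a. Poly_Mapping.keys a \<subseteq> carrier G},
      monoid.mult = (\<lambda>a b. \<Sum>g\<in>Poly_Mapping.keys a. \<Sum>h\<in>Poly_Mapping.keys b.
         Poly_Mapping.single (g \<otimes>\<^bsub>G\<^esub> h)
           (Poly_Mapping.lookup a g * Poly_Mapping.lookup b h * lam g h)),
      one = Poly_Mapping.single \<one>\<^bsub>G\<^esub> (inverse (lam \<one>\<^bsub>G\<^esub> \<one>\<^bsub>G\<^esub>)),
      ring.zero = 0,
      add = (+)\<rparr>"

text \<open>
  The span of the \<open>u\<^sub>g\<close> with \<open>g \<in> S\<close>, carrying the operations of the whole algebra. It is a
  subalgebra when \<open>S\<close> is a subgroup of \<open>G\<close>, and in general need not be closed under the product.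
\<close>

definition twisted_span ::
    "('g, 'm) monoid_scheme \<Rightarrow> ('g \<Rightarrow> 'g \<Rightarrow> 'k::field) \<Rightarrow> 'g set \<Rightarrow> ('g \<Rightarrow>\<^sub>0 'k) ring" where
  "twisted_span G lam S =
     (twisted_group_algebra G lam)\<lparr>carrier := {a. Poly_Mapping.keys a \<subseteq> S}\<rparr>"

definition idempotents :: "('a, 'm) ring_scheme \<Rightarrow> 'a set" where
  "idempotents R = {e \<in> carrier R. e \<otimes>\<^bsub>R\<^esub> e = e}"

definition center :: "('a, 'm) ring_scheme \<Rightarrow> 'a set" where
  "center R = {z \<in> carrier R. \<forall>x\<in>carrier R. z \<otimes>\<^bsub>R\<^esub> x = x \<otimes>\<^bsub>R\<^esub> z}"

text \<open>
  The summands may be taken over the element type of \<open>R\<close> without loss of generality, since each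
  summand of a direct sum is isomorphic to an ideal of \<open>R\<close>.
\<close>

definition direct_sum_of_fields :: "('a, 'm) ring_scheme \<Rightarrow> bool" where
  "direct_sum_of_fields R \<longleftrightarrow>
     (\<exists>Fs :: 'a ring list. (\<forall>F\<in>set Fs. field F) \<and> R \<simeq> RDirProd_list Fs)"

end

theory Submission
  imports Defs
begin

text \<open>
  Write \<open>R\<close> for the twisted group algebra and \<open>A\<close> for the span of the torsion subgroup.

  Suppose the units of \<open>R\<close> have finite conjugacy classes. If \<open>e\<close> is idempotent and
  \<open>y = e r (1 - e)\<close> is nonzero, then infinitely many units \<open>w\<close> commute with \<open>e\<close>, and conjugating
  \<open>1 + y\<close> by \<open>e w + (1 - e)\<close> gives the infinitely many elements \<open>1 + w y\<close>; hence idempotents are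
  central. Since torsion in FC-groups is locally finite, Maschke's theorem makes \<open>A\<close> von Neumann
  regular, so \<open>A\<close> is a finite product of division rings \<open>e A\<close>. If \<open>A\<close> is infinite, so is every
  \<open>e A\<close>, and the pigeonhole argument for conjugates in infinite division rings shows that \<open>e A\<close>
  is central in \<open>R\<close>. If \<open>A\<close> is finite, the \<open>e A\<close> are fields by Wedderburn.

  Conversely, the group modulo its torsion is torsion-free abelian, hence orderable, so comparing
  leading and trailing terms shows that each component of a unit is a product of an element of
  \<open>e A\<close> and a basis element. Conjugates of units can then be listed componentwise.
\<close>

section \<open>Torsion and orderability in FC-groups\<close>

text \<open>\<open>R\<close> may have zero divisors, so infinitely many units \<open>w\<close> need
  not give infinitely many products \<open>w y\<close>. The units are therefore built from monomials
  \<open>c u\<^sub>g\<close>: for a fixed nonzero \<open>y\<close>, only finitely many monomials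
  share the same product with \<open>y\<close>, and there are infinitely many monomials because
  \<open>R\<close> is infinite. The same count shows that a component \<open>e A\<close> of an
  infinite \<open>A\<close> is infinite. The hypothesis on the characteristic allows the averaging
  in Maschke's theorem on each finite torsion subgroup; finiteness of the set of idempotents bounds
  the number of components. Condition 2 lists, up to a constant factor, the coefficients of the
  conjugates of \<open>u\<^sub>g\<close> under basis elements; together with the FC property of
  \<open>G\<close> it says that these conjugates are finite in number. A component of a unit is some
  \<open>a\<close> in \<open>e A\<close> times the inverse of a basis element, so a conjugate by it
  is flanked by \<open>a\<close> and an inverse of \<open>a\<close>. If \<open>A\<close> is finite
  these take finitely many values; if \<open>A\<close> is infinite they are central and cancel. This
  is the dichotomy behind condition 4.\<close>

definition word_prod :: "('a, 'm) monoid_scheme \<Rightarrow> 'a list \<Rightarrow> 'a" where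
  "word_prod G w = foldr (\<otimes>\<^bsub>G\<^esub>) w \<one>\<^bsub>G\<^esub>"

context monoid
begin

lemma word_prod_simps [simp]:
  "word_prod G [] = \<one>" "word_prod G (x # w) = x \<otimes> word_prod G w"
  by (simp_all add: word_prod_def)

lemma word_prod_closed [simp, intro]: "set w \<subseteq> carrier G \<Longrightarrow> word_prod G w \<in> carrier G"
  by (induction w) auto

lemma word_prod_append:
  "set v \<subseteq> carrier G \<Longrightarrow> set w \<subseteq> carrier G \<Longrightarrow> word_prod G (v @ w) = word_prod G v \<otimes> word_prod G w"
  by (induction v) (auto simp: m_assoc)

lemma word_prod_replicate: "x \<in> carrier G \<Longrightarrow> word_prod G (replicate n x) = x [^] n"
  by (induction n) (simp_all add: nat_pow_Suc2[symmetric])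

end

section \<open>Words over finite normal sets: the theorems of Dietzmann and Schur\<close>

context group
begin

lemma conj_mult: "h \<in> carrier G \<Longrightarrow> x \<in> carrier G \<Longrightarrow> y \<in> carrier G \<Longrightarrow>
   h \<otimes> x \<otimes> inv h \<otimes> (h \<otimes> y \<otimes> inv h) = h \<otimes> (x \<otimes> y) \<otimes> inv h"
  by (metis inv_closed inv_solve_left m_assoc m_closed)

lemma conj_pow: "h \<in> carrier G \<Longrightarrow> x \<in> carrier G \<Longrightarrow>
   (h \<otimes> x \<otimes> inv h) [^] (n::nat) = h \<otimes> x [^] n \<otimes> inv h"
  by (induction n) (simp_all add: conj_mult)

lemma conj_conj: "g \<in> carrier G \<Longrightarrow> h \<in> carrier G \<Longrightarrow> x \<in> carrier G \<Longrightarrow>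
   g \<otimes> (h \<otimes> x \<otimes> inv h) \<otimes> inv g = (g \<otimes> h) \<otimes> x \<otimes> inv (g \<otimes> h)"
  by (simp add: inv_mult_group m_assoc)

text \<open>Moving copies of \<open>s\<close> leftwards past a letter \<open>a\<close> replaces
  \<open>a\<close> by its conjugate by a power of \<open>s\<close>, which is again a single letter
  of \<open>S\<close>. So all copies can be gathered in front at no cost in length.\<close>

lemma word_collect:
  assumes S: "S \<subseteq> carrier G" and cl: "\<And>a. a \<in> S \<Longrightarrow> inv s \<otimes> a \<otimes> s \<in> S" and s: "s \<in> S"
    and w: "set w \<subseteq> S"
  obtains w' where "set w' \<subseteq> S" "length w = count_list w s + length w'"
    "word_prod G w = s [^] count_list w s \<otimes> word_prod G w'"
proof -
  have sc: "s \<in> carrier G" using S s by auto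
  have pw: "inv (s [^] k) \<otimes> a \<otimes> s [^] (k::nat) \<in> S" if "a \<in> S" for a k
  proof (induction k)
    case 0 then show ?case using that S by auto
  next
    case (Suc k)
    have "inv (s [^] Suc k) \<otimes> a \<otimes> s [^] Suc k = inv s \<otimes> (inv (s [^] k) \<otimes> a \<otimes> s [^] k) \<otimes> s"
      using that S sc by (simp add: inv_mult_group m_assoc subset_iff)
    then show ?case using cl[OF Suc] by simp
  qed
  have "\<exists>w'. set w' \<subseteq> S \<and> length w = count_list w s + length w' \<and>
    word_prod G w = s [^] count_list w s \<otimes> word_prod G w'" using w
  proof (induction w)
    case Nil then show ?case by (intro exI[of _ "[]"]) auto
  next
    case (Cons a w)
    then obtain w' where w': "set w' \<subseteq> S" "length w = count_list w s + length w'"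
      "word_prod G w = s [^] count_list w s \<otimes> word_prod G w'" by auto
    have a: "a \<in> S" "a \<in> carrier G" and w'c: "set w' \<subseteq> carrier G" using Cons.prems S w' by auto
    show ?case
    proof (cases "a = s")
      case True
      then show ?thesis using w' a w'c sc
        by (intro exI[of _ w']) (auto simp: m_assoc[symmetric] nat_pow_Suc2[symmetric])
    next
      case False
      let ?k = "count_list w s"
      let ?a = "inv (s [^] ?k) \<otimes> a \<otimes> s [^] ?k"
      have "a \<otimes> (s [^] ?k \<otimes> word_prod G w') = s [^] ?k \<otimes> (?a \<otimes> word_prod G w')"
        using a sc w'c by (simp add: m_assoc[symmetric])
      then show ?thesis using w' False pw[OF a(1), of ?k]
        by (intro exI[of _ "?a # w'"]) auto
    qed
  qed
  then show thesis using that by blast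
qed

text \<open>
  Dietzmann's argument, stated so that it also yields Schur's theorem: in a long word some letter
  occurs often enough to be collected into a power, which is then replaced by a shorter word.
\<close>

lemma finite_subgroup_of_words:
  assumes fin: "finite S" and S: "S \<subseteq> carrier G"
    and cl: "\<And>s a. s \<in> S \<Longrightarrow> a \<in> S \<Longrightarrow> inv s \<otimes> a \<otimes> s \<in> S"
    and red: "\<And>s. s \<in> S \<Longrightarrow> \<exists>n::nat. \<exists>w. set w \<subseteq> S \<and> length w < n \<and> s [^] n = word_prod G w"
  obtains H where "subgroup H G" "finite H" "S \<subseteq> H"
proof -
  obtain n v where v: "\<And>s. s \<in> S \<Longrightarrow> set (v s) \<subseteq> S \<and> length (v s) < n s \<and> s [^] (n s :: nat) = word_prod G (v s)"
    using red by metis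
  \<comment> \<open>Pigeonhole constant: a word longer than the sum of all thresholds
    \<open>n s\<close> contains some letter \<open>s\<close> at least \<open>n s\<close>
    times.\<close>
  define N where "N = (\<Sum>s\<in>S. n s)"
  have short: "\<exists>w'. set w' \<subseteq> S \<and> length w' \<le> N \<and> word_prod G w' = word_prod G w" if "set w \<subseteq> S" for w
    using that
  proof (induction "length w" arbitrary: w rule: less_induct)
    case less
    show ?case
    proof (cases "length w \<le> N")
      case True then show ?thesis using less.prems by blast
    next
      case False
      have "length w = (\<Sum>s\<in>set w. count_list w s)" by (simp add: sum_count_set)
      also have "\<dots> = (\<Sum>s\<in>S. count_list w s)"
        using less.prems fin by (intro sum.mono_neutral_left) (auto simp: count_list_0_iff)
      finally have len: "length w = (\<Sum>s\<in>S. count_list w s)" .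
      have "\<exists>s\<in>S. n s \<le> count_list w s"
      proof (rule ccontr)
        assume "\<not> (\<exists>s\<in>S. n s \<le> count_list w s)"
        then have "(\<Sum>s\<in>S. count_list w s) \<le> N" unfolding N_def by (intro sum_mono) auto
        then show False using False len by simp
      qed
      then obtain s where s: "s \<in> S" "n s \<le> count_list w s" by blast
      obtain w' where w': "set w' \<subseteq> S" "length w = count_list w s + length w'"
        "word_prod G w = s [^] count_list w s \<otimes> word_prod G w'"
        using word_collect[OF S cl[OF s(1)] s(1) less.prems] by blast
      define k where "k = count_list w s - n s"
      have k: "count_list w s = n s + k" using s k_def by simp
      let ?w = "v s @ replicate k s @ w'"
      have sc: "s \<in> carrier G" "set (v s) \<subseteq> carrier G" "set w' \<subseteq> carrier G"
        using s S v[OF s(1)] w' by auto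
      have "word_prod G ?w = word_prod G w"
        using sc v[OF s(1)] w' k by (subst word_prod_append | simp add: word_prod_replicate
            nat_pow_mult[symmetric] m_assoc subset_iff)+
      moreover have "length ?w < length w" using w' k v[OF s(1)] by simp
      moreover have "set ?w \<subseteq> S" using v[OF s(1)] s w' by auto
      ultimately show ?thesis using less.hyps by metis
    qed
  qed
  define H where "H = word_prod G ` {w. set w \<subseteq> S}"
  have "H \<subseteq> word_prod G ` {w. set w \<subseteq> S \<and> length w \<le> N}"
    unfolding H_def using short by (force simp: image_iff)
  moreover have "finite {w. set w \<subseteq> S \<and> length w \<le> N}" using fin by (rule finite_lists_length_le)
  ultimately have finH: "finite H" by (meson finite_imageI finite_subset)
  have Hc: "H \<subseteq> carrier G" unfolding H_def using S by auto
  have mult: "x \<otimes> y \<in> H" if xy: "x \<in> H" "y \<in> H" for x y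
  proof -
    obtain a b where "set a \<subseteq> S" "set b \<subseteq> S" "x = word_prod G a" "y = word_prod G b"
      using xy H_def by auto
    then have "x \<otimes> y = word_prod G (a @ b)" "set (a @ b) \<subseteq> S" using S by (auto simp: word_prod_append)
    then show ?thesis unfolding H_def by blast
  qed
  have one: "\<one> \<in> H" unfolding H_def by (rule image_eqI[of _ _ "[]"]) auto
  have "inv x \<in> H" if x: "x \<in> H" for x
  proof -
    have "(\<otimes>) x ` H = H"
      using mult[OF x] finH x Hc by (intro endo_inj_surj) (auto simp: inj_on_def subset_iff)
    then obtain y where "y \<in> H" "x \<otimes> y = \<one>" using one by (metis imageE)
    then show ?thesis using x Hc by (metis inv_unique' subsetD inv_equality inv_inv)
  qed
  then have "subgroup H G" using Hc mult one by (intro subgroupI) auto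
  moreover have "s \<in> H" if "s \<in> S" for s
    unfolding H_def using that S by (intro image_eqI[of _ _ "[s]"]) auto
  ultimately show thesis using that finH by blast
qed

lemma inv_cancel:
  "x \<in> carrier G \<Longrightarrow> y \<in> carrier G \<Longrightarrow> inv x \<otimes> (x \<otimes> y) = y"
  "x \<in> carrier G \<Longrightarrow> y \<in> carrier G \<Longrightarrow> x \<otimes> (inv x \<otimes> y) = y"
  by (simp_all add: m_assoc[symmetric])

lemma pow_eq_imp_pow_diff_eq_one:
  assumes "x \<in> carrier G" "x [^] (i::nat) = x [^] j" "i < j"
  shows "x [^] (j - i) = \<one>"
proof -
  have "x [^] i \<otimes> x [^] (j - i) = x [^] j"
    using assms(1,3) by (simp add: nat_pow_mult)
  then have "x [^] i \<otimes> x [^] (j - i) = x [^] i \<otimes> \<one>"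
    using assms by simp
  then show ?thesis using assms(1) by (simp del: r_one)
qed

lemma finite_subgroup_subset_torsion:
  assumes "subgroup H G" "finite H"
  shows "H \<subseteq> torsion G"
proof
  fix x assume x: "x \<in> H"
  then have xc: "x \<in> carrier G" using assms subgroup.subset by blast
  have "x [^] n \<in> H" for n :: nat
    by (induction n) (use assms x in \<open>auto intro: subgroup.m_closed subgroup.one_closed\<close>)
  then have "\<not> inj (\<lambda>n::nat. x [^] n)"
    using assms(2) by (metis finite_subset image_subsetI infinite_UNIV_nat range_inj_infinite)
  then obtain i j :: nat where "x [^] i = x [^] j" "i < j"
    by (metis injI linorder_neqE_nat)
  then have "x [^] (j - i) = \<one>" "j - i > 0" using pow_eq_imp_pow_diff_eq_one xc by auto
  then show "x \<in> torsion G" using xc unfolding torsion_def by blast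
qed

lemma one_in_torsion: "\<one> \<in> torsion G"
  unfolding torsion_def by (auto intro: exI[of _ 1])

lemma torsion_subset: "torsion G \<subseteq> carrier G"
  unfolding torsion_def by auto

lemma inv_in_torsion: "x \<in> torsion G \<Longrightarrow> inv x \<in> torsion G"
  unfolding torsion_def by (auto simp: nat_pow_inv)

lemma conj_in_torsion: "x \<in> torsion G \<Longrightarrow> h \<in> carrier G \<Longrightarrow> h \<otimes> x \<otimes> inv h \<in> torsion G"
  unfolding torsion_def by (auto simp: conj_pow)

lemma root_in_torsion:
  assumes "x \<in> carrier G" "x [^] (n::nat) \<in> torsion G" "n > 0"
  shows "x \<in> torsion G"
proof -
  obtain m :: nat where "m > 0" "(x [^] n) [^] m = \<one>" using assms(2) unfolding torsion_def by auto
  then show ?thesis using assms unfolding torsion_def by (auto simp: nat_pow_pow intro!: exI[of _ "n * m"])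
qed

text \<open>The conjugates of elements of \<open>F\<close> form a finite normal set of torsion
  elements, and each relation \<open>s [^] n = \<one>\<close> serves as a reduction with the empty
  word as replacement.\<close>

lemma finite_subgroup_of_torsion:
  assumes FC: "FC_group G" and F: "finite F" "F \<subseteq> torsion G"
  obtains H where "subgroup H G" "finite H" "F \<subseteq> H" "H \<subseteq> torsion G"
proof -
  define S where "S = (\<Union>f\<in>F. {h \<otimes> f \<otimes> inv h | h. h \<in> carrier G})"
  have fin: "finite S" unfolding S_def using FC F torsion_subset unfolding FC_group_def by blast
  have St: "S \<subseteq> torsion G" unfolding S_def using F conj_in_torsion by blast
  then have Sc: "S \<subseteq> carrier G" using torsion_subset by blast
  have FS: "F \<subseteq> S"
  proof
    fix f assume f: "f \<in> F"
    then have "f = \<one> \<otimes> f \<otimes> inv \<one>" using F torsion_subset by auto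
    then show "f \<in> S" unfolding S_def using f by blast
  qed
  obtain H where H: "subgroup H G" "finite H" "S \<subseteq> H"
  proof (rule finite_subgroup_of_words[OF fin Sc])
    fix s a assume s: "s \<in> S" and "a \<in> S"
    then obtain f h where h: "f \<in> F" "h \<in> carrier G" "a = h \<otimes> f \<otimes> inv h" unfolding S_def by blast
    have "inv s \<otimes> a \<otimes> s = inv s \<otimes> a \<otimes> inv (inv s)" using s Sc by auto
    also have "\<dots> = (inv s \<otimes> h) \<otimes> f \<otimes> inv (inv s \<otimes> h)"
      unfolding h(3) using s Sc h F torsion_subset by (intro conj_conj) auto
    finally show "inv s \<otimes> a \<otimes> s \<in> S" unfolding S_def using h s Sc by blast
  next
    fix s assume "s \<in> S"
    then show "\<exists>n::nat. \<exists>w. set w \<subseteq> S \<and> length w < n \<and> s [^] n = word_prod G w"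
      using St unfolding torsion_def by (force intro!: exI[of _ "[]"])
  qed blast
  then show thesis using that FS finite_subgroup_subset_torsion by blast
qed

lemma torsion_subgroup:
  assumes "FC_group G" shows "subgroup (torsion G) G"
proof (rule subgroupI)
  fix x y assume "x \<in> torsion G" "y \<in> torsion G"
  then obtain H where "subgroup H G" "finite H" "{x, y} \<subseteq> H" "H \<subseteq> torsion G"
    using finite_subgroup_of_torsion[OF assms, of "{x, y}"] by blast
  then show "x \<otimes> y \<in> torsion G" using subgroup.m_closed by fastforce
qed (use torsion_subset one_in_torsion inv_in_torsion in auto)

text \<open>Schur's theorem for the subgroup \<open>H\<close> generated by \<open>x\<close> and
  \<open>y\<close>. Its centre has finite index, so \<open>H\<close> has only finitely many
  commutators; a suitable power of a commutator is a product of fewer commutators, so they all lie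
  in a finite subgroup.\<close>

lemma commutator_in_torsion:
  assumes FC: "FC_group G" and x: "x \<in> carrier G" and y: "y \<in> carrier G"
  shows "x \<otimes> y \<otimes> inv x \<otimes> inv y \<in> torsion G"
proof -
  define H where "H = generate G {x, y}"
  have H: "subgroup H G" unfolding H_def using x y by (intro generate_is_subgroup) auto
  have Hc: "\<And>h. h \<in> H \<Longrightarrow> h \<in> carrier G" using H subgroup.subset by blast
  have xy: "x \<in> H" "y \<in> H" unfolding H_def by (auto intro: generate.incl)
  note Hm = subgroup.m_closed[OF H] subgroup.m_inv_closed[OF H] subgroup.one_closed[OF H]
  \<comment> \<open>The fibres of \<open>\<phi>\<close> on \<open>H\<close> are the cosets of the
    centre of \<open>H\<close>, because commuting with the two generators suffices; a finite image
    thus expresses finite index.\<close>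
  define \<phi> where "\<phi> = (\<lambda>a. (a \<otimes> x \<otimes> inv a, a \<otimes> y \<otimes> inv a))"
  have "\<phi> ` H \<subseteq> {h \<otimes> x \<otimes> inv h | h. h \<in> carrier G} \<times> {h \<otimes> y \<otimes> inv h | h. h \<in> carrier G}"
    unfolding \<phi>_def using Hc by auto
  then have fin\<phi>: "finite (\<phi> ` H)"
    using FC x y unfolding FC_group_def by (meson finite_SigmaI finite_subset)
  have central: "(inv a \<otimes> b) \<otimes> h = h \<otimes> (inv a \<otimes> b)"
    if ab: "a \<in> H" "b \<in> H" "\<phi> a = \<phi> b" and h: "h \<in> H" for a b h
  proof -
    define z where "z = inv a \<otimes> b"
    have z: "z \<in> carrier G" unfolding z_def using ab Hc by auto
    define C where "C = {c \<in> carrier G. z \<otimes> c = c \<otimes> z}"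
    have step: "u \<in> C" if u: "u \<in> carrier G" "a \<otimes> u \<otimes> inv a = b \<otimes> u \<otimes> inv b" for u
    proof -
      have "z \<otimes> u = inv a \<otimes> (b \<otimes> u \<otimes> inv b) \<otimes> b"
        unfolding z_def using u ab Hc by (simp add: m_assoc)
      also have "\<dots> = u \<otimes> z"
        unfolding z_def u(2)[symmetric] using u(1) ab(1,2) Hc by (simp add: m_assoc inv_cancel)
      finally show ?thesis using u C_def by auto
    qed
    have "x \<in> C" "y \<in> C" using step x y ab(3) unfolding \<phi>_def by auto
    moreover have "subgroup C G"
    proof (rule subgroupI)
      fix c d assume cd: "c \<in> C" "d \<in> C"
      then have c: "c \<in> carrier G" "d \<in> carrier G" and com: "z \<otimes> c = c \<otimes> z" "z \<otimes> d = d \<otimes> z"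
        unfolding C_def by auto
      have "z \<otimes> (c \<otimes> d) = (c \<otimes> z) \<otimes> d" using c z by (simp add: m_assoc[symmetric] com(1))
      also have "\<dots> = (c \<otimes> d) \<otimes> z" using c z by (simp add: m_assoc com(2))
      finally show "c \<otimes> d \<in> C" using c C_def by auto
      have "inv c \<otimes> (c \<otimes> z) \<otimes> inv c = inv c \<otimes> (z \<otimes> c) \<otimes> inv c" using cd C_def by simp
      moreover have "c \<in> carrier G" using cd C_def by simp
      ultimately have "z \<otimes> inv c = inv c \<otimes> z" using z by (simp add: m_assoc inv_cancel)
      then show "inv c \<in> C" using cd unfolding C_def by simp
    qed (use z C_def in auto)
    ultimately have "H \<subseteq> C" unfolding H_def by (simp add: generate_subgroup_incl)
    then show ?thesis using h unfolding C_def z_def by auto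
  qed
  define cm where "cm = (\<lambda>a b. a \<otimes> b \<otimes> inv a \<otimes> inv b)"
  define S where "S = {cm a b | a b. a \<in> H \<and> b \<in> H}"
  define r where "r = inv_into H \<phi>"
  have r: "r (\<phi> a) \<in> H" "\<phi> (r (\<phi> a)) = \<phi> a" if "a \<in> H" for a
    using that unfolding r_def by (auto intro: inv_into_into f_inv_into_f)
  \<comment> \<open>Central factors \<open>z\<close> and \<open>w\<close> drop out of a commutator,
    which therefore depends only on the classes of its arguments modulo the centre.\<close>
  have cm_cong: "cm a b = cm a' b'"
    if ab: "a \<in> H" "b \<in> H" "a' \<in> H" "b' \<in> H" "\<phi> a = \<phi> a'" "\<phi> b = \<phi> b'" for a b a' b'
  proof -
    define z w where "z = inv a \<otimes> a'" and "w = inv b \<otimes> b'"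
    have zw: "z \<in> H" "w \<in> H" "a' = a \<otimes> z" "b' = b \<otimes> w"
      unfolding z_def w_def using ab Hm Hc by (auto simp: inv_cancel)
    have zc: "z \<otimes> h = h \<otimes> z" "w \<otimes> h = h \<otimes> w" if "h \<in> H" for h
      unfolding z_def w_def using central ab that by auto
    have "cm a' b' = a \<otimes> (z \<otimes> (b \<otimes> w)) \<otimes> inv z \<otimes> inv a \<otimes> inv w \<otimes> inv b"
      unfolding cm_def zw using ab zw Hc by (simp add: inv_mult_group m_assoc)
    also have "\<dots> = a \<otimes> b \<otimes> (w \<otimes> inv a) \<otimes> inv w \<otimes> inv b"
      using zc(1)[of "b \<otimes> w"] ab zw Hc Hm by (simp add: m_assoc inv_cancel)
    also have "\<dots> = cm a b"
      unfolding cm_def using zc(2)[of "inv a"] ab zw Hc Hm by (simp add: m_assoc inv_cancel)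
    finally show ?thesis by simp
  qed
  have "S \<subseteq> (\<lambda>(p, q). cm (r p) (r q)) ` (\<phi> ` H \<times> \<phi> ` H)"
  proof
    fix s assume "s \<in> S"
    then obtain a b where ab: "a \<in> H" "b \<in> H" "s = cm a b" unfolding S_def by blast
    have "s = cm (r (\<phi> a)) (r (\<phi> b))"
      unfolding ab(3) by (rule cm_cong) (simp_all only: r ab)
    then show "s \<in> (\<lambda>(p, q). cm (r p) (r q)) ` (\<phi> ` H \<times> \<phi> ` H)" using ab by auto
  qed
  then have finS: "finite S" using fin\<phi> by (meson finite_SigmaI finite_imageI finite_subset)
  have cmH: "cm a b \<in> H" if "a \<in> H" "b \<in> H" for a b unfolding cm_def using that Hm by auto
  have conj_cm: "h \<otimes> cm a b \<otimes> inv h = cm (h \<otimes> a \<otimes> inv h) (h \<otimes> b \<otimes> inv h)"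
    if "a \<in> H" "b \<in> H" "h \<in> H" for a b h
    unfolding cm_def using that[THEN Hc] by (simp add: m_assoc inv_cancel inv_mult_group)
  have conj_S: "h \<otimes> s \<otimes> inv h \<in> S" if "s \<in> S" "h \<in> H" for s h
  proof -
    obtain a b where ab: "a \<in> H" "b \<in> H" "s = cm a b" using \<open>s \<in> S\<close> unfolding S_def by blast
    have "h \<otimes> a \<otimes> inv h \<in> H" "h \<otimes> b \<otimes> inv h \<in> H" using ab that(2) by (simp_all add: Hm)
    then show ?thesis unfolding S_def using ab conj_cm[OF ab(1,2) that(2)] by blast
  qed
  have SH: "S \<subseteq> H" unfolding S_def using cmH by blast
  obtain K where K: "subgroup K G" "finite K" "S \<subseteq> K"
  proof (rule finite_subgroup_of_words[OF finS])
    show "S \<subseteq> carrier G" using SH Hc by blast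
    fix s a assume "s \<in> S" "a \<in> S"
    then show "inv s \<otimes> a \<otimes> s \<in> S" using conj_S[of a "inv s"] SH Hm Hc by auto
  next
    fix c assume c: "c \<in> S"
    then obtain a b where ab: "a \<in> H" "b \<in> H" "c = cm a b" unfolding S_def by blast
    have cH: "c \<in> H" and cc: "c \<in> carrier G" using c SH Hc by auto
    have cp: "c [^] n \<in> H" for n :: nat by (induction n) (use cH Hm in auto)
    have "(\<lambda>n::nat. \<phi> (c [^] n)) ` UNIV \<subseteq> \<phi> ` H" using cp by auto
    then have "\<not> inj (\<lambda>n::nat. \<phi> (c [^] n))"
      using fin\<phi> by (meson finite_subset range_inj_infinite)
    then obtain i j :: nat where ij: "\<phi> (c [^] i) = \<phi> (c [^] j)" "i < j"
      by (metis injI linorder_neqE_nat)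
    \<comment> \<open>Chosen so that \<open>c [^] Suc m\<close> is the quotient of two powers with
      equal \<open>\<phi>\<close>, hence central in \<open>H\<close>.\<close>
    define m where "m = j - i - 1"
    have "c [^] j = c [^] i \<otimes> c [^] Suc m"
      unfolding m_def using ij(2) cc by (subst nat_pow_mult) auto
    then have "inv (c [^] i) \<otimes> c [^] j = c [^] Suc m" using cc by (simp add: inv_cancel)
    then have cen: "c [^] Suc m \<otimes> h = h \<otimes> c [^] Suc m" if "h \<in> H" for h
      using central[OF cp[of i] cp[of j] ij(1) that] by simp
    have abc: "a \<in> carrier G" "b \<in> carrier G" using ab Hc by auto
    \<comment> \<open>For \<open>c = [a, b]\<close> with \<open>c [^] Suc m\<close> central, pulling
      one \<open>b\<close> through the central power gives \<open>c\<^sup>m\<^sup>+\<^sup>2 =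
      [a, b\<^sup>2] (b c b\<^sup>-\<^sup>1)\<^sup>m\<close>: \<open>m + 2\<close> commutators are
      replaced by \<open>m + 1\<close>.\<close>
    let ?w = "cm a (b \<otimes> b) # replicate m (b \<otimes> c \<otimes> inv b)"
    have "c [^] Suc (Suc m) = c \<otimes> c [^] Suc m" using cc by (metis nat_pow_Suc2)
    also have "\<dots> = a \<otimes> b \<otimes> inv a \<otimes> (c [^] Suc m \<otimes> inv b)"
      unfolding cen[OF Hm(2)[OF ab(2)]] using abc cc unfolding ab(3) cm_def by (simp add: m_assoc)
    also have "\<dots> = a \<otimes> b \<otimes> inv a \<otimes> (c \<otimes> c [^] m \<otimes> inv b)"
      using cc by (metis nat_pow_Suc2)
    also have "\<dots> = cm a (b \<otimes> b) \<otimes> (b \<otimes> c [^] m \<otimes> inv b)"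
    proof -
      define d where "d = c [^] m"
      have "d \<in> carrier G" unfolding d_def using cc by simp
      then show ?thesis unfolding d_def[symmetric] ab(3) cm_def using abc by (simp add: m_assoc inv_cancel inv_mult_group)
    qed
    also have "\<dots> = word_prod G ?w"
      using abc cc by (simp add: word_prod_replicate conj_pow)
    finally have "c [^] Suc (Suc m) = word_prod G ?w" .
    moreover have "cm a (b \<otimes> b) \<in> S" unfolding S_def using ab Hm(1) by blast
    then have "set ?w \<subseteq> S" using conj_S[OF c ab(2)] by auto
    ultimately show "\<exists>n::nat. \<exists>w. set w \<subseteq> S \<and> length w < n \<and> c [^] n = word_prod G w"
      by (intro exI[of _ "Suc (Suc m)"] exI[of _ ?w]) auto
  qed blast
  have "cm x y \<in> S" unfolding S_def using xy by blast
  then show ?thesis using K finite_subgroup_subset_torsion unfolding cm_def by blast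
qed

text \<open>\<open>P\<close> is the preimage of a positive cone of the quotient by torsion, obtained
  as a maximal element by Zorn. If it omits \<open>g\<close>, adjoining the powers of
  \<open>g\<close> must fail, so the inverse of a positive power of \<open>g\<close> is in
  \<open>P\<close>. If both \<open>x\<close> and its inverse were omitted, some power of
  \<open>x\<close> and the inverse of that power would lie in \<open>P\<close>, making
  \<open>x\<close> torsion and hence a member of \<open>P\<close>.\<close>

lemma torsion_free_quotient_cone:
  assumes FC: "FC_group G"
  obtains P where "torsion G \<subseteq> P" "P \<subseteq> carrier G" "\<And>x y. x \<in> P \<Longrightarrow> y \<in> P \<Longrightarrow> x \<otimes> y \<in> P"
    "\<And>x. x \<in> P \<Longrightarrow> inv x \<in> P \<Longrightarrow> x \<in> torsion G"
    "\<And>x. x \<in> carrier G \<Longrightarrow> x \<in> P \<or> inv x \<in> P"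
proof -
  define \<F> where "\<F> = {P. torsion G \<subseteq> P \<and> P \<subseteq> carrier G \<and> (\<forall>x\<in>P. \<forall>y\<in>P. x \<otimes> y \<in> P) \<and>
    (\<forall>x\<in>P. inv x \<in> P \<longrightarrow> x \<in> torsion G)}"
  have T: "torsion G \<in> \<F>"
    unfolding \<F>_def using torsion_subset subgroup.m_closed[OF torsion_subgroup[OF FC]] by auto
  have "\<exists>M\<in>\<F>. (\<forall>Y\<in>\<F>. M \<subseteq> Y \<longrightarrow> Y = M)"
  proof (rule subset_Zorn_nonempty)
    show "\<F> \<noteq> {}" using T by blast
    fix \<C> assume \<C>: "\<C> \<noteq> {}" "subset.chain \<F> \<C>"
    have two: "\<exists>Y\<in>\<C>. x \<in> Y \<and> y \<in> Y" if xy: "x \<in> \<Union>\<C>" "y \<in> \<Union>\<C>" for x y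
    proof -
      obtain Y Z where YZ: "Y \<in> \<C>" "x \<in> Y" "Z \<in> \<C>" "y \<in> Z" using xy by blast
      then have "Y \<subseteq> Z \<or> Z \<subseteq> Y" using \<C>(2) unfolding subset_chain_def by blast
      then show ?thesis using YZ by blast
    qed
    have in\<F>: "\<And>Y. Y \<in> \<C> \<Longrightarrow> Y \<in> \<F>" using \<C>(2) unfolding subset.chain_def by blast
    show "\<Union>\<C> \<in> \<F>"
      unfolding \<F>_def
    proof (intro CollectI conjI ballI impI)
      show "torsion G \<subseteq> \<Union>\<C>" using \<C>(1) in\<F> unfolding \<F>_def by blast
      show "\<Union>\<C> \<subseteq> carrier G" using in\<F> unfolding \<F>_def by blast
      fix x y assume "x \<in> \<Union>\<C>" "y \<in> \<Union>\<C>"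
      then obtain Y where "Y \<in> \<C>" "x \<in> Y" "y \<in> Y" using two by blast
      then show "x \<otimes> y \<in> \<Union>\<C>" using in\<F> unfolding \<F>_def by blast
    next
      fix x assume "x \<in> \<Union>\<C>" "inv x \<in> \<Union>\<C>"
      then obtain Y where "Y \<in> \<C>" "x \<in> Y" "inv x \<in> Y" using two by blast
      then show "x \<in> torsion G" using in\<F> unfolding \<F>_def by blast
    qed
  qed
  then obtain P where P: "P \<in> \<F>" and max: "\<And>Y. Y \<in> \<F> \<Longrightarrow> P \<subseteq> Y \<Longrightarrow> Y = P" by blast
  have TP: "torsion G \<subseteq> P" and Pc: "P \<subseteq> carrier G" and Pm: "\<And>x y. x \<in> P \<Longrightarrow> y \<in> P \<Longrightarrow> x \<otimes> y \<in> P"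
    and Pi: "\<And>x. x \<in> P \<Longrightarrow> inv x \<in> P \<Longrightarrow> x \<in> torsion G" using P unfolding \<F>_def by auto
  have oneP: "\<one> \<in> P" using TP one_in_torsion by blast
  have extend: "\<exists>k::nat. k > 0 \<and> inv (g [^] k) \<in> P" if g: "g \<in> carrier G" "g \<notin> P" for g
  proof (rule ccontr)
    assume neg: "\<not> ?thesis"
    define Q where "Q = {p \<otimes> g [^] (n::nat) | p n. p \<in> P}"
    have mul: "\<exists>r\<in>P. (p \<otimes> g [^] n) \<otimes> (q \<otimes> g [^] m) = r \<otimes> g [^] (n + m)"
      if pq: "p \<in> P" "q \<in> P" for p q and n m :: nat
    proof
      define h where "h = g [^] n"
      have h: "h \<in> carrier G" "p \<in> carrier G" "q \<in> carrier G" unfolding h_def using g pq Pc by auto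
      \<comment> \<open>A commutator is torsion, hence in \<open>P\<close>; it is the price of
        moving a power of \<open>g\<close> past \<open>q\<close>, and makes \<open>Q\<close> closed
        under products.\<close>
      let ?t = "h \<otimes> q \<otimes> inv h \<otimes> inv q"
      have "?t \<in> P" using commutator_in_torsion[OF FC h(1) h(3)] TP by blast
      then show "p \<otimes> (?t \<otimes> q) \<in> P" using pq Pm by blast
      have "(p \<otimes> h) \<otimes> (q \<otimes> g [^] m) = p \<otimes> (?t \<otimes> q) \<otimes> (h \<otimes> g [^] m)"
        using h g by (simp add: m_assoc inv_cancel)
      then show "(p \<otimes> g [^] n) \<otimes> (q \<otimes> g [^] m) = p \<otimes> (?t \<otimes> q) \<otimes> g [^] (n + m)"
        unfolding h_def using g by (simp add: nat_pow_mult)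
    qed
    have PQ: "P \<subseteq> Q"
    proof
      fix p assume "p \<in> P"
      then have "p = p \<otimes> g [^] (0::nat)" using Pc by auto
      then show "p \<in> Q" using \<open>p \<in> P\<close> unfolding Q_def by blast
    qed
    have "Q \<in> \<F>"
      unfolding \<F>_def
    proof (intro CollectI conjI ballI impI)
      show "torsion G \<subseteq> Q" using TP PQ by blast
      show "Q \<subseteq> carrier G" unfolding Q_def using Pc g by auto
      fix x y assume "x \<in> Q" "y \<in> Q"
      then show "x \<otimes> y \<in> Q" using mul unfolding Q_def by (smt (verit, best) mem_Collect_eq)
    next
      fix x assume x: "x \<in> Q" "inv x \<in> Q"
      then obtain p q n m where pq: "p \<in> P" "q \<in> P" "x = p \<otimes> g [^] (n::nat)" "inv x = q \<otimes> g [^] (m::nat)"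
        unfolding Q_def by blast
      obtain r where r: "r \<in> P" "x \<otimes> inv x = r \<otimes> g [^] (n + m)" using mul[OF pq(1,2)] pq(3,4) by auto
      have xc: "x \<in> carrier G" using pq Pc g by auto
      then have "r \<otimes> g [^] (n + m) = \<one>" using r by simp
      then have "inv (g [^] (n + m)) = r" using r(1) g Pc by (intro inv_equality) auto
      then have "n + m = 0" using neg r(1) by (metis gr0I)
      then have "x = p" "inv x = q" using pq Pc by auto
      then show "x \<in> torsion G" using pq(1,2) Pi by blast
    qed
    then have "Q = P" using max PQ by blast
    moreover have "\<one> \<otimes> g [^] (1::nat) \<in> Q" unfolding Q_def using oneP by blast
    ultimately show False using g by simp
  qed
  have pw: "x [^] n \<in> P" if "x \<in> P" for x and n :: nat
    using that by (induction n) (auto simp: oneP Pm)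
  have "x \<in> P \<or> inv x \<in> P" if x: "x \<in> carrier G" for x
  proof (rule ccontr)
    assume neg: "\<not> ?thesis"
    then obtain k l :: nat where kl: "k > 0" "inv (x [^] k) \<in> P" "l > 0" "inv (inv x [^] l) \<in> P"
      using extend[of x] extend[of "inv x"] x by auto
    have "inv (x [^] (k * l)) \<in> P"
      using pw[OF kl(2), of l] x by (simp add: nat_pow_inv nat_pow_pow)
    moreover have "x [^] (k * l) \<in> P"
      using pw[OF kl(4), of k] x by (simp add: nat_pow_inv nat_pow_pow mult.commute)
    ultimately have "x [^] (k * l) \<in> torsion G" using Pi by blast
    then have "x \<in> torsion G" using root_in_torsion x kl by (metis nat_0_less_mult_iff)
    then show False using neg TP by blast
  qed
  then show thesis using that TP Pc Pm Pi by blast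
qed

end

text \<open>
  The quotient by the torsion subgroup is torsion-free abelian, hence orderable; the order is
  phrased here as a preorder on the group itself.
\<close>

definition biinvariant_preorder :: "('a, 'm) monoid_scheme \<Rightarrow> ('a \<Rightarrow> 'a \<Rightarrow> bool) \<Rightarrow> bool" where
  "biinvariant_preorder G leq \<longleftrightarrow>
    (\<forall>x\<in>carrier G. \<forall>y\<in>carrier G. leq x y \<or> leq y x) \<and>
    (\<forall>x\<in>carrier G. \<forall>y\<in>carrier G. \<forall>z\<in>carrier G. leq x y \<longrightarrow> leq y z \<longrightarrow> leq x z) \<and>
    (\<forall>x\<in>carrier G. \<forall>y\<in>carrier G. \<forall>a\<in>carrier G. \<forall>b\<in>carrier G.
       leq x y \<longrightarrow> leq a b \<longrightarrow> leq (x \<otimes>\<^bsub>G\<^esub> a) (y \<otimes>\<^bsub>G\<^esub> b)) \<and>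
    (\<forall>x\<in>carrier G. \<forall>y\<in>carrier G. leq x y \<and> leq y x \<longleftrightarrow> inv\<^bsub>G\<^esub> x \<otimes>\<^bsub>G\<^esub> y \<in> torsion G)"

section \<open>Bi-invariant preorders on an FC-group\<close>

context group
begin

text \<open>The cone defines the order by \<open>inv x \<otimes> y \<in> P\<close>. Since
  commutators are torsion and so lie in the cone, the cone is normal, which is what makes the order
  monotone in both factors at once.\<close>

lemma FC_group_preorder:
  assumes FC: "FC_group G"
  shows "\<exists>leq. biinvariant_preorder G leq"
proof -
  obtain P where P: "torsion G \<subseteq> P" "P \<subseteq> carrier G" "\<And>x y. x \<in> P \<Longrightarrow> y \<in> P \<Longrightarrow> x \<otimes> y \<in> P"
    "\<And>x. x \<in> P \<Longrightarrow> inv x \<in> P \<Longrightarrow> x \<in> torsion G"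
    "\<And>x. x \<in> carrier G \<Longrightarrow> x \<in> P \<or> inv x \<in> P"
    using torsion_free_quotient_cone[OF FC] by blast
  define leq where "leq = (\<lambda>x y. inv x \<otimes> y \<in> P)"
  have inv_leq: "inv (inv x \<otimes> y) = inv y \<otimes> x" if "x \<in> carrier G" "y \<in> carrier G" for x y
    using that by (simp add: inv_mult_group)
  have "biinvariant_preorder G leq"
    unfolding biinvariant_preorder_def
  proof (intro conjI ballI impI)
    fix x y assume xy: "x \<in> carrier G" "y \<in> carrier G"
    then show "leq x y \<or> leq y x" unfolding leq_def using P(5)[of "inv x \<otimes> y"] inv_leq by auto
    show "leq x y \<and> leq y x \<longleftrightarrow> inv x \<otimes> y \<in> torsion G"
      unfolding leq_def using inv_leq[OF xy] P(1,4) inv_in_torsion by (metis subsetD)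
  next
    fix x y z assume "x \<in> carrier G" "y \<in> carrier G" "z \<in> carrier G" "leq x y" "leq y z"
    then show "leq x z" unfolding leq_def using P(3)[of "inv x \<otimes> y" "inv y \<otimes> z"]
      by (simp add: m_assoc inv_cancel)
  next
    fix x y u v assume c: "x \<in> carrier G" "y \<in> carrier G" "u \<in> carrier G" "v \<in> carrier G"
      and "leq x y" "leq u v"
    then have p: "inv x \<otimes> y \<in> P" "inv u \<otimes> v \<in> P" unfolding leq_def by auto
    define p where "p = inv x \<otimes> y"
    have pc: "p \<in> carrier G" "p \<in> P" unfolding p_def using c p by auto
    let ?t = "inv p \<otimes> inv u \<otimes> inv (inv p) \<otimes> inv (inv u)"
    have "?t \<in> P" using pc c P(1) commutator_in_torsion[OF FC, of "inv p" "inv u"] by auto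
    then have "p \<otimes> ?t \<otimes> (inv u \<otimes> v) \<in> P"
      using P(3) pc p(2) by blast
    also have "p \<otimes> ?t \<otimes> (inv u \<otimes> v) = inv u \<otimes> p \<otimes> v"
      using pc c by (simp add: m_assoc inv_cancel)
    also have "\<dots> = inv (x \<otimes> u) \<otimes> (y \<otimes> v)"
      unfolding p_def using c by (simp add: m_assoc inv_mult_group)
    finally show "leq (x \<otimes> u) (y \<otimes> v)" unfolding leq_def .
  qed
  then show ?thesis by blast
qed

lemma exists_greatest:
  assumes leq: "biinvariant_preorder G leq" and F: "finite F" "F \<noteq> {}" "F \<subseteq> carrier G"
  shows "\<exists>m\<in>F. \<forall>x\<in>F. leq x m"
  using F
proof (induction F rule: finite_ne_induct)
  case (singleton x)
  then have "x \<in> carrier G" by simp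
  then have "leq x x" using leq unfolding biinvariant_preorder_def by blast
  then show ?case by simp
next
  case (insert x F)
  then obtain m where m: "m \<in> F" "\<forall>y\<in>F. leq y m" by auto
  have c: "x \<in> carrier G" "m \<in> carrier G" "F \<subseteq> carrier G" using insert m by auto
  note L = leq[unfolded biinvariant_preorder_def]
  have tot: "leq x m \<or> leq m x" "leq x x" using conjunct1[OF L] c by blast+
  have tr: "leq y x" if "y \<in> F" "leq y m" "leq m x" for y
    using conjunct1[OF conjunct2[OF L]] that c by blast
  show ?case
  proof (cases "leq x m")
    case True then show ?thesis using m by blast
  next
    case False
    then show ?thesis using tot tr m by (intro bexI[of _ x]) auto
  qed
qed

text \<open>Lets a single statement about leading terms serve for trailing terms as well.\<close>

lemma biinvariant_preorder_reverse:
  assumes "biinvariant_preorder G leq"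
  shows "biinvariant_preorder G (\<lambda>x y. leq y x)"
proof -
  have sym: "inv x \<otimes> y \<in> torsion G \<longleftrightarrow> inv y \<otimes> x \<in> torsion G" if "x \<in> carrier G" "y \<in> carrier G" for x y
    using that inv_in_torsion[of "inv x \<otimes> y"] inv_in_torsion[of "inv y \<otimes> x"] by (auto simp: inv_mult_group)
  note L = assms[unfolded biinvariant_preorder_def]
  show ?thesis
    unfolding biinvariant_preorder_def
  proof (intro conjI ballI impI)
    fix x y assume xy: "x \<in> carrier G" "y \<in> carrier G"
    show "leq y x \<or> leq x y" using conjunct1[OF L] xy by blast
    show "leq y x \<and> leq x y \<longleftrightarrow> inv x \<otimes> y \<in> torsion G"
      unfolding sym[OF xy] using conjunct2[OF conjunct2[OF conjunct2[OF L]]] xy by blast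
  next
    fix x y z assume "x \<in> carrier G" "y \<in> carrier G" "z \<in> carrier G" "leq y x" "leq z y"
    then show "leq z x" using conjunct1[OF conjunct2[OF L]] by blast
  next
    fix x y a b assume "x \<in> carrier G" "y \<in> carrier G" "a \<in> carrier G" "b \<in> carrier G" "leq y x" "leq b a"
    then show "leq (y \<otimes> b) (x \<otimes> a)" using conjunct1[OF conjunct2[OF conjunct2[OF L]]] by blast
  qed
qed

lemma biinvariant_preorder_cancel:
  assumes leq: "biinvariant_preorder G leq" and c: "x \<in> carrier G" "y \<in> carrier G" "z \<in> carrier G"
  shows "leq (x \<otimes> z) (y \<otimes> z) \<Longrightarrow> leq x y" "leq (z \<otimes> x) (z \<otimes> y) \<Longrightarrow> leq x y"
proof -
  have mono: "\<And>a b c d. a \<in> carrier G \<Longrightarrow> b \<in> carrier G \<Longrightarrow> c \<in> carrier G \<Longrightarrow> d \<in> carrier G \<Longrightarrow>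
      leq a b \<Longrightarrow> leq c d \<Longrightarrow> leq (a \<otimes> c) (b \<otimes> d)" and refl: "\<And>a. a \<in> carrier G \<Longrightarrow> leq a a"
    using leq unfolding biinvariant_preorder_def by blast+
  show "leq x y" if "leq (x \<otimes> z) (y \<otimes> z)"
    using mono[OF _ _ _ _ that refl[of "inv z"]] c by (simp add: m_assoc)
  show "leq x y" if "leq (z \<otimes> x) (z \<otimes> y)"
    using mono[OF _ _ _ _ refl[of "inv z"] that] c by (simp add: inv_cancel)
qed

end

section \<open>Wedderburn's little theorem\<close>

lemma (in monoid) Units_inv_cancel:
  "x \<in> Units G \<Longrightarrow> y \<in> carrier G \<Longrightarrow> inv x \<otimes> (x \<otimes> y) = y"
  "x \<in> Units G \<Longrightarrow> y \<in> carrier G \<Longrightarrow> x \<otimes> (inv x \<otimes> y) = y"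
  by (simp_all add: m_assoc[symmetric] Units_closed)

lemma (in monoid) Units_nat_pow_closed: "x \<in> Units G \<Longrightarrow> x [^] (n::nat) \<in> Units G"
  by (induction n) auto

lemma (in group_hom) card_kernel_mult_card_image:
  assumes "finite (carrier G)"
  shows "card (carrier G) = card (kernel G H h) * card (h ` carrier G)"
proof -
  have fibre: "card {x \<in> carrier G. h x = h y} = card (kernel G H h)" if y: "y \<in> carrier G" for y
  proof (rule bij_betw_same_card[symmetric])
    show "bij_betw (\<lambda>x. x \<otimes> y) (kernel G H h) {x \<in> carrier G. h x = h y}"
      unfolding kernel_def using y
      by (intro bij_betwI[of _ _ _ "\<lambda>x. x \<otimes> inv y"]) (auto simp: G.m_assoc)
  qed
  have "card (carrier G) = (\<Sum>z\<in>h ` carrier G. card {x \<in> carrier G. h x = z})"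
    using sum.image_gen[OF assms, of "\<lambda>_. 1::nat" h] by simp
  also have "\<dots> = (\<Sum>z\<in>h ` carrier G. card (kernel G H h))"
    using fibre by (intro sum.cong) auto
  finally show ?thesis by (simp add: mult.commute)
qed

context ring
begin

lemma finsum_shift:
  assumes "f \<in> UNIV \<rightarrow> carrier R"
  shows "(\<Oplus>k\<in>{..<n}. f (Suc k)) \<oplus> f 0 = (\<Oplus>k\<in>{..<n}. f k) \<oplus> f (n::nat)"
proof (induction n)
  case 0 then show ?case by simp
next
  case (Suc n)
  have c: "f k \<in> carrier R" for k using assms by auto
  have "(\<Oplus>k\<in>{..<Suc n}. f (Suc k)) \<oplus> f 0 = f (Suc n) \<oplus> ((\<Oplus>k\<in>{..<n}. f (Suc k)) \<oplus> f 0)"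
    unfolding lessThan_Suc using c by (subst finsum_insert) (auto simp: a_assoc)
  also have "\<dots> = (\<Oplus>k\<in>{..<Suc n}. f k) \<oplus> f (Suc n)"
    unfolding Suc lessThan_Suc using c by (subst finsum_insert) (auto simp: a_ac)
  finally show ?case .
qed

lemma finsum_cyclic_shift:
  assumes "f \<in> UNIV \<rightarrow> carrier R" "f n = f 0"
  shows "(\<Oplus>k\<in>{..<n}. f (Suc k)) = (\<Oplus>k\<in>{..<n::nat}. f k)"
proof -
  have c: "f k \<in> carrier R" for k using assms by auto
  have "(\<Oplus>k\<in>{..<n}. f (Suc k)) \<oplus> f 0 = (\<Oplus>k\<in>{..<n}. f k) \<oplus> f 0"
    using finsum_shift[OF assms(1)] assms(2) by simp
  then show ?thesis using c by (subst (asm) add.right_cancel) auto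
qed

lemma finsum_exchange:
  assumes "finite A" "finite B" "\<And>i j. i \<in> A \<Longrightarrow> j \<in> B \<Longrightarrow> f i j \<in> carrier R"
  shows "(\<Oplus>i\<in>A. \<Oplus>j\<in>B. f i j) = (\<Oplus>j\<in>B. \<Oplus>i\<in>A. f i j)"
  using assms(1,3)
proof (induction A)
  case empty then show ?case by (simp add: finsum_zero)
next
  case (insert a A)
  have "(\<Oplus>j\<in>B. \<Oplus>i\<in>insert a A. f i j) = (\<Oplus>j\<in>B. f a j \<oplus> (\<Oplus>i\<in>A. f i j))"
    using insert by (intro finsum_cong') (auto simp: Pi_def)
  also have "\<dots> = (\<Oplus>j\<in>B. f a j) \<oplus> (\<Oplus>j\<in>B. \<Oplus>i\<in>A. f i j)"
    using insert by (intro finsum_addf) (auto simp: Pi_def)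
  finally show ?case using insert by (subst finsum_insert) (auto simp: Pi_def)
qed

end

locale finite_division_ring = ring +
  assumes finite_carrier: "finite (carrier R)"
    and Units_eq: "Units R = carrier R - {\<zero>}"
begin

lemma zero_not_one: "\<zero> \<noteq> \<one>"
  using Units_eq Units_one_closed by auto

lemma nonzero_Units: "x \<in> carrier R \<Longrightarrow> x \<noteq> \<zero> \<Longrightarrow> x \<in> Units R"
  using Units_eq by auto

lemma Units_nonzero: "x \<in> Units R \<Longrightarrow> x \<noteq> \<zero>"
  using Units_eq by auto

lemma mult_eq_zero:
  assumes "a \<in> carrier R" "b \<in> carrier R" "a \<otimes> b = \<zero>" "a \<noteq> \<zero>"
  shows "b = \<zero>"
proof -
  have "a \<in> Units R" using assms nonzero_Units by auto
  then have "b = inv a \<otimes> (a \<otimes> b)" using Units_inv_cancel(1) assms(2) by metis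
  then show ?thesis using assms(3) \<open>a \<in> Units R\<close> by simp
qed

text \<open>\<open>m\<close> is the multiplicative order of \<open>x\<close>. It divides
  \<open>card (Units R)\<close>, which is one less than the order of the additive group; hence
  \<open>[m] \<cdot> v = \<zero>\<close> gives
  \<open>v = [card (carrier R)] \<cdot> v = \<zero>\<close>. This is the invertibility of
  \<open>m\<close> required for Fourier inversion.\<close>

lemma Units_pow_eq_one:
  assumes "x \<in> Units R"
  obtains m :: nat where "m > 0" "x [^] m = \<one>" "\<And>k. 0 < k \<Longrightarrow> k < m \<Longrightarrow> x [^] k \<noteq> \<one>"
    "\<And>v. v \<in> carrier R \<Longrightarrow> [m] \<cdot> v = \<zero> \<Longrightarrow> v = \<zero>"
proof -
  interpret U: group "units_of R" by (rule units_group)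
  have fin: "finite (carrier (units_of R))"
    unfolding units_of_carrier Units_eq using finite_carrier by auto
  have xU: "x \<in> carrier (units_of R)" using assms by (simp add: units_of_carrier)
  define m where "m = U.ord x"
  have pw: "x [^]\<^bsub>units_of R\<^esub> k = x [^] k" for k :: nat using units_of_pow assms by simp
  have "m > 0" unfolding m_def using U.ord_ge_1[OF fin xU] by simp
  moreover have "x [^] m = \<one>"
    using U.pow_ord_eq_1[OF xU] unfolding m_def pw units_of_one .
  moreover have "x [^] k \<noteq> \<one>" if "0 < k" "k < m" for k
    using that U.pow_eq_id[OF xU, of k] unfolding pw units_of_one m_def by (auto dest: dvd_imp_le)
  moreover have "v = \<zero>" if v: "v \<in> carrier R" "[m] \<cdot> v = \<zero>" for v
  proof -
    have dvd: "m dvd card (Units R)"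
      using U.ord_dvd_group_order[OF xU] unfolding m_def order_def units_of_carrier .
    then obtain q where q: "card (Units R) = m * q" by blast
    have "[card (Units R)] \<cdot> v = \<zero>"
      using v add.nat_pow_pow[of v q m] unfolding q by simp
    moreover have "card (carrier R) = Suc (card (Units R))"
      unfolding Units_eq by (rule card_Suc_Diff1[OF finite_carrier zero_closed, symmetric])
    moreover have "[card (carrier R)] \<cdot> v = \<zero>"
      using add.pow_order_eq_1 v(1) unfolding order_def by simp
    ultimately show ?thesis using v(1) by (simp add: add.nat_pow_Suc)
  qed
  ultimately show thesis using that by blast
qed

lemma geometric_sum_eq_zero:
  assumes h: "h \<in> carrier R" "h [^] (m::nat) = \<one>" "h \<noteq> \<one>"
  shows "(\<Oplus>j\<in>{..<m}. h [^] j) = \<zero>"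
proof -
  let ?S = "\<Oplus>j\<in>{..<m}. h [^] j"
  have S: "?S \<in> carrier R" using h by (intro finsum_closed) auto
  have "h \<otimes> ?S = (\<Oplus>j\<in>{..<m}. h [^] Suc j)"
    using h by (subst finsum_rdistr) (auto simp: nat_pow_Suc2[symmetric] intro!: finsum_cong')
  also have "\<dots> = ?S" using h by (intro finsum_cyclic_shift) auto
  finally have "(h \<ominus> \<one>) \<otimes> ?S = \<zero>"
    using h S by (simp add: minus_eq l_distr l_minus r_neg)
  then show ?thesis using mult_eq_zero[of "h \<ominus> \<one>" ?S] h S by auto
qed

text \<open>
  The sum \<open>v j\<close> below is a Fourier component of \<open>b\<close> for conjugation by \<open>g\<close>; it is an eigenvector,
  and the components add up to a multiple of \<open>b\<close> by the order of \<open>g\<close>, which is invertible.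
\<close>

lemma exists_eigenvector:
  assumes g: "g \<in> carrier R" and b: "b \<in> carrier R" and ne: "g \<otimes> b \<noteq> b \<otimes> g"
  obtains x and j :: nat where "x \<in> Units R" "x \<otimes> g = g [^] j \<otimes> x" "x \<otimes> g \<noteq> g \<otimes> x"
proof -
  have "g \<noteq> \<zero>" using ne b by auto
  then have gU: "g \<in> Units R" using g nonzero_Units by auto
  obtain m :: nat where m: "m > 0" "g [^] m = \<one>" "\<And>k. 0 < k \<Longrightarrow> k < m \<Longrightarrow> g [^] k \<noteq> \<one>"
    and tf: "\<And>v. v \<in> carrier R \<Longrightarrow> [m] \<cdot> v = \<zero> \<Longrightarrow> v = \<zero>"
    using Units_pow_eq_one[OF gU] by blast
  define f where "f = (\<lambda>j k::nat. g [^] (j * k) \<otimes> b \<otimes> g [^] k)"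
  define v where "v = (\<lambda>j. \<Oplus>k\<in>{..<m}. f j k)"
  have fc: "f j k \<in> carrier R" for j k unfolding f_def using g b by auto
  have vc: "v j \<in> carrier R" for j unfolding v_def using fc by auto
  have gm: "g [^] (j * m) = \<one>" for j
    using m(2) g nat_pow_pow[of g m j] by (simp add: mult.commute)
  have eig: "g [^] j \<otimes> v j \<otimes> g = v j" for j
  proof -
    have "g [^] j \<otimes> v j \<otimes> g = (\<Oplus>k\<in>{..<m}. g [^] j \<otimes> f j k \<otimes> g)"
      unfolding v_def using fc g by (subst finsum_rdistr, simp, simp, blast, subst finsum_ldistr) auto
    also have "\<dots> = (\<Oplus>k\<in>{..<m}. f j (Suc k))"
    proof (intro finsum_cong')
      fix k
      have "g [^] j \<otimes> f j k \<otimes> g = (g [^] j \<otimes> g [^] (j * k)) \<otimes> b \<otimes> (g [^] k \<otimes> g)"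
        unfolding f_def using g b by (simp add: m_assoc)
      then show "g [^] j \<otimes> f j k \<otimes> g = f j (Suc k)"
        unfolding f_def using g by (simp add: nat_pow_mult)
    qed (use fc in auto)
    also have "\<dots> = v j"
      unfolding v_def using fc g b m(2) gm by (intro finsum_cyclic_shift) (auto simp: f_def)
    finally show ?thesis .
  qed
  \<comment> \<open>Fourier inversion: summed over \<open>j\<close>, each term with
    \<open>k \<noteq> 0\<close> contains a geometric sum of a nontrivial root of unity and vanishes,
    and \<open>k = 0\<close> contributes \<open>[m] \<cdot> b\<close>. If all components commuted
    with \<open>g\<close>, so would \<open>b\<close>.\<close>
  have "(\<Oplus>j\<in>{..<m}. v j) = (\<Oplus>k\<in>{..<m}. \<Oplus>j\<in>{..<m}. f j k)"
    unfolding v_def using fc by (intro finsum_exchange) auto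
  also have "\<dots> = (\<Oplus>k\<in>{..<m}. if 0 = k then [m] \<cdot> b else \<zero>)"
  proof (intro finsum_cong')
    fix k assume k: "k \<in> {..<m}"
    have "(\<Oplus>j\<in>{..<m}. f j k) = (\<Oplus>j\<in>{..<m}. (g [^] k) [^] j \<otimes> (b \<otimes> g [^] k))"
      unfolding f_def using g b by (intro finsum_cong') (auto simp: nat_pow_pow m_assoc mult.commute)
    also have "\<dots> = (\<Oplus>j\<in>{..<m}. (g [^] k) [^] j) \<otimes> (b \<otimes> g [^] k)"
      using g b by (intro finsum_ldistr[symmetric]) auto
    also have "\<dots> = (if 0 = k then [m] \<cdot> b else \<zero>)"
    proof (cases "k = 0")
      case True
      then show ?thesis using b add_pow_ldistr[of \<one> b m] by (simp add: add.finprod_const)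
    next
      case False
      then have "g [^] k \<noteq> \<one>" using m(3) k by auto
      moreover have "(g [^] k) [^] m = \<one>" using gm[of k] g by (simp add: nat_pow_pow)
      ultimately show ?thesis using False geometric_sum_eq_zero g b by simp
    qed
    finally show "(\<Oplus>j\<in>{..<m}. f j k) = (if 0 = k then [m] \<cdot> b else \<zero>)" .
  qed (use b in auto)
  also have "\<dots> = [m] \<cdot> b"
    using finsum_singleton[of 0 "{..<m}" "\<lambda>_. [m] \<cdot> b"] m(1) b by simp
  finally have sum: "(\<Oplus>j\<in>{..<m}. v j) = [m] \<cdot> b" .
  have "\<exists>j. v j \<otimes> g \<noteq> g \<otimes> v j"
  proof (rule ccontr)
    assume "\<not> ?thesis"
    then have "(\<Oplus>j\<in>{..<m}. v j) \<otimes> g = g \<otimes> (\<Oplus>j\<in>{..<m}. v j)"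
      using vc g by (simp add: finsum_ldistr finsum_rdistr)
    then have "[m] \<cdot> (b \<otimes> g) = [m] \<cdot> (g \<otimes> b)"
      unfolding sum using g b by (simp add: add_pow_ldistr add_pow_rdistr)
    then have "[m] \<cdot> (b \<otimes> g \<ominus> g \<otimes> b) = \<zero>"
      using g b by (simp add: minus_eq add.nat_pow_distrib add.nat_pow_inv r_neg)
    then show False using tf[of "b \<otimes> g \<ominus> g \<otimes> b"] ne g b by auto
  qed
  then obtain j where j: "v j \<otimes> g \<noteq> g \<otimes> v j" by blast
  have "v j \<noteq> \<zero>" using j g by auto
  \<comment> \<open>The eigenvector equation needs the inverse of \<open>g [^] j\<close>; as
    \<open>g [^] m = \<one>\<close>, this is the nonnegative power with exponent
    \<open>(m - 1) * j\<close>.\<close>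
  moreover have "v j \<otimes> g = g [^] ((m - 1) * j) \<otimes> v j"
  proof -
    have "g [^] ((m - 1) * j) \<otimes> v j = g [^] ((m - 1) * j) \<otimes> (g [^] j \<otimes> v j \<otimes> g)" using eig by simp
    also have "\<dots> = g [^] ((m - 1) * j + j) \<otimes> (v j \<otimes> g)"
      using g vc by (simp add: nat_pow_mult[symmetric] m_assoc)
    also have "(m - 1) * j + j = j * m" using m(1) by (cases m) auto
    finally show ?thesis using gm g vc by simp
  qed
  ultimately show thesis using that[of "v j" "(m - 1) * j"] j vc nonzero_Units by blast
qed

text \<open>
  Dedekind's independence of automorphisms: the automorphisms of \<open>L\<close> are the conjugations by powers
  of \<open>y\<close>, and \<open>s k\<close> is the image of \<open>s 0\<close> under the \<open>k\<close>-th one.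
\<close>

lemma dedekind_independence:
  assumes L: "L \<subseteq> carrier R" "\<And>c d. c \<in> L \<Longrightarrow> d \<in> L \<Longrightarrow> c \<otimes> d = d \<otimes> c"
      "\<And>c d. c \<in> L \<Longrightarrow> d \<in> L \<Longrightarrow> c \<otimes> d \<in> L" "\<one> \<in> L"
    and y: "y \<in> Units R" and s: "\<And>k. s k \<in> L" "\<And>k. y \<otimes> s k = s (Suc k) \<otimes> y"
      "\<And>k. 0 < k \<Longrightarrow> k < n \<Longrightarrow> s k \<noteq> s 0"
    and d: "\<And>i. d i \<in> carrier R" and le: "m \<le> n"
    and sum: "\<And>c. c \<in> L \<Longrightarrow> (\<Oplus>i\<in>{..<m}. y [^] i \<otimes> c \<otimes> d i) = \<zero>"
    and i: "i < m"
  shows "d i = \<zero>"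
  using d le sum i
proof (induction m arbitrary: d i)
  case 0 then show ?case by simp
next
  case (Suc m)
  have yc: "y \<in> carrier R" using y Units_closed by auto
  have sc: "\<And>k. s k \<in> carrier R" and Lc: "\<And>c. c \<in> L \<Longrightarrow> c \<in> carrier R" using s L by auto
  have ys: "y [^] i \<otimes> s k = s (k + i) \<otimes> y [^] i" for i k
  proof (induction i)
    case (Suc i)
    have "y [^] Suc i \<otimes> s k = y \<otimes> (y [^] i \<otimes> s k)"
      using yc sc by (simp only: nat_pow_Suc2) (simp add: m_assoc)
    also have "\<dots> = s (Suc (k + i)) \<otimes> (y \<otimes> y [^] i)"
      unfolding Suc using yc sc s(2) by (simp add: m_assoc[symmetric])
    finally show ?case using yc by (simp only: nat_pow_Suc2) simp
  qed (use sc in simp)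
  have low: "d i = \<zero>" if im: "i < m" for i
  proof -
    \<comment> \<open>Subtract \<open>s m\<close> times the relation for \<open>c\<close> from the
      relation for \<open>c \<otimes> s 0\<close>. Carried past \<open>y [^] i\<close>, the factor
      \<open>s m\<close> becomes \<open>s (m - i)\<close>, so the term at \<open>i = m\<close>
      cancels and a shorter relation remains.\<close>
    have "(\<Oplus>i\<in>{..<m}. y [^] i \<otimes> c \<otimes> ((s 0 \<ominus> s (m - i)) \<otimes> d i)) = \<zero>" if c: "c \<in> L" for c
    proof -
      have cc: "c \<in> carrier R" using Lc c by auto
      let ?f = "\<lambda>i. y [^] i \<otimes> (c \<otimes> s 0) \<otimes> d i"
      let ?g = "\<lambda>i. y [^] i \<otimes> c \<otimes> d i"
      let ?h = "\<lambda>i. y [^] i \<otimes> c \<otimes> ((s 0 \<ominus> s (m - i)) \<otimes> d i)"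
      have fg: "?h i = ?f i \<oplus> (\<ominus> s m) \<otimes> ?g i" if "i \<le> m" for i
      proof -
        have "s m \<otimes> ?g i = (s ((m - i) + i) \<otimes> y [^] i) \<otimes> (c \<otimes> d i)"
          using that yc sc cc Suc.prems(1) by (simp add: m_assoc)
        also have "\<dots> = y [^] i \<otimes> (s (m - i) \<otimes> c) \<otimes> d i"
          unfolding ys[symmetric] using that yc sc cc Suc.prems(1) by (simp add: m_assoc)
        also have "s (m - i) \<otimes> c = c \<otimes> s (m - i)" using L(2) s(1) c by blast
        finally have "s m \<otimes> ?g i = y [^] i \<otimes> (c \<otimes> s (m - i)) \<otimes> d i" .
        then show ?thesis using yc sc cc Suc.prems(1)
          by (simp add: minus_eq l_distr r_distr l_minus r_minus m_assoc)
      qed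
      have "(\<Oplus>i\<in>{..<Suc m}. ?h i) = (\<Oplus>i\<in>{..<Suc m}. ?f i \<oplus> (\<ominus> s m) \<otimes> ?g i)"
        using fg yc sc cc Suc.prems(1) by (intro finsum_cong') auto
      also have "\<dots> = (\<Oplus>i\<in>{..<Suc m}. ?f i) \<oplus> (\<ominus> s m) \<otimes> (\<Oplus>i\<in>{..<Suc m}. ?g i)"
        using yc sc cc Suc.prems(1) by (subst finsum_addf) (auto simp: finsum_rdistr)
      also have "\<dots> = \<zero>" using Suc.prems(3)[of c] Suc.prems(3)[of "c \<otimes> s 0"] L(3) s(1) c sc by simp
      finally have "?h m \<oplus> (\<Oplus>i\<in>{..<m}. ?h i) = \<zero>"
        unfolding lessThan_Suc using yc sc cc Suc.prems(1) by (subst (asm) finsum_insert) auto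
      then show ?thesis using yc sc cc Suc.prems(1) by (simp add: minus_eq r_neg)
    qed
    then have "(s 0 \<ominus> s (m - i)) \<otimes> d i = \<zero>"
      using Suc.IH[of "\<lambda>i. (s 0 \<ominus> s (m - i)) \<otimes> d i" i] Suc.prems sc im by auto
    moreover have "s 0 \<ominus> s (m - i) \<noteq> \<zero>"
      using s(3)[of "m - i"] im Suc.prems(2) sc r_right_minus_eq by fastforce
    ultimately show ?thesis using mult_eq_zero sc Suc.prems(1) by blast
  qed
  have "d m = \<zero>"
  proof -
    have "(\<Oplus>i\<in>{..<Suc m}. y [^] i \<otimes> \<one> \<otimes> d i) = \<zero>" using Suc.prems(3) L(4) by blast
    then have "y [^] m \<otimes> d m \<oplus> (\<Oplus>i\<in>{..<m}. y [^] i \<otimes> d i) = \<zero>"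
      unfolding lessThan_Suc using yc Suc.prems(1) by (subst (asm) finsum_insert) auto
    moreover have "(\<Oplus>i\<in>{..<m}. y [^] i \<otimes> d i) = (\<Oplus>i\<in>{..<m}. \<zero>)"
      using low yc by (intro finsum_cong') auto
    ultimately have "y [^] m \<otimes> d m = \<zero>" using yc Suc.prems(1) by (simp add: finsum_zero)
    then show ?thesis
      using mult_eq_zero Units_nonzero Units_nat_pow_closed[OF y] Units_closed Suc.prems(1) by blast
  qed
  then show ?case using low Suc.prems(4) by (cases "i = m") auto
qed

text \<open>
  The element \<open>x\<close> induces an automorphism of order \<open>n\<close> on the finite field \<open>L\<close>. Hilbert's Theorem 90
  and counting show that the norm to the fixed field is surjective, so \<open>b\<close> in \<open>L\<close> can be chosen with
  \<open>y = b x\<close> satisfying \<open>y\<^sup>n = 1\<close>. Then the powers of \<open>y\<close> add up to zero, against independence.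
\<close>

lemma no_normalizing_element:
  fixes L :: "'a set" and x g :: 'a and n :: nat
  assumes L: "L \<subseteq> carrier R" "\<And>c d. c \<in> L \<Longrightarrow> d \<in> L \<Longrightarrow> c \<otimes> d = d \<otimes> c"
      "\<And>c d. c \<in> L \<Longrightarrow> d \<in> L \<Longrightarrow> c \<otimes> d \<in> L" "\<one> \<in> L"
      "\<And>c d. c \<in> L \<Longrightarrow> d \<in> L \<Longrightarrow> c \<oplus> d \<in> L" "\<zero> \<in> L"
      "\<And>c. c \<in> L \<Longrightarrow> c \<noteq> \<zero> \<Longrightarrow> inv c \<in> L"
    and x: "x \<in> Units R" "\<And>c. c \<in> L \<Longrightarrow> x \<otimes> c \<otimes> inv x \<in> L"
    and g: "g \<in> L" "\<And>k. 0 < k \<Longrightarrow> k < n \<Longrightarrow> x [^] k \<otimes> g \<noteq> g \<otimes> x [^] k"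
    and n: "n > 1" "x [^] n \<in> L"
  shows False
proof -
  have xc: "x \<in> carrier R" "inv x \<in> carrier R" using x Units_closed by auto
  have Lc: "\<And>c. c \<in> L \<Longrightarrow> c \<in> carrier R" using L(1) by auto
  have LU: "\<And>c. c \<in> L \<Longrightarrow> c \<noteq> \<zero> \<Longrightarrow> c \<in> Units R" using Lc nonzero_Units by auto
  define \<sigma> where "\<sigma> = (\<lambda>c. x \<otimes> c \<otimes> inv x)"
  have \<sigma>L: "\<sigma> c \<in> L" if "c \<in> L" for c unfolding \<sigma>_def using x(2) that .
  have \<sigma>x: "x \<otimes> c = \<sigma> c \<otimes> x" if "c \<in> carrier R" for c
    unfolding \<sigma>_def using that x xc by (simp add: m_assoc)
  have \<sigma>m: "\<sigma> (c \<otimes> d) = \<sigma> c \<otimes> \<sigma> d" if "c \<in> carrier R" "d \<in> carrier R" for c d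
    unfolding \<sigma>_def using that x xc by (simp add: m_assoc Units_inv_cancel)
  have \<sigma>1: "\<sigma> \<one> = \<one>" unfolding \<sigma>_def using x xc by simp
  have \<sigma>nz: "\<sigma> c \<noteq> \<zero>" if "c \<in> L" "c \<noteq> \<zero>" for c
  proof
    assume "\<sigma> c = \<zero>"
    then have "x \<otimes> c = \<zero>" using \<sigma>x[of c] Lc that xc by simp
    then show False using mult_eq_zero[of x c] that Lc xc Units_nonzero[OF x(1)] by blast
  qed
  define s where "s = (\<lambda>k. (\<sigma> ^^ k) g)"
  have sL: "s k \<in> L" for k unfolding s_def by (induction k) (use g \<sigma>L in auto)
  have s0: "s 0 = g" and sS: "\<And>k. s (Suc k) = \<sigma> (s k)" unfolding s_def by auto
  have xs: "x [^] k \<otimes> g = s k \<otimes> x [^] k" for k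
  proof (induction k)
    case 0 then show ?case using g Lc by (simp add: s0)
  next
    case (Suc k)
    have "x [^] Suc k \<otimes> g = x \<otimes> (s k \<otimes> x [^] k)"
      using Suc[symmetric] xc g Lc by (simp only: nat_pow_Suc2) (simp add: m_assoc)
    also have "\<dots> = s (Suc k) \<otimes> (x \<otimes> x [^] k)"
      using \<sigma>x[of "s k"] Lc[OF sL[of k]] Lc[OF sL[of "Suc k"]] xc by (simp add: m_assoc[symmetric] sS)
    finally show ?case using xc by (simp only: nat_pow_Suc2)
  qed
  have sne: "s k \<noteq> s 0" if "0 < k" "k < n" for k
    using xs[of k] g(2)[OF that] unfolding s0 by metis
  define z where "z = x [^] n"
  have zL: "z \<in> L" and zU: "z \<in> Units R" and zx: "z \<otimes> x = x \<otimes> z"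
    unfolding z_def using n x xc Units_nat_pow_closed by (auto simp: nat_pow_comm[of x n 1, simplified])
  \<comment> \<open>\<open>N k b\<close> is the product of \<open>b\<close>,
    \<open>\<sigma> b\<close>, up to the image of \<open>b\<close> under the power
    \<open>k - 1\<close> of \<open>\<sigma>\<close>; it is the coefficient in
    \<open>(b x)\<^sup>k = N k b x\<^sup>k\<close>. For \<open>k = n\<close> it is the norm to the
    fixed field.\<close>
  define N where "N = (\<lambda>k b. ((\<lambda>t. b \<otimes> \<sigma> t) ^^ k) \<one>)"
  have N0: "N 0 b = \<one>" and NS: "N (Suc k) b = b \<otimes> \<sigma> (N k b)" for k b unfolding N_def by auto
  have NL: "N k b \<in> L" if "b \<in> L" for k b
    by (induction k) (use that L \<sigma>L in \<open>auto simp: N0 NS\<close>)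
  have Nm: "N k (b \<otimes> c) = N k b \<otimes> N k c" if bc: "b \<in> L" "c \<in> L" for k b c
  proof (induction k)
    case (Suc k)
    let ?B = "\<sigma> (N k b)" and ?C = "\<sigma> (N k c)"
    have "b \<otimes> c \<otimes> (?B \<otimes> ?C) = b \<otimes> (c \<otimes> ?B) \<otimes> ?C"
      using bc NL \<sigma>L Lc by (simp add: m_assoc)
    also have "c \<otimes> ?B = ?B \<otimes> c" using bc NL \<sigma>L L(2) by blast
    finally show ?case using bc NL \<sigma>L Lc by (simp add: NS Suc \<sigma>m m_assoc)
  qed (use N0 in simp)
  have Npow: "(b \<otimes> x) [^] k = N k b \<otimes> x [^] k" if b: "b \<in> L" for k b
  proof (induction k)
    case (Suc k)
    have c: "b \<in> carrier R" "N k b \<in> carrier R" "\<sigma> (N k b) \<in> carrier R" using b NL \<sigma>L Lc by auto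
    have "(b \<otimes> x) [^] Suc k = b \<otimes> (x \<otimes> N k b) \<otimes> x [^] k"
      using c xc Suc by (simp only: nat_pow_Suc2 m_closed) (simp add: m_assoc)
    also have "\<dots> = b \<otimes> \<sigma> (N k b) \<otimes> (x \<otimes> x [^] k)"
      unfolding \<sigma>x[OF c(2)] using c xc by (simp add: m_assoc)
    finally show ?case using xc by (simp only: nat_pow_Suc2 NS)
  qed (simp add: N0)
  have bxU: "b \<otimes> x \<in> Units R" if "b \<in> L" "b \<noteq> \<zero>" for b using LU that x by auto
  have bxs: "(b \<otimes> x) \<otimes> s k = s (Suc k) \<otimes> (b \<otimes> x)" if b: "b \<in> L" for b k
  proof -
    have "(b \<otimes> x) \<otimes> s k = (b \<otimes> s (Suc k)) \<otimes> x"
      using b Lc sL xc \<sigma>x[of "s k"] by (simp add: m_assoc sS \<sigma>L)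
    also have "b \<otimes> s (Suc k) = s (Suc k) \<otimes> b" using L(2) b sL by blast
    finally show ?thesis using b Lc sL xc by (simp add: m_assoc)
  qed
  define F where "F = {c \<in> L - {\<zero>}. \<sigma> c = c}"
  have NF: "N n b \<in> F" if b: "b \<in> L" "b \<noteq> \<zero>" for b
  proof -
    have bc: "b \<in> carrier R" "b \<in> Units R" and Nc: "N n b \<in> carrier R" and zc: "z \<in> carrier R"
      using b Lc LU NL zL by auto
    have e: "(b \<otimes> x) [^] n = N n b \<otimes> z" using Npow b z_def by simp
    have U: "N n b \<otimes> z \<in> Units R" using e Units_nat_pow_closed bxU b by metis
    then have nz: "N n b \<noteq> \<zero>" using Units_nonzero[of \<zero>] zc by auto
    \<comment> \<open>The power \<open>(b x)\<^sup>n\<close>, equal to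
      \<open>N n b \<otimes> z\<close>, commutes with \<open>b x\<close>. Cancelling
      \<open>b\<close> and \<open>z\<close> leaves \<open>N n b\<close> commuting with
      \<open>x\<close>, that is, fixed by \<open>\<sigma>\<close>.\<close>
    have "(b \<otimes> x) \<otimes> (N n b \<otimes> z) = (N n b \<otimes> z) \<otimes> (b \<otimes> x)"
      unfolding e[symmetric] using bc xc nat_pow_comm[of "b \<otimes> x" 1 n] by simp
    also have "\<dots> = N n b \<otimes> (z \<otimes> b) \<otimes> x" using bc xc zc Nc by (simp add: m_assoc)
    also have "z \<otimes> b = b \<otimes> z" using zL b L(2) by blast
    also have "N n b \<otimes> (b \<otimes> z) \<otimes> x = (N n b \<otimes> b) \<otimes> (z \<otimes> x)" using bc xc zc Nc by (simp add: m_assoc)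
    also have "N n b \<otimes> b = b \<otimes> N n b" using NL b L(2) by blast
    finally have "b \<otimes> (x \<otimes> N n b \<otimes> z) = b \<otimes> (N n b \<otimes> x \<otimes> z)"
      unfolding zx using bc xc zc Nc by (simp add: m_assoc)
    then have "x \<otimes> N n b \<otimes> z = N n b \<otimes> x \<otimes> z" using bc xc zc Nc by simp
    then have "x \<otimes> N n b = N n b \<otimes> x"
      by (metis zU zc Nc xc(1) m_closed Units_r_inv Units_inv_closed m_assoc r_one)
    then have "\<sigma> (N n b) = N n b" unfolding \<sigma>_def using x xc Nc by (simp add: m_assoc)
    then show ?thesis unfolding F_def using nz NL b by auto
  qed
  \<comment> \<open>\<open>c\<close> is the Lagrange resolvent, the sum of the terms
    \<open>y [^] i \<otimes> \<theta> \<otimes> inv x [^] i\<close>; independence provides a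
    \<open>\<theta>\<close> for which it is nonzero. Norm one means
    \<open>y [^] n = x [^] n\<close>, so the terms have period \<open>n\<close> and
    \<open>y c x\<^sup>-\<^sup>1 = c\<close>, which reads
    \<open>b \<otimes> \<sigma> c = c\<close>.\<close>
  have hilbert90: "\<exists>c\<in>L - {\<zero>}. b = c \<otimes> inv (\<sigma> c)" if b: "b \<in> L" "b \<noteq> \<zero>" and Nb: "N n b = \<one>" for b
  proof -
    define y where "y = b \<otimes> x"
    have bc: "b \<in> carrier R" using b Lc by auto
    have yU: "y \<in> Units R" and yc: "y \<in> carrier R" unfolding y_def using bxU b Units_closed by auto
    have yn: "y [^] n = z" unfolding y_def using Npow[OF b(1)] Nb z_def xc by simp
    have ixc: "inv x [^] i \<in> carrier R" for i :: nat using xc by simp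
    have "\<exists>\<theta>\<in>L. (\<Oplus>i\<in>{..<n}. y [^] i \<otimes> \<theta> \<otimes> inv x [^] i) \<noteq> \<zero>"
    proof (rule ccontr)
      assume neg: "\<not> ?thesis"
      have "inv x [^] (0::nat) = \<zero>"
        by (rule dedekind_independence[of L y s n "\<lambda>i. inv x [^] i" n])
           (use L yU sL bxs[OF b(1)] sne ixc neg n y_def in auto)
      then show False using zero_not_one by simp
    qed
    then obtain \<theta> where \<theta>: "\<theta> \<in> L" "(\<Oplus>i\<in>{..<n}. y [^] i \<otimes> \<theta> \<otimes> inv x [^] i) \<noteq> \<zero>" by blast
    define f where "f = (\<lambda>i::nat. y [^] i \<otimes> \<theta> \<otimes> inv x [^] i)"
    define c where "c = (\<Oplus>i\<in>{..<n}. f i)"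
    have \<theta>c: "\<theta> \<in> carrier R" using \<theta> Lc by auto
    have fc: "f i \<in> carrier R" for i unfolding f_def using yc ixc \<theta>c by auto
    have xixk: "x [^] i \<otimes> inv x [^] i = \<one>" for i :: nat
    proof (induction i)
      case (Suc i)
      have "x [^] Suc i \<otimes> inv x [^] Suc i = x [^] i \<otimes> (x \<otimes> (inv x \<otimes> inv x [^] i))"
        unfolding nat_pow_Suc2[OF xc(2)] nat_pow_Suc[of x] using xc ixc[of i] by (intro m_assoc) auto
      then show ?case using Suc x ixc xc by (simp add: Units_inv_cancel)
    qed simp
    have xi\<theta>: "x [^] i \<otimes> \<theta> \<otimes> inv x [^] i \<in> L" for i :: nat
    proof (induction i)
      case (Suc i)
      have "x [^] Suc i \<otimes> \<theta> \<otimes> inv x [^] Suc i = \<sigma> (x [^] i \<otimes> \<theta> \<otimes> inv x [^] i)"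
        unfolding \<sigma>_def using xc ixc \<theta>c by (simp only: nat_pow_Suc2[OF xc(1)]) (simp add: m_assoc)
      then show ?case using \<sigma>L Suc by metis
    qed (use \<theta> \<theta>c in simp)
    have fL: "f i \<in> L" for i
    proof -
      have "f i = N i b \<otimes> (x [^] i \<otimes> \<theta> \<otimes> inv x [^] i)"
        unfolding f_def y_def Npow[OF b(1)] using NL[OF b(1)] Lc xc ixc \<theta>c by (simp add: m_assoc)
      then show ?thesis using NL[OF b(1)] xi\<theta> L(3) by simp
    qed
    have "(\<Oplus>i\<in>{..<k}. f i) \<in> L" for k :: nat
    proof (induction k)
      case 0 then show ?case using L(6) by simp
    next
      case (Suc k) then show ?case unfolding lessThan_Suc using fc fL L(5) by (subst finsum_insert) auto
    qed
    then have cL: "c \<in> L" unfolding c_def .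
    have cnz: "c \<noteq> \<zero>" using \<theta> unfolding c_def f_def by simp
    have "y \<otimes> c \<otimes> inv x = (\<Oplus>i\<in>{..<n}. y \<otimes> f i \<otimes> inv x)"
      unfolding c_def using fc yc xc by (subst finsum_rdistr, simp, simp, blast, subst finsum_ldistr) auto
    also have "\<dots> = (\<Oplus>i\<in>{..<n}. f (Suc i))"
    proof (intro finsum_cong')
      fix i
      show "y \<otimes> f i \<otimes> inv x = f (Suc i)"
        unfolding f_def nat_pow_Suc2[OF yc] nat_pow_Suc[of "inv x"]
        using yc xc ixc[of i] \<theta>c by (simp add: m_assoc)
    qed (use fc in auto)
    also have "\<dots> = c"
      unfolding c_def
    proof (intro finsum_cyclic_shift)
      have "f n = \<theta> \<otimes> (z \<otimes> inv x [^] n)"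
        unfolding f_def yn using L(2)[OF zL \<theta>(1)] \<theta>c zL Lc ixc by (simp add: m_assoc)
      then show "f n = f 0" using xixk \<theta>c unfolding z_def f_def by simp
    qed (use fc in auto)
    finally have "b \<otimes> \<sigma> c = c"
      unfolding y_def \<sigma>_def using bc xc cL Lc by (simp add: m_assoc)
    then have "b = c \<otimes> inv (\<sigma> c)"
      using LU[OF \<sigma>L[OF cL] \<sigma>nz[OF cL cnz]] bc by (metis Units_closed Units_inv_closed Units_r_inv m_assoc r_one)
    then show ?thesis using cL cnz by blast
  qed
  define A where "A = (units_of R)\<lparr>carrier := L - {\<zero>}\<rparr>"
  have Acar: "carrier A = L - {\<zero>}" and Amul: "monoid.mult A = monoid.mult R" and Aone: "one A = \<one>"
    unfolding A_def units_of_def by auto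
  have Lm: "c \<otimes> d \<in> L - {\<zero>}" if "c \<in> L - {\<zero>}" "d \<in> L - {\<zero>}" for c d
    using that L(3) mult_eq_zero Lc by blast
  interpret U: group "units_of R" by (rule units_group)
  have "subgroup (L - {\<zero>}) (units_of R)"
  proof (rule U.subgroupI)
    show "L - {\<zero>} \<subseteq> carrier (units_of R)" unfolding units_of_carrier using LU by blast
    show "L - {\<zero>} \<noteq> {}" using L(4) zero_not_one by auto
    show "inv\<^bsub>units_of R\<^esub> a \<in> L - {\<zero>}" if "a \<in> L - {\<zero>}" for a
    proof -
      have aU: "a \<in> Units R" and "inv a \<in> L" using that LU L(7) by auto
      moreover have "inv a \<noteq> \<zero>" using Units_nonzero[OF Units_inv_Units[OF aU]] .
      ultimately show ?thesis using units_of_inv[OF aU] by simp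
    qed
    show "a \<otimes>\<^bsub>units_of R\<^esub> b \<in> L - {\<zero>}" if "a \<in> L - {\<zero>}" "b \<in> L - {\<zero>}" for a b
      using Lm that unfolding units_of_mult by blast
  qed
  then have "group A" unfolding A_def by (rule U.subgroup_imp_group)
  then interpret A: group A .
  have finA: "finite (carrier A)"
    unfolding Acar using finite_subset[OF L(1) finite_carrier] by simp
  define \<psi> where "\<psi> = (\<lambda>c. c \<otimes> inv (\<sigma> c))"
  have \<psi>A: "\<psi> c \<in> L - {\<zero>}" if "c \<in> L - {\<zero>}" for c
  proof -
    have "\<sigma> c \<in> L" "\<sigma> c \<noteq> \<zero>" using that \<sigma>L \<sigma>nz by auto
    then have "inv (\<sigma> c) \<in> L - {\<zero>}" using L(7) LU Units_nonzero[OF Units_inv_Units] by blast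
    then show ?thesis unfolding \<psi>_def using that Lm by blast
  qed
  interpret NN: group_hom A A "N n"
  proof (unfold_locales, rule homI)
    show "N n b \<in> carrier A" if "b \<in> carrier A" for b using that NF unfolding Acar F_def by blast
    show "N n (b \<otimes>\<^bsub>A\<^esub> c) = N n b \<otimes>\<^bsub>A\<^esub> N n c" if "b \<in> carrier A" "c \<in> carrier A" for b c
      using that Nm unfolding Acar Amul by blast
  qed
  interpret PP: group_hom A A \<psi>
  proof (unfold_locales, rule homI)
    show "\<psi> b \<in> carrier A" if "b \<in> carrier A" for b using that \<psi>A unfolding Acar by blast
    fix b c assume "b \<in> carrier A" "c \<in> carrier A"
    then have bc: "b \<in> L" "c \<in> L" "b \<noteq> \<zero>" "c \<noteq> \<zero>" unfolding Acar by auto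
    let ?b = "inv (\<sigma> b)" and ?c = "inv (\<sigma> c)"
    have u: "\<sigma> b \<in> Units R" "\<sigma> c \<in> Units R" using LU \<sigma>L \<sigma>nz bc by auto
    have m: "?b \<in> L" "?c \<in> L" using bc \<sigma>L \<sigma>nz L(7) by auto
    have "inv (\<sigma> (b \<otimes> c)) = ?c \<otimes> ?b"
      using \<sigma>m[of b c] bc Lc u by (metis U.inv_mult_group Units_m_closed units_of_carrier units_of_inv units_of_mult)
    then have "\<psi> (b \<otimes> c) = b \<otimes> ((c \<otimes> ?c) \<otimes> ?b)"
      unfolding \<psi>_def using bc m Lc by (simp add: m_assoc)
    also have "(c \<otimes> ?c) \<otimes> ?b = ?b \<otimes> (c \<otimes> ?c)" using L(2,3) bc m by blast
    finally show "\<psi> (b \<otimes>\<^bsub>A\<^esub> c) = \<psi> b \<otimes>\<^bsub>A\<^esub> \<psi> c"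
      unfolding \<psi>_def Amul using bc m Lc by (simp add: m_assoc)
  qed
  have kerP: "kernel A A \<psi> = F"
  proof -
    have "\<psi> c = \<one> \<longleftrightarrow> \<sigma> c = c" if "c \<in> L - {\<zero>}" for c
    proof -
      have u: "\<sigma> c \<in> Units R" "c \<in> carrier R" "\<sigma> c \<in> carrier R" using LU \<sigma>L \<sigma>nz that Lc by auto
      show ?thesis unfolding \<psi>_def
      proof
        assume "c \<otimes> inv (\<sigma> c) = \<one>"
        then have "c \<otimes> inv (\<sigma> c) \<otimes> \<sigma> c = \<sigma> c" using u by simp
        then show "\<sigma> c = c" using u by (simp add: m_assoc)
      qed (use u Units_r_inv in metis)
    qed
    then show ?thesis unfolding kernel_def Acar Aone F_def by auto
  qed
  have "kernel A A (N n) \<subseteq> \<psi> ` carrier A"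
    using hilbert90 unfolding kernel_def Acar Aone \<psi>_def by auto
  then have k: "card (kernel A A (N n)) \<le> card (\<psi> ` carrier A)"
    using finA by (intro card_mono) auto
  have pos: "card (kernel A A (N n)) > 0"
  proof -
    have "\<one>\<^bsub>A\<^esub> \<in> kernel A A (N n)" using subgroup.one_closed[OF NN.subgroup_kernel] .
    moreover have "finite (kernel A A (N n))" using finA unfolding kernel_def by simp
    ultimately show ?thesis by (auto simp: card_gt_0_iff)
  qed
  \<comment> \<open>The nonzero elements of \<open>L\<close> are counted through
    \<open>\<psi>\<close> and through the norm. Since the kernel of the norm is no larger than the
    image of \<open>\<psi>\<close>, the image of the norm is at least as large as \<open>F\<close>,
    hence equal to it.\<close>
  have "card F * card (\<psi> ` carrier A) = card (kernel A A (N n)) * card (N n ` carrier A)"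
    using NN.card_kernel_mult_card_image[OF finA] PP.card_kernel_mult_card_image[OF finA] kerP by simp
  moreover have "card F * card (kernel A A (N n)) \<le> card F * card (\<psi> ` carrier A)" using k by simp
  ultimately have "card F \<le> card (N n ` carrier A)" using pos by (simp add: mult.commute)
  moreover have "N n ` carrier A \<subseteq> F" using NF unfolding Acar by auto
  moreover have "finite F" using finA unfolding F_def Acar by auto
  ultimately have img: "N n ` carrier A = F" by (simp add: card_seteq)
  have "inv z \<in> F"
  proof -
    have zc: "z \<in> carrier R" "inv z \<in> carrier R" using zL Lc zU by auto
    have "inv z \<in> L - {\<zero>}" using zL zU L(7) Units_nonzero[OF zU] Units_nonzero[OF Units_inv_Units[OF zU]] by blast
    moreover have "x \<otimes> inv z = inv z \<otimes> x"
    proof -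
      have "inv z \<otimes> (z \<otimes> x) \<otimes> inv z = inv z \<otimes> (x \<otimes> z) \<otimes> inv z" using zx by simp
      then show ?thesis using xc zc zU by (simp add: m_assoc Units_inv_cancel)
    qed
    then have "\<sigma> (inv z) = inv z" unfolding \<sigma>_def using x xc zc by (simp add: m_assoc)
    ultimately show ?thesis unfolding F_def by auto
  qed
  then obtain b where b: "b \<in> L" "b \<noteq> \<zero>" "N n b = inv z" using img unfolding Acar by fastforce
  define y where "y = b \<otimes> x"
  have yU: "y \<in> Units R" and yc: "y \<in> carrier R" unfolding y_def using bxU b Units_closed by auto
  have yn: "y [^] n = \<one>" unfolding y_def using Npow[OF b(1)] b z_def[symmetric] zU by simp
  have ys: "\<And>k. y \<otimes> s k = s (Suc k) \<otimes> y" unfolding y_def using bxs[OF b(1)] .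
  \<comment> \<open>\<open>y\<close> carries \<open>s 0\<close> to \<open>s 1\<close>, and these
    differ because \<open>n > 1\<close>.\<close>
  have "y \<noteq> \<one>" using ys[of 0] sne[of 1] n sL Lc by auto
  then have S0: "(\<Oplus>i\<in>{..<n}. y [^] i) = \<zero>" using geometric_sum_eq_zero yc yn by blast
  have "\<one> = \<zero>"
  proof (rule dedekind_independence[of L y s n "\<lambda>_. \<one>" n 0])
    fix c assume "c \<in> L"
    then have cc: "c \<in> carrier R" using Lc by auto
    have "(\<Oplus>i\<in>{..<n}. y [^] i \<otimes> c \<otimes> \<one>) = (\<Oplus>i\<in>{..<n}. y [^] i) \<otimes> c"
      using cc yc by (subst finsum_ldistr) auto
    then show "(\<Oplus>i\<in>{..<n}. y [^] i \<otimes> c \<otimes> \<one>) = \<zero>" using S0 cc by simp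
  qed (use L yU sL ys sne n in auto)
  then show False using zero_not_one by simp
qed

text \<open>A noncommuting pair gives a unit \<open>x\<close> with \<open>x g = g\<^sup>j x\<close>
  that does not commute with \<open>g\<close>. With \<open>n\<close> least such that
  \<open>z = x\<^sup>n\<close> commutes with \<open>g\<close>, let \<open>C\<close> be the
  centraliser of \<open>g\<close> and \<open>z\<close>, and \<open>L\<close> its centre. Conjugation
  by \<open>x\<close> respects \<open>C\<close>, since \<open>x\<close> only turns \<open>g\<close>
  into a power of \<open>g\<close> and commutes with \<open>z\<close>; hence it maps the field
  \<open>L\<close> into itself. As \<open>L\<close> contains \<open>g\<close> and \<open>z\<close>,
  this contradicts \<open>no_normalizing_element\<close>.\<close>

theorem wedderburn_little:
  assumes g: "g \<in> carrier R" and b: "b \<in> carrier R"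
  shows "g \<otimes> b = b \<otimes> g"
proof (rule ccontr)
  assume gb: "g \<otimes> b \<noteq> b \<otimes> g"
  obtain x j where x: "x \<in> Units R" and xg: "x \<otimes> g = g [^] (j::nat) \<otimes> x" and ne: "x \<otimes> g \<noteq> g \<otimes> x"
    by (rule exists_eigenvector[OF g b gb])
  have xc: "x \<in> carrier R" "inv x \<in> carrier R" using x Units_closed by auto
  obtain m :: nat where m: "m > 0" "x [^] m = \<one>"
    by (rule Units_pow_eq_one[OF x], rule that)
  define n where "n = (LEAST n::nat. n > 0 \<and> x [^] n \<otimes> g = g \<otimes> x [^] n)"
  have "n > 0 \<and> x [^] n \<otimes> g = g \<otimes> x [^] n"
    unfolding n_def by (rule LeastI[of "\<lambda>n::nat. n > 0 \<and> x [^] n \<otimes> g = g \<otimes> x [^] n" m]) (use m g in simp)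
  moreover have min: "x [^] k \<otimes> g \<noteq> g \<otimes> x [^] k" if "0 < k" "k < n" for k
    using not_less_Least[of k "\<lambda>n::nat. n > 0 \<and> x [^] n \<otimes> g = g \<otimes> x [^] n"] that unfolding n_def by auto
  ultimately have n: "n > 0" "x [^] n \<otimes> g = g \<otimes> x [^] n" by auto
  have n1: "n > 1" using n ne xc by (cases "n = 1") auto
  define z where "z = x [^] n"
  have zc: "z \<in> carrier R" and zg: "z \<otimes> g = g \<otimes> z" and zx: "z \<otimes> x = x \<otimes> z"
    unfolding z_def using xc n nat_pow_comm[of x n 1] by auto
  define C where "C = {d \<in> carrier R. d \<otimes> g = g \<otimes> d \<and> d \<otimes> z = z \<otimes> d}"
  define L where "L = {c \<in> carrier R. \<forall>d\<in>C. c \<otimes> d = d \<otimes> c}"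
  have LC: "L \<subseteq> C" unfolding L_def C_def using g zc zg by auto
  have gL: "g \<in> L" and zL: "z \<in> L" unfolding L_def C_def using g zc by auto
  show False
  proof (rule no_normalizing_element[of L x g n])
    show "L \<subseteq> carrier R" unfolding L_def by auto
    show "c \<otimes> d = d \<otimes> c" if "c \<in> L" "d \<in> L" for c d using that LC unfolding L_def by blast
    show "c \<otimes> d \<in> L" if "c \<in> L" "d \<in> L" for c d
    proof -
      have cd: "c \<in> carrier R" "d \<in> carrier R" and com: "\<And>e. e \<in> C \<Longrightarrow> c \<otimes> e = e \<otimes> c" "\<And>e. e \<in> C \<Longrightarrow> d \<otimes> e = e \<otimes> d"
        using that unfolding L_def by auto
      have "c \<otimes> d \<otimes> e = e \<otimes> (c \<otimes> d)" if e: "e \<in> C" for e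
      proof -
        have ec: "e \<in> carrier R" using e unfolding C_def by auto
        have "c \<otimes> d \<otimes> e = c \<otimes> e \<otimes> d" using cd ec com(2)[OF e] by (simp add: m_assoc)
        then show ?thesis using cd ec com(1)[OF e] by (simp add: m_assoc)
      qed
      then show ?thesis unfolding L_def using cd by auto
    qed
    show "\<one> \<in> L" "\<zero> \<in> L" unfolding L_def C_def by auto
    show "c \<oplus> d \<in> L" if "c \<in> L" "d \<in> L" for c d
      using that unfolding L_def C_def by (auto simp: l_distr r_distr)
    show "inv c \<in> L" if "c \<in> L" "c \<noteq> \<zero>" for c
    proof -
      have c: "c \<in> Units R" "c \<in> carrier R" using that nonzero_Units unfolding L_def by auto
      have "inv c \<otimes> e = e \<otimes> inv c" if e: "e \<in> C" for e
      proof -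
        have ec: "e \<in> carrier R" using e unfolding C_def by auto
        have "inv c \<otimes> (e \<otimes> c) \<otimes> inv c = inv c \<otimes> (c \<otimes> e) \<otimes> inv c"
          using e \<open>c \<in> L\<close> unfolding L_def by auto
        then show ?thesis using c ec by (simp add: m_assoc Units_inv_cancel)
      qed
      then show ?thesis unfolding L_def using c by auto
    qed
    show "x \<otimes> c \<otimes> inv x \<in> L" if c: "c \<in> L" for c
    proof -
      have cc: "c \<in> carrier R" using c unfolding L_def by auto
      have gx: "inv x \<otimes> g [^] j = g \<otimes> inv x"
      proof -
        have "inv x \<otimes> (g [^] j \<otimes> x) \<otimes> inv x = inv x \<otimes> (x \<otimes> g) \<otimes> inv x" using xg by simp
        then show ?thesis using x xc g by (simp add: m_assoc Units_inv_cancel)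
      qed
      have zix: "inv x \<otimes> z = z \<otimes> inv x"
      proof -
        have "inv x \<otimes> (z \<otimes> x) \<otimes> inv x = inv x \<otimes> (x \<otimes> z) \<otimes> inv x" using zx by simp
        then show ?thesis using x xc zc by (simp add: m_assoc Units_inv_cancel)
      qed
      have "x \<otimes> c \<otimes> inv x \<otimes> d = d \<otimes> (x \<otimes> c \<otimes> inv x)" if d: "d \<in> C" for d
      proof -
        have dc: "d \<in> carrier R" and dg: "d \<otimes> g = g \<otimes> d" and dz: "d \<otimes> z = z \<otimes> d"
          using d unfolding C_def by auto
        have dgj: "d \<otimes> g [^] k = g [^] k \<otimes> d" for k :: nat
        proof (induction k)
          case (Suc k)
          have "d \<otimes> g [^] Suc k = (d \<otimes> g [^] k) \<otimes> g" using dc g by (simp add: m_assoc)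
          also have "\<dots> = g [^] Suc k \<otimes> d" unfolding Suc using dc g dg by (simp add: m_assoc)
          finally show ?case .
        qed (use dc in simp)
        let ?e = "inv x \<otimes> d \<otimes> x"
        have "?e \<otimes> g = inv x \<otimes> (d \<otimes> g [^] j) \<otimes> x" using dc xc g xg by (simp add: m_assoc)
        also have "\<dots> = (inv x \<otimes> g [^] j) \<otimes> d \<otimes> x" unfolding dgj using dc xc g by (simp add: m_assoc)
        also have "\<dots> = g \<otimes> ?e" unfolding gx using dc xc g by (simp add: m_assoc)
        finally have eg: "?e \<otimes> g = g \<otimes> ?e" .
        have "?e \<otimes> z = inv x \<otimes> (d \<otimes> z) \<otimes> x" using dc xc zc zx by (simp add: m_assoc)
        also have "\<dots> = (inv x \<otimes> z) \<otimes> d \<otimes> x" unfolding dz using dc xc zc by (simp add: m_assoc)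
        also have "\<dots> = z \<otimes> ?e" unfolding zix using dc xc zc by (simp add: m_assoc)
        finally have "?e \<in> C" unfolding C_def using eg dc xc by auto
        then have "x \<otimes> (c \<otimes> ?e) \<otimes> inv x = x \<otimes> (?e \<otimes> c) \<otimes> inv x" using c unfolding L_def by auto
        then show ?thesis using dc xc x cc by (simp add: m_assoc Units_inv_cancel)
      qed
      then show ?thesis unfolding L_def using cc xc by auto
    qed
  qed (use x gL zL n1 min z_def in auto)
qed

end

section \<open>Central idempotents and corner rings\<close>

lemma ring_hom_RDirProd_list:
  assumes "ring R" "\<And>S f. (S, f) \<in> set Ss \<Longrightarrow> f \<in> ring_hom R S"
  shows "(\<lambda>a. map (\<lambda>(S, f). f a) Ss) \<in> ring_hom R (RDirProd_list (map fst Ss))"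
  using assms(2)
proof (induction Ss)
  case Nil
  interpret ring R by fact
  show ?case by (auto intro!: ring_hom_memI simp: monoid.defs)
next
  case (Cons p Ss)
  obtain S f where p: "p = (S, f)" by force
  let ?h = "\<lambda>a. map (\<lambda>(S, f). f a) Ss"
  have "(\<lambda>(r, s). (f r, ?h s)) \<in> ring_hom (RDirProd R R) (RDirProd S (RDirProd_list (map fst Ss)))"
    using Cons p by (intro RDirProd_hom3) auto
  then have "(\<lambda>(a, as). a # as) \<circ> ((\<lambda>(r, s). (f r, ?h s)) \<circ> (\<lambda>a. (a, a))) \<in>
      ring_hom R (RDirProd_list (S # map fst Ss))"
    by (intro ring_hom_trans[OF _ RDirProd_list_hom1] ring_hom_trans[OF RDirProd_hom1])
  then show ?case using p by (simp add: comp_def)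
qed

text \<open>The one-sided condition suffices because \<open>e\<close> will always be central. The
  result is a plain \<open>ring\<close> whatever extension \<open>R\<close> carries, as the summands
  in \<open>direct_sum_of_fields\<close> require.\<close>

definition corner :: "('a, 'm) ring_scheme \<Rightarrow> 'a \<Rightarrow> 'a ring" where
  "corner R e = \<lparr>carrier = {x \<in> carrier R. e \<otimes>\<^bsub>R\<^esub> x = x}, monoid.mult = monoid.mult R, one = e,
     ring.zero = \<zero>\<^bsub>R\<^esub>, add = add R\<rparr>"

lemma corner_simps [simp]:
  "carrier (corner R e) = {x \<in> carrier R. e \<otimes>\<^bsub>R\<^esub> x = x}"
  "x \<otimes>\<^bsub>corner R e\<^esub> y = x \<otimes>\<^bsub>R\<^esub> y" "\<one>\<^bsub>corner R e\<^esub> = e" "\<zero>\<^bsub>corner R e\<^esub> = \<zero>\<^bsub>R\<^esub>"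
  "x \<oplus>\<^bsub>corner R e\<^esub> y = x \<oplus>\<^bsub>R\<^esub> y"
  by (simp_all add: corner_def)

definition primitive_idempotents :: "('a, 'm) ring_scheme \<Rightarrow> 'a set" where
  "primitive_idempotents R = {e \<in> idempotents R. e \<noteq> \<zero>\<^bsub>R\<^esub> \<and>
     (\<forall>f\<in>idempotents R. e \<otimes>\<^bsub>R\<^esub> f = f \<longrightarrow> f = \<zero>\<^bsub>R\<^esub> \<or> f = e)}"

context ring
begin

lemma corner_ring:
  assumes "e \<in> center R" "e \<otimes> e = e"
  shows "ring (corner R e)"
proof (rule ringI)
  have e: "e \<in> carrier R" and com: "\<And>x. x \<in> carrier R \<Longrightarrow> e \<otimes> x = x \<otimes> e"
    using assms(1) unfolding center_def by auto
  show "abelian_group (corner R e)"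
  proof (rule abelian_groupI)
    fix x assume "x \<in> carrier (corner R e)"
    then show "\<exists>y\<in>carrier (corner R e). y \<oplus>\<^bsub>corner R e\<^esub> x = \<zero>\<^bsub>corner R e\<^esub>"
      using e by (intro bexI[of _ "\<ominus> x"]) (auto simp: l_neg r_minus)
  qed (use e in \<open>auto simp: r_distr a_ac\<close>)
  show "Group.monoid (corner R e)"
  proof (rule monoidI)
    fix x assume "x \<in> carrier (corner R e)"
    then show "x \<otimes>\<^bsub>corner R e\<^esub> \<one>\<^bsub>corner R e\<^esub> = x" using com[of x] by simp
  qed (use e assms(2) in \<open>auto simp: m_assoc[symmetric]\<close>)
qed (auto simp: l_distr r_distr)

end

section \<open>Primitive idempotents and the Peirce decomposition\<close>

locale finite_central_idempotents = ring +
  assumes finite_idempotents: "finite (idempotents R)"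
    and idempotents_central: "idempotents R \<subseteq> center R"
begin

lemma idempotentD: "e \<in> idempotents R \<Longrightarrow> e \<in> carrier R" "e \<in> idempotents R \<Longrightarrow> e \<otimes> e = e"
  by (auto simp: idempotents_def)

lemma idempotent_commute: "e \<in> idempotents R \<Longrightarrow> x \<in> carrier R \<Longrightarrow> e \<otimes> x = x \<otimes> e"
  using idempotents_central unfolding center_def by blast

lemma mult_idempotents:
  assumes "e \<in> idempotents R" "f \<in> idempotents R"
  shows "e \<otimes> f \<in> idempotents R"
proof -
  have "e \<otimes> f \<otimes> (e \<otimes> f) = e \<otimes> (f \<otimes> e) \<otimes> f" using assms idempotentD by (simp add: m_assoc)
  also have "f \<otimes> e = e \<otimes> f" by (rule idempotent_commute[OF assms(2) idempotentD(1)[OF assms(1)]])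
  also have "e \<otimes> (e \<otimes> f) \<otimes> f = (e \<otimes> e) \<otimes> (f \<otimes> f)" using assms idempotentD(1) by (simp add: m_assoc)
  finally have "e \<otimes> f \<otimes> (e \<otimes> f) = e \<otimes> f" using assms by (simp add: idempotentD(2))
  then show ?thesis using assms by (simp add: idempotents_def)
qed

abbreviation "E \<equiv> primitive_idempotents R"

lemma E_idempotent: "e \<in> E \<Longrightarrow> e \<in> idempotents R"
  by (auto simp: primitive_idempotents_def)

lemma E_carrier [simp]: "e \<in> E \<Longrightarrow> e \<in> carrier R"
  using E_idempotent idempotentD by auto

lemma finite_E: "finite E"
  using finite_idempotents E_idempotent by (meson finite_subset subsetI)

lemma E_below: "e \<in> E \<Longrightarrow> f \<in> idempotents R \<Longrightarrow> e \<otimes> f = f \<Longrightarrow> f \<noteq> \<zero> \<Longrightarrow> f = e"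
  by (auto simp: primitive_idempotents_def)

text \<open>A nonzero product would be an idempotent below both factors, and so equal to each of
  them.\<close>

lemma E_orthogonal:
  assumes "e \<in> E" "f \<in> E" "e \<noteq> f"
  shows "e \<otimes> f = \<zero>"
proof (rule ccontr)
  assume nz: "e \<otimes> f \<noteq> \<zero>"
  have i: "e \<otimes> f \<in> idempotents R" using assms E_idempotent mult_idempotents by auto
  have c: "e \<in> carrier R" "f \<in> carrier R" using assms by auto
  have "e \<otimes> (e \<otimes> f) = e \<otimes> f" using c assms(1) E_idempotent idempotentD by (simp add: m_assoc[symmetric])
  then have "e \<otimes> f = e" using E_below assms(1) i nz by blast
  moreover have "f \<otimes> (e \<otimes> f) = e \<otimes> f"
    using c idempotentD[OF E_idempotent[OF assms(2)]]
      idempotent_commute[OF E_idempotent[OF assms(2)], of "e \<otimes> f"] by (simp add: m_assoc)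
  then have "e \<otimes> f = f" using E_below assms(2) i nz by blast
  ultimately show False using assms(3) by simp
qed

lemma E_absorb_sum:
  assumes e: "e \<in> E" and f: "\<And>d. d \<in> E \<Longrightarrow> f d \<in> carrier R" "\<And>d. d \<in> E \<Longrightarrow> d \<otimes> f d = f d"
  shows "e \<otimes> (\<Oplus>d\<in>E. f d) = f e"
proof -
  have "e \<otimes> (\<Oplus>d\<in>E. f d) = (\<Oplus>d\<in>E. e \<otimes> f d)"
    using e f finite_E by (intro finsum_rdistr) auto
  also have "\<dots> = (\<Oplus>d\<in>E. if e = d then f d else \<zero>)"
  proof (intro finsum_cong')
    fix d assume d: "d \<in> E"
    show "e \<otimes> f d = (if e = d then f d else \<zero>)"
    proof (cases "e = d")
      case False
      have "e \<otimes> (d \<otimes> f d) = \<zero>" using E_orthogonal[OF e d False] e d f(1)[OF d] by (simp add: m_assoc[symmetric])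
      then show ?thesis using False f(2)[OF d] by simp
    qed (use f(2) d in auto)
  qed (use f in auto)
  also have "\<dots> = f e" using e f finite_E by (intro finsum_singleton) auto
  finally show ?thesis .
qed

text \<open>Otherwise \<open>\<one> \<ominus> s\<close> is a nonzero idempotent, where
  \<open>s\<close> is the sum. A minimal nonzero idempotent below it is primitive, so it is fixed by
  \<open>s\<close>, yet \<open>s\<close> annihilates everything below
  \<open>\<one> \<ominus> s\<close>.\<close>

lemma sum_E: "(\<Oplus>e\<in>E. e) = \<one>"
proof (rule ccontr)
  define s where "s = (\<Oplus>e\<in>E. e)"
  assume ne: "(\<Oplus>e\<in>E. e) \<noteq> \<one>"
  have sc: "s \<in> carrier R" unfolding s_def by (intro finsum_closed) auto
  have es: "e \<otimes> s = e" if "e \<in> E" for e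
    unfolding s_def using E_absorb_sum[OF that, of "\<lambda>d. d"] E_idempotent idempotentD by auto
  have ss: "s \<otimes> s = s"
  proof -
    have "s \<otimes> s = (\<Oplus>e\<in>E. e \<otimes> s)" unfolding s_def
      using finite_E s_def sc by (intro finsum_ldistr) auto
    also have "\<dots> = s" unfolding s_def using es s_def by (intro finsum_cong') auto
    finally show ?thesis .
  qed
  define f where "f = \<one> \<ominus> s"
  have fc: "f \<in> carrier R" unfolding f_def using sc by auto
  have fs: "f \<otimes> s = \<zero>" "s \<oplus> f = \<one>"
    unfolding f_def using sc ss a_lcomm[of s \<one> "\<ominus> s"] by (auto simp: minus_eq l_distr l_minus r_neg)
  have "f \<otimes> (s \<oplus> f) = f" using fs fc by simp
  then have "f \<otimes> f = f" using fs(1) fc sc by (simp add: r_distr)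
  then have fI: "f \<in> idempotents R" unfolding idempotents_def using fc by auto
  have f0: "f \<noteq> \<zero>" using ne sc unfolding f_def s_def[symmetric] by auto
  define I where "I = {g \<in> idempotents R. g \<noteq> \<zero> \<and> f \<otimes> g = g}"
  \<comment> \<open>The number of idempotents below \<open>g\<close> is a rank function: minimising
    it over the finite set \<open>I\<close> produces a primitive idempotent.\<close>
  define below where "below = (\<lambda>g. {h \<in> idempotents R. g \<otimes> h = h})"
  have "finite I" "f \<in> I" unfolding I_def using finite_idempotents fI f0 idempotentD by auto
  then obtain g where "is_arg_min (\<lambda>g. card (below g)) (\<lambda>g. g \<in> I) g"
    using ex_is_arg_min_if_finite[of I "\<lambda>g. card (below g)"] by auto
  then have g: "g \<in> I" and min: "\<And>h. h \<in> I \<Longrightarrow> card (below g) \<le> card (below h)"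
    unfolding is_arg_min_linorder by auto
  have gI: "g \<in> idempotents R" "g \<noteq> \<zero>" "f \<otimes> g = g" and gc: "g \<in> carrier R"
    using g idempotentD unfolding I_def by auto
  have "h = g" if h: "h \<in> idempotents R" "g \<otimes> h = h" "h \<noteq> \<zero>" for h
  proof -
    have hc: "h \<in> carrier R" using h idempotentD by auto
    have "f \<otimes> (g \<otimes> h) = g \<otimes> h" using m_assoc[OF fc gc hc] gI(3) by simp
    then have "h \<in> I" unfolding I_def using h by auto
    have "below h \<subseteq> below g"
    proof
      fix k assume k: "k \<in> below h"
      then have kc: "k \<in> carrier R" "h \<otimes> k = k" "k \<in> idempotents R" unfolding below_def using idempotentD by auto
      have "g \<otimes> (h \<otimes> k) = h \<otimes> k" using gc hc kc(1) h(2) by (simp add: m_assoc[symmetric])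
      then show "k \<in> below g" using kc unfolding below_def by auto
    qed
    moreover have "finite (below g)" unfolding below_def using finite_idempotents by auto
    ultimately have "below h = below g" using min[OF \<open>h \<in> I\<close>] by (simp add: card_seteq)
    moreover have "g \<in> below g" unfolding below_def using gI idempotentD by auto
    ultimately have "h \<otimes> g = g" unfolding below_def by auto
    then show ?thesis using h(2) idempotent_commute[OF h(1) gc] by simp
  qed
  then have "g \<in> E" unfolding primitive_idempotents_def using gI by auto
  have "g = f \<otimes> (g \<otimes> s)" using es[OF \<open>g \<in> E\<close>] gI by simp
  also have "\<dots> = f \<otimes> s \<otimes> g" using idempotent_commute[OF gI(1) sc] fc sc gc by (simp add: m_assoc)
  finally show False using fs gI gc by simp
qed

lemma E_decomposition: "x \<in> carrier R \<Longrightarrow> (\<Oplus>e\<in>E. e \<otimes> x) = x"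
  using finsum_ldistr[OF finite_E, of x "\<lambda>e. e"] sum_E by auto

lemma eq_by_E:
  assumes "x \<in> carrier R" "y \<in> carrier R" "\<And>e. e \<in> E \<Longrightarrow> e \<otimes> x = e \<otimes> y"
  shows "x = y"
proof -
  have "(\<Oplus>e\<in>E. e \<otimes> x) = (\<Oplus>e\<in>E. e \<otimes> y)"
    using assms by (intro finsum_cong') auto
  then show ?thesis using assms E_decomposition by simp
qed

lemma E_corner_ring: "e \<in> E \<Longrightarrow> ring (corner R e)"
  using corner_ring E_idempotent idempotents_central idempotentD by blast

text \<open>From \<open>x z x = x\<close>, the element \<open>y = e z\<close> makes
  \<open>x y\<close> and \<open>y x\<close> nonzero idempotents below the primitive idempotent
  \<open>e\<close>, so both equal \<open>e\<close>.\<close>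

lemma E_corner_division:
  assumes e: "e \<in> E" and x: "x \<in> carrier R" "e \<otimes> x = x" "x \<noteq> \<zero>"
    and reg: "\<exists>y\<in>carrier R. x \<otimes> y \<otimes> x = x"
  obtains y where "y \<in> carrier R" "e \<otimes> y = y" "x \<otimes> y = e" "y \<otimes> x = e"
proof -
  obtain z where z: "z \<in> carrier R" "x \<otimes> z \<otimes> x = x" using reg by blast
  define y where "y = e \<otimes> z"
  have ec: "e \<in> carrier R" "e \<otimes> e = e" using e E_idempotent idempotentD by auto
  have com: "e \<otimes> v = v \<otimes> e" if "v \<in> carrier R" for v using that e E_idempotent idempotent_commute by auto
  have y: "y \<in> carrier R" "e \<otimes> y = y" unfolding y_def using z ec by (auto simp: m_assoc[symmetric])
  have "x \<otimes> y \<otimes> x = x \<otimes> (e \<otimes> z) \<otimes> x" unfolding y_def ..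
  also have "\<dots> = x \<otimes> z \<otimes> (e \<otimes> x)" unfolding com[OF z(1)] using x z ec by (simp add: m_assoc)
  finally have xyx: "x \<otimes> y \<otimes> x = x" using x z by simp
  have "x \<otimes> y \<otimes> (x \<otimes> y) = x \<otimes> y \<otimes> x \<otimes> y" using x y by (simp add: m_assoc)
  then have i1: "x \<otimes> y \<in> idempotents R" unfolding idempotents_def xyx using x y by auto
  have "y \<otimes> x \<otimes> (y \<otimes> x) = y \<otimes> (x \<otimes> y \<otimes> x)" using x y by (simp add: m_assoc)
  then have i2: "y \<otimes> x \<in> idempotents R" unfolding idempotents_def xyx using x y by auto
  have "x \<otimes> y \<noteq> \<zero>" using xyx x y by auto
  moreover have "y \<otimes> x \<noteq> \<zero>" using xyx x y by (auto simp: m_assoc)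
  moreover have "e \<otimes> (x \<otimes> y) = x \<otimes> y" "e \<otimes> (y \<otimes> x) = y \<otimes> x" using ec x y by (auto simp: m_assoc[symmetric])
  ultimately show thesis using that[OF y] E_below[OF e] i1 i2 by blast
qed

end

section \<open>Regular rings: the components as division rings and fields\<close>

locale finite_central_idempotents_regular = finite_central_idempotents +
  assumes regular: "\<And>x. x \<in> carrier R \<Longrightarrow> \<exists>y\<in>carrier R. x \<otimes> y \<otimes> x = x"
begin

lemma corner_Units:
  assumes "e \<in> E"
  shows "Units (corner R e) = carrier (corner R e) - {\<zero>\<^bsub>corner R e\<^esub>}"
proof (intro equalityI subsetI)
  fix x assume x: "x \<in> Units (corner R e)"
  then obtain y where "x \<in> carrier R" "e \<otimes> x = x" "y \<in> carrier R" "y \<otimes> x = e" unfolding Units_def by auto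
  moreover have "e \<noteq> \<zero>" using assms unfolding primitive_idempotents_def by auto
  ultimately show "x \<in> carrier (corner R e) - {\<zero>\<^bsub>corner R e\<^esub>}" by auto
next
  fix x assume "x \<in> carrier (corner R e) - {\<zero>\<^bsub>corner R e\<^esub>}"
  then have x: "x \<in> carrier R" "e \<otimes> x = x" "x \<noteq> \<zero>" by auto
  then show "x \<in> Units (corner R e)"
    using E_corner_division[OF assms x] regular unfolding Units_def by (auto 4 4)
qed

lemma finite_corner_commute:
  assumes "e \<in> E" "finite (carrier (corner R e))" "x \<in> carrier R" "e \<otimes> x = x" "y \<in> carrier R" "e \<otimes> y = y"
  shows "x \<otimes> y = y \<otimes> x"
proof -
  interpret D: finite_division_ring "corner R e"
    using assms(1,2) E_corner_ring corner_Units
    by (intro finite_division_ring.intro finite_division_ring_axioms.intro) auto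
  show ?thesis using D.wedderburn_little[of x y] assms by simp
qed

lemma commute_if_corners_commute:
  assumes c: "\<And>e x y. e \<in> E \<Longrightarrow> x \<in> carrier R \<Longrightarrow> e \<otimes> x = x \<Longrightarrow> y \<in> carrier R \<Longrightarrow> e \<otimes> y = y \<Longrightarrow> x \<otimes> y = y \<otimes> x"
    and x: "x \<in> carrier R" and y: "y \<in> carrier R"
  shows "x \<otimes> y = y \<otimes> x"
proof (rule eq_by_E)
  fix e assume e: "e \<in> E"
  have ec: "e \<in> carrier R" "e \<otimes> e = e" using e E_idempotent idempotentD by auto
  have *: "e \<otimes> (u \<otimes> v) = (e \<otimes> u) \<otimes> (e \<otimes> v)" if "u \<in> carrier R" "v \<in> carrier R" for u v
  proof -
    have "e \<otimes> (u \<otimes> v) = e \<otimes> (e \<otimes> u) \<otimes> v" using ec that by (simp add: m_assoc[symmetric])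
    also have "e \<otimes> (e \<otimes> u) = (e \<otimes> u) \<otimes> e"
      using ec that by (intro idempotent_commute[OF E_idempotent[OF e]]) auto
    finally show ?thesis using ec that by (simp add: m_assoc)
  qed
  have ex: "e \<otimes> (e \<otimes> u) = e \<otimes> u" if "u \<in> carrier R" for u using that ec by (simp add: m_assoc[symmetric])
  show "e \<otimes> (x \<otimes> y) = e \<otimes> (y \<otimes> x)"
    unfolding *[OF x y] *[OF y x] using c[OF e] ec ex x y by simp
qed (use x y in auto)

text \<open>The isomorphism lists the components \<open>e \<otimes> a\<close>. It is injective
  because the primitive idempotents sum to one; a preimage of a list is the sum of its entries, by
  orthogonality.\<close>

lemma direct_sum_of_fieldsI:
  assumes com: "\<And>x y. x \<in> carrier R \<Longrightarrow> y \<in> carrier R \<Longrightarrow> x \<otimes> y = y \<otimes> x"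
  shows "direct_sum_of_fields R"
proof -
  obtain es where es: "set es = E" "distinct es" using finite_distinct_list[OF finite_E] by blast
  let ?Fs = "map (corner R) es"
  have field: "field (corner R e)" if e: "e \<in> E" for e
  proof -
    interpret C: ring "corner R e" using E_corner_ring e .
    have "cring (corner R e)"
      using com by unfold_locales auto
    then show ?thesis using corner_Units[OF e] by (rule cring.cring_fieldI)
  qed
  define \<phi> where "\<phi> = (\<lambda>a. map (\<lambda>e. e \<otimes> a) es)"
  have ec: "e \<in> carrier R" "e \<otimes> e = e" if "e \<in> E" for e using that E_idempotent idempotentD by auto
  have hom1: "(\<lambda>a. e \<otimes> a) \<in> ring_hom R (corner R e)" if e: "e \<in> E" for e
  proof (rule ring_hom_memI)
    fix x y assume xy: "x \<in> carrier R" "y \<in> carrier R"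
    show "e \<otimes> x \<in> carrier (corner R e)" using ec[OF e] xy by (simp add: m_assoc[symmetric])
    have "(e \<otimes> x) \<otimes> (e \<otimes> y) = e \<otimes> (e \<otimes> x) \<otimes> y" using com[of "e \<otimes> x" e] ec[OF e] xy by (simp add: m_assoc[symmetric])
    also have "\<dots> = e \<otimes> (x \<otimes> y)" using ec[OF e] xy by (simp add: m_assoc[symmetric])
    finally show "e \<otimes> (x \<otimes> y) = (e \<otimes> x) \<otimes>\<^bsub>corner R e\<^esub> (e \<otimes> y)" by simp
    show "e \<otimes> (x \<oplus> y) = (e \<otimes> x) \<oplus>\<^bsub>corner R e\<^esub> (e \<otimes> y)" using ec[OF e] xy by (simp add: r_distr)
  qed (use ec[OF e] in auto)
  have "\<phi> \<in> ring_hom R (RDirProd_list ?Fs)"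
    using ring_hom_RDirProd_list[OF ring_axioms, of "map (\<lambda>e. (corner R e, \<lambda>a. e \<otimes> a)) es"] hom1 es
    unfolding \<phi>_def by (auto simp: comp_def)
  moreover have "bij_betw \<phi> (carrier R) (carrier (RDirProd_list ?Fs))"
    unfolding bij_betw_def
  proof
    show "inj_on \<phi> (carrier R)"
      by (rule inj_onI, rule eq_by_E) (auto simp: \<phi>_def es(1))
    show "\<phi> ` carrier R = carrier (RDirProd_list ?Fs)"
    proof
      show "\<phi> ` carrier R \<subseteq> carrier (RDirProd_list ?Fs)"
        using \<open>\<phi> \<in> ring_hom R (RDirProd_list ?Fs)\<close> ring_hom_closed by fast
      show "carrier (RDirProd_list ?Fs) \<subseteq> \<phi> ` carrier R"
      proof
        fix as assume as: "as \<in> carrier (RDirProd_list ?Fs)"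
        have len: "length as = length es" using RDirProd_list_carrier_mem(1)[OF as] by simp
        have mem: "as ! i \<in> carrier R \<and> es ! i \<otimes> as ! i = as ! i" if "i < length es" for i
          using RDirProd_list_carrier_mem(2)[OF as, of i] that by simp
        \<comment> \<open>Entries of a list are addressed by position and components by idempotent;
          distinctness of \<open>es\<close> makes the translation well defined.\<close>
        define idx where "idx = (\<lambda>e. THE i. i < length es \<and> es ! i = e)"
        have idx: "idx (es ! i) = i" if "i < length es" for i
          unfolding idx_def using that es(2) by (auto simp: nth_eq_iff_index_eq)
        define f where "f = (\<lambda>e. as ! idx e)"
        have f: "f e \<in> carrier R \<and> e \<otimes> f e = f e" if "e \<in> E" for e
        proof -
          obtain i where "i < length es" "es ! i = e" using \<open>e \<in> E\<close> es(1) by (metis in_set_conv_nth)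
          then show ?thesis unfolding f_def using idx mem by auto
        qed
        have "\<phi> (\<Oplus>e\<in>E. f e) = as"
        proof (rule nth_equalityI)
          fix i assume "i < length (\<phi> (\<Oplus>e\<in>E. f e))"
          then have i: "i < length es" unfolding \<phi>_def by simp
          then have "es ! i \<in> E" using es(1) nth_mem by blast
          then show "\<phi> (\<Oplus>e\<in>E. f e) ! i = as ! i"
            unfolding \<phi>_def using i E_absorb_sum[of "es ! i" f] f idx[OF i] by (simp add: f_def)
        qed (simp add: \<phi>_def len)
        then show "as \<in> \<phi> ` carrier R" using f by (intro image_eqI[of _ _ "\<Oplus>e\<in>E. f e"]) auto
      qed
    qed
  qed
  ultimately have "R \<simeq> RDirProd_list ?Fs" unfolding is_ring_iso_def ring_iso_def by blast
  then show ?thesis unfolding direct_sum_of_fields_def using field es by (intro exI[of _ ?Fs]) auto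
qed

end

section \<open>The twisted group algebra\<close>

abbreviation (input) "keys \<equiv> Poly_Mapping.keys"
abbreviation (input) "lookup \<equiv> Poly_Mapping.lookup"
abbreviation (input) "single \<equiv> Poly_Mapping.single"

text \<open>Provides the \<open>vector_space\<close> structure from which the linear projection in
  Maschke's theorem is taken.\<close>

definition scale :: "'k::field \<Rightarrow> ('g \<Rightarrow>\<^sub>0 'k) \<Rightarrow> ('g \<Rightarrow>\<^sub>0 'k)" where
  "scale c a = Poly_Mapping.map ((*) c) a"

lemma lookup_scale [simp]: "lookup (scale c a) g = c * lookup a g"
  unfolding scale_def by transfer (simp add: when_def)

lemma vector_space_scale: "vector_space (scale :: 'k::field \<Rightarrow> ('g \<Rightarrow>\<^sub>0 'k) \<Rightarrow> _)"
  by unfold_locales (auto intro!: poly_mapping_eqI simp: lookup_add algebra_simps)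

lemma scale_single [simp]: "scale c (single g d) = single g (c * d)"
  by (auto intro!: poly_mapping_eqI simp: lookup_single when_def)

lemma scale_add: "scale c (a + b) = scale c a + scale c b"
  by (auto intro!: poly_mapping_eqI simp: lookup_add algebra_simps)

lemma scale_sum: "scale c (sum f S) = (\<Sum>x\<in>S. scale c (f x))"
  by (auto intro!: poly_mapping_eqI simp: lookup_sum sum_distrib_left)

lemma scale_scale [simp]: "scale c (scale d a) = scale (c * d) a"
  by (auto intro!: poly_mapping_eqI)

lemma scale_one [simp]: "scale 1 a = a"
  by (auto intro!: poly_mapping_eqI)

lemma keys_scale: "keys (scale c a) \<subseteq> keys a"
  by (auto simp: in_keys_iff)

lemma poly_mapping_span_induct [consumes 1, case_names zero single add]:
  fixes a :: "'g \<Rightarrow>\<^sub>0 'k::ab_group_add"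
  assumes "keys a \<subseteq> S" and "P 0"
    and "\<And>g c. g \<in> S \<Longrightarrow> c \<noteq> 0 \<Longrightarrow> P (single g c)"
    and "\<And>a b. keys a \<subseteq> S \<Longrightarrow> keys b \<subseteq> S \<Longrightarrow> P a \<Longrightarrow> P b \<Longrightarrow> P (a + b)"
  shows "P a"
proof -
  have "finite (keys a)" by simp
  then show ?thesis using assms(1)
  proof (induction "keys a" arbitrary: a rule: finite_induct)
    case empty
    then have "a = 0" by (simp flip: keys_eq_empty)
    then show ?case using assms(2) by simp
  next
    case (insert g F)
    define b where "b = a - single g (lookup a g)"
    have lb: "lookup b h = (if h = g then 0 else lookup a h)" for h
      unfolding b_def by (auto simp: lookup_minus lookup_single when_def)
    have kb: "keys b = F"
      using insert.hyps(2,4) by (auto simp: in_keys_iff lb split: if_splits)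
    have "a = single g (lookup a g) + b" unfolding b_def by simp
    moreover have "P (single g (lookup a g))"
      using insert.hyps(4) insert.prems assms(3) by (metis in_keys_iff insertI1 subsetD)
    moreover have "P b" using insert kb by auto
    moreover have "keys (single g (lookup a g)) \<subseteq> S"
      using insert.hyps(4) insert.prems by auto
    moreover have "keys b \<subseteq> S" using kb insert by auto
    ultimately show ?case using assms(4) by metis
  qed
qed

locale twisted_algebra = group G for G :: "('g, 'm) monoid_scheme" (structure) +
  fixes lam :: "'g \<Rightarrow> 'g \<Rightarrow> 'k::field"
  assumes cocycle: "two_cocycle G lam"
begin

abbreviation R :: "('g \<Rightarrow>\<^sub>0 'k) ring" where "R \<equiv> twisted_group_algebra G lam"

abbreviation A :: "'g set \<Rightarrow> ('g \<Rightarrow>\<^sub>0 'k) ring" where "A \<equiv> twisted_span G lam"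

abbreviation tmult :: "('g \<Rightarrow>\<^sub>0 'k) \<Rightarrow> ('g \<Rightarrow>\<^sub>0 'k) \<Rightarrow> ('g \<Rightarrow>\<^sub>0 'k)" (infixl \<open>\<star>\<close> 70)
  where "a \<star> b \<equiv> a \<otimes>\<^bsub>R\<^esub> b"

lemma lam_nonzero: "g \<in> carrier G \<Longrightarrow> h \<in> carrier G \<Longrightarrow> lam g h \<noteq> 0"
  using cocycle unfolding two_cocycle_def by blast

lemma lam_cocycle: "g \<in> carrier G \<Longrightarrow> h \<in> carrier G \<Longrightarrow> k \<in> carrier G \<Longrightarrow>
    lam g h * lam (g \<otimes> h) k = lam h k * lam g (h \<otimes> k)"
  using cocycle unfolding two_cocycle_def by blast

text \<open>The cocycle identity at \<open>(\<one>, \<one>, g)\<close> already forces this constancy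
  without normalisation; it is why a rescaled \<open>u\<^sub>1\<close> is an identity.\<close>

lemma lam_one_left: "g \<in> carrier G \<Longrightarrow> lam \<one> g = lam \<one> \<one>"
  using lam_cocycle[of \<one> \<one> g] lam_nonzero[of \<one> g] by simp

lemma lam_one_right: "g \<in> carrier G \<Longrightarrow> lam g \<one> = lam \<one> \<one>"
  using lam_cocycle[of g \<one> \<one>] lam_nonzero[of g \<one>] by simp

lemma lam_inv_commute: "g \<in> carrier G \<Longrightarrow> lam (inv g) g = lam g (inv g)"
  using lam_cocycle[of g "inv g" g] lam_one_left[of g] lam_one_right[of g] lam_nonzero[of \<one> \<one>] by simp

lemma R_simps [simp]:
  "carrier R = {a. keys a \<subseteq> carrier G}" "\<zero>\<^bsub>R\<^esub> = 0" "a \<oplus>\<^bsub>R\<^esub> b = a + b"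
  "\<one>\<^bsub>R\<^esub> = single \<one> (inverse (lam \<one> \<one>))"
  by (simp_all add: twisted_group_algebra_def)

lemma A_simps [simp]:
  "carrier (A S) = {a. keys a \<subseteq> S}" "\<zero>\<^bsub>A S\<^esub> = 0" "a \<oplus>\<^bsub>A S\<^esub> b = a + b"
  "\<one>\<^bsub>A S\<^esub> = \<one>\<^bsub>R\<^esub>" "a \<otimes>\<^bsub>A S\<^esub> b = a \<star> b"
  by (simp_all add: twisted_span_def twisted_group_algebra_def)

text \<open>Enlarged index sets allow products of elements with different supports to be compared
  over a common one, as bilinearity needs.\<close>

lemma tmult_eq:
  assumes "finite S" "keys a \<subseteq> S" "finite T" "keys b \<subseteq> T"
  shows "a \<star> b = (\<Sum>g\<in>S. \<Sum>h\<in>T. single (g \<otimes> h)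
           (lookup a g * lookup b h * lam g h))"
proof -
  have "(\<Sum>h\<in>keys b. single (g \<otimes> h)
           (lookup a g * lookup b h * lam g h)) =
      (\<Sum>h\<in>T. single (g \<otimes> h)
           (lookup a g * lookup b h * lam g h))" for g
    using assms by (intro sum.mono_neutral_left) (auto simp: in_keys_iff)
  then have "a \<star> b = (\<Sum>g\<in>keys a. \<Sum>h\<in>T. single (g \<otimes> h)
           (lookup a g * lookup b h * lam g h))"
    by (simp add: twisted_group_algebra_def)
  also have "\<dots> = (\<Sum>g\<in>S. \<Sum>h\<in>T. single (g \<otimes> h)
           (lookup a g * lookup b h * lam g h))"
    using assms by (intro sum.mono_neutral_left) (auto simp: in_keys_iff)
  finally show ?thesis .
qed

lemma tmult_add_left: "(a + a') \<star> b = a \<star> b + a' \<star> b"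
proof -
  let ?S = "keys a \<union> keys a'" and ?T = "keys b"
  have "keys (a + a') \<subseteq> ?S" by (rule keys_add)
  then show ?thesis
    by (subst (1 2 3) tmult_eq[of ?S _ ?T])
       (auto simp: lookup_add distrib_right single_add sum.distrib)
qed

lemma tmult_add_right: "a \<star> (b + b') = a \<star> b + a \<star> b'"
proof -
  let ?S = "keys a" and ?T = "keys b \<union> keys b'"
  have "keys (b + b') \<subseteq> ?T" by (rule keys_add)
  then show ?thesis
    by (subst (1 2 3) tmult_eq[of ?S _ ?T])
       (auto simp: lookup_add distrib_right distrib_left single_add sum.distrib)
qed

lemma tmult_zero [simp]: "0 \<star> b = 0" "b \<star> 0 = 0"
  by (simp_all add: twisted_group_algebra_def)

lemma tmult_single [simp]:
  "single g c \<star> single h d = single (g \<otimes> h) (c * d * lam g h)"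
  by (subst tmult_eq[of "{g}" _ "{h}"]) auto

lemma tmult_scale_left: "scale c a \<star> b = scale c (a \<star> b)"
  using keys_scale[of c a]
  by (subst (1 2) tmult_eq[of "keys a" _ "keys b"])
     (auto simp: scale_sum mult.assoc)

lemma tmult_scale_right: "a \<star> scale c b = scale c (a \<star> b)"
  using keys_scale[of c b]
  by (subst (1 2) tmult_eq[of "keys a" _ "keys b"])
     (auto simp: scale_sum mult_ac)

lemma tmult_sum_right: "a \<star> sum f S = (\<Sum>x\<in>S. a \<star> f x)"
  by (induction S rule: infinite_finite_induct) (auto simp: tmult_add_right)

lemma tmult_sum_left: "sum f S \<star> a = (\<Sum>x\<in>S. f x \<star> a)"
  by (induction S rule: infinite_finite_induct) (auto simp: tmult_add_left)

lemma keys_tmult: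
  assumes "keys a \<subseteq> S" "keys b \<subseteq> T"
  shows "keys (a \<star> b) \<subseteq> {g \<otimes> h | g h. g \<in> S \<and> h \<in> T}"
proof
  fix k assume "k \<in> keys (a \<star> b)"
  then have nz: "lookup (a \<star> b) k \<noteq> 0" by (simp add: in_keys_iff)
  have "\<exists>g\<in>keys a. \<exists>h\<in>keys b. g \<otimes> h = k"
  proof (rule ccontr)
    assume "\<not> ?thesis"
    then have "lookup (a \<star> b) k = 0"
      by (subst tmult_eq[of "keys a" _ "keys b"])
         (auto simp: lookup_sum lookup_single when_def intro!: sum.neutral)
    then show False using nz by simp
  qed
  then show "k \<in> {g \<otimes> h | g h. g \<in> S \<and> h \<in> T}" using assms by blast
qed

lemma tmult_assoc:
  assumes "keys a \<subseteq> carrier G" "keys b \<subseteq> carrier G"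
    "keys c \<subseteq> carrier G"
  shows "(a \<star> b) \<star> c = a \<star> (b \<star> c)"
  using assms(1)
proof (induction a rule: poly_mapping_span_induct)
  case (single g x)
  show ?case using assms(2)
  proof (induction b rule: poly_mapping_span_induct)
    case (single h y)
    show ?case using assms(3)
    proof (induction c rule: poly_mapping_span_induct)
      case (single k z)
      then show ?case using \<open>g \<in> carrier G\<close> \<open>h \<in> carrier G\<close> lam_cocycle[of g h k]
        by (simp add: m_assoc mult_ac)
    qed (simp_all add: tmult_add_right)
  qed (simp_all add: tmult_add_right tmult_add_left)
qed (simp_all add: tmult_add_left)

lemma A_carrier_eq_R: "A (carrier G) = R"
  unfolding twisted_span_def by (simp add: twisted_group_algebra_def)

lemma ring_A:
  assumes H: "subgroup H G"
  shows "ring (A H)"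
proof (rule ringI)
  have Hc: "H \<subseteq> carrier G" using H subgroup.subset by blast
  show "abelian_group (A H)"
  proof (rule abelian_groupI)
    fix x y assume "x \<in> carrier (A H)" "y \<in> carrier (A H)"
    then show "x \<oplus>\<^bsub>A H\<^esub> y \<in> carrier (A H)" using keys_add[of x y] by auto
  next
    fix x assume "x \<in> carrier (A H)"
    then show "\<exists>y\<in>carrier (A H). y \<oplus>\<^bsub>A H\<^esub> x = \<zero>\<^bsub>A H\<^esub>" by (intro bexI[of _ "- x"]) auto
  qed auto
  show "Group.monoid (A H)"
  proof (rule monoidI)
    fix x y z assume x: "x \<in> carrier (A H)" and y: "y \<in> carrier (A H)"
    show "x \<otimes>\<^bsub>A H\<^esub> y \<in> carrier (A H)"
      using keys_tmult[of x H y H] x y subgroup.m_closed[OF H] by auto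
    show "x \<otimes>\<^bsub>A H\<^esub> y \<otimes>\<^bsub>A H\<^esub> z = x \<otimes>\<^bsub>A H\<^esub> (y \<otimes>\<^bsub>A H\<^esub> z)" if "z \<in> carrier (A H)"
      using x y that Hc tmult_assoc[of x y z] by simp
    have kx: "keys x \<subseteq> carrier G" using x Hc by auto
    show "\<one>\<^bsub>A H\<^esub> \<otimes>\<^bsub>A H\<^esub> x = x" using kx
    proof (induction x rule: poly_mapping_span_induct)
      case (single g c)
      then show ?case using lam_one_left[of g] lam_nonzero[of \<one> \<one>] by (simp add: field_simps)
    qed (simp_all add: tmult_add_right)
    show "x \<otimes>\<^bsub>A H\<^esub> \<one>\<^bsub>A H\<^esub> = x" using kx
    proof (induction x rule: poly_mapping_span_induct)
      case (single g c)
      then show ?case using lam_one_right[of g] lam_nonzero[of \<one> \<one>] by (simp add: field_simps)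
    qed (simp_all add: tmult_add_left)
  qed (use subgroup.one_closed[OF H] in auto)
qed (auto simp: tmult_add_left tmult_add_right)

lemma ring_R: "ring R"
  using ring_A[OF subgroup_self] A_carrier_eq_R by simp

sublocale R: ring R by (rule ring_R)

definition u :: "'g \<Rightarrow> 'g \<Rightarrow>\<^sub>0 'k" where "u g = single g 1"

text \<open>Besides the factor from multiplying \<open>g\<close> with its inverse,
  \<open>lam \<one> \<one>\<close> enters because the identity is a rescaled basis element. The
  symmetry \<open>lam_inv_commute\<close> makes the inverse two-sided.\<close>

lemma inv_single:
  assumes g: "g \<in> carrier G" and c: "c \<noteq> 0"
  shows "single g c \<in> Units R"
    "inv\<^bsub>R\<^esub> (single g c) = single (inv g) (inverse (c * lam g (inv g) * lam \<one> \<one>))"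
proof -
  let ?i = "single (inv g) (inverse (c * lam g (inv g) * lam \<one> \<one>))"
  have "single g c \<star> ?i = \<one>\<^bsub>R\<^esub>" "?i \<star> single g c = \<one>\<^bsub>R\<^esub>"
    using g c lam_nonzero[of g "inv g"] lam_nonzero[of \<one> \<one>] by (simp_all add: lam_inv_commute field_simps)
  moreover have "single g c \<in> carrier R" "?i \<in> carrier R" using g by auto
  ultimately show "single g c \<in> Units R" "inv\<^bsub>R\<^esub> (single g c) = ?i"
    using R.inv_unique'[of "single g c" ?i] unfolding Units_def by (blast, metis)
qed

lemma u_Units: "g \<in> carrier G \<Longrightarrow> u g \<in> Units R"
  unfolding u_def by (rule inv_single) auto

lemma inv_u: "g \<in> carrier G \<Longrightarrow> inv\<^bsub>R\<^esub> (u g) = single (inv g) (inverse (lam g (inv g) * lam \<one> \<one>))"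
  unfolding u_def by (subst inv_single) auto

lemma lookup_single_tmult:
  assumes g: "g \<in> carrier G" and y: "y \<in> carrier R" and h: "h \<in> carrier G"
  shows "lookup (single g c \<star> y) (g \<otimes> h) = c * lookup y h * lam g h"
proof -
  have yk: "\<And>k. k \<in> keys y \<Longrightarrow> k \<in> carrier G" using y by auto
  let ?T = "insert h (keys y)"
  have "single g c \<star> y =
     (\<Sum>k\<in>?T. single (g \<otimes> k) (c * lookup y k * lam g k))"
    by (subst tmult_eq[of "{g}" _ ?T]) auto
  then have "lookup (single g c \<star> y) (g \<otimes> h) =
     (\<Sum>k\<in>?T. lookup (single (g \<otimes> k) (c * lookup y k * lam g k)) (g \<otimes> h))"
    by (simp only: lookup_sum)
  also have "\<dots> = (\<Sum>k\<in>?T. if k = h then c * lookup y k * lam g k else 0)"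
    by (rule sum.cong) (use g h yk in \<open>auto simp: lookup_single when_def\<close>)
  also have "\<dots> = c * lookup y h * lam g h" by (subst sum.delta) auto
  finally show ?thesis .
qed

text \<open>For \<open>S = carrier G\<close> these are the trivial units, the supply of infinitely
  many units when \<open>R\<close> is infinite, whether the field or the group is
  responsible.\<close>

definition monomials :: "'g set \<Rightarrow> ('g \<Rightarrow>\<^sub>0 'k) set" where
  "monomials S = {single g c | g c. g \<in> S \<and> c \<noteq> 0}"

text \<open>Right multiplication by \<open>y\<close> is finite-to-one on monomials, even in the
  presence of zero divisors. For a fixed \<open>s\<close> in the support of \<open>y\<close>, the
  product \<open>z\<close> has \<open>g \<otimes> s\<close> in its finite support, and the
  coefficient there determines \<open>c\<close>.\<close>

lemma finite_monomials_if_finite_translates: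
  assumes y: "y \<in> carrier R" "y \<noteq> 0" and B: "B \<subseteq> monomials (carrier G)"
    and fin: "finite ((\<lambda>m. m \<star> y) ` B)"
  shows "finite B"
proof -
  obtain s where s: "s \<in> keys y" using y(2) by fastforce
  then have sc: "s \<in> carrier G" and sy: "lookup y s \<noteq> 0" using y by (auto simp: in_keys_iff)
  have "finite {m \<in> B. m \<star> y = z}" for z
  proof -
    let ?f = "\<lambda>k. single (k \<otimes> inv s)
      (lookup z k / (lookup y s * lam (k \<otimes> inv s) s))"
    have "{m \<in> B. m \<star> y = z} \<subseteq> ?f ` keys z"
    proof
      fix m assume "m \<in> {m \<in> B. m \<star> y = z}"
      then obtain g c where m: "g \<in> carrier G" "c \<noteq> 0" "m = single g c" "m \<star> y = z"
        using B unfolding monomials_def by blast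
      have l: "lookup z (g \<otimes> s) = c * lookup y s * lam g s"
        using lookup_single_tmult[OF m(1) y(1) sc, of c] unfolding m(3)[symmetric] m(4) .
      have "lam g s \<noteq> 0" using lam_nonzero m sc by auto
      then have "g \<otimes> s \<in> keys z" using l m sy by (simp add: in_keys_iff)
      moreover have "m = ?f (g \<otimes> s)" using l m sc sy \<open>lam g s \<noteq> 0\<close> by (simp add: m_assoc)
      ultimately show "m \<in> ?f ` keys z" by blast
    qed
    then show ?thesis by (meson finite_imageI finite_keys finite_subset)
  qed
  then have "finite (\<Union>z\<in>(\<lambda>m. m \<star> y) ` B. {m \<in> B. m \<star> y = z})" using fin by blast
  then show ?thesis by (rule rev_finite_subset) auto
qed

text \<open>For nonempty \<open>S\<close>, the monomials at one element of \<open>S\<close> bound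
  the field and those with coefficient one bound \<open>S\<close>.\<close>

lemma finite_span_if_finite_monomials:
  assumes "finite (monomials S)"
  shows "finite {a :: 'g \<Rightarrow>\<^sub>0 'k. keys a \<subseteq> S}"
proof (cases "S = {}")
  case True
  then have "{a :: 'g \<Rightarrow>\<^sub>0 'k. keys a \<subseteq> S} = {0}" by auto
  then show ?thesis by simp
next
  case False
  then obtain s where s: "s \<in> S" by blast
  have "single s ` (UNIV - {0 :: 'k}) \<subseteq> monomials S" unfolding monomials_def using s by blast
  then have "finite (single s ` (UNIV - {0 :: 'k}))" using assms finite_subset by blast
  then have "finite (UNIV - {0 :: 'k})"
    by (rule finite_imageD) (auto intro!: inj_onI dest: injD[OF inj_single])
  then have K: "finite (UNIV :: 'k set)" by simp
  have "(\<lambda>g. single g (1 :: 'k)) ` S \<subseteq> monomials S" unfolding monomials_def using one_neq_zero by blast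
  then have "finite ((\<lambda>g. single g (1 :: 'k)) ` S)" using assms finite_subset by blast
  then have S: "finite S"
  proof (rule finite_imageD)
    show "inj_on (\<lambda>g. single g (1 :: 'k)) S"
      by (rule inj_onI) (metis keys_single one_neq_zero singleton_insert_inj_eq)
  qed
  have "lookup ` {a :: 'g \<Rightarrow>\<^sub>0 'k. keys a \<subseteq> S} \<subseteq>
      {f. \<forall>x. (x \<in> S \<longrightarrow> f x \<in> UNIV) \<and> (x \<notin> S \<longrightarrow> f x = 0)}"
    by (auto simp: in_keys_iff subset_iff)
  then have "finite (lookup ` {a :: 'g \<Rightarrow>\<^sub>0 'k. keys a \<subseteq> S})"
    using finite_set_of_finite_funs[OF S K, of 0] finite_subset by blast
  then show ?thesis by (rule finite_imageD) (auto intro: inj_onI poly_mapping_eqI)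
qed

text \<open>Read contrapositively: in an infinite span, even the multiples of one nonzero
  \<open>e\<close> are infinite in number, since translation by \<open>e\<close> is finite-to-one on
  monomials.\<close>

lemma finite_span_if_finite_ideal:
  assumes S: "S \<subseteq> carrier G" and e: "e \<in> carrier R" "e \<noteq> 0"
    and fin: "finite {a \<star> e | a. keys a \<subseteq> S}"
  shows "finite {a :: 'g \<Rightarrow>\<^sub>0 'k. keys a \<subseteq> S}"
proof -
  have "(\<lambda>m. m \<star> e) ` monomials S \<subseteq> {a \<star> e | a. keys a \<subseteq> S}"
  proof (intro image_subsetI)
    fix m assume "m \<in> monomials S"
    then have "keys m \<subseteq> S" unfolding monomials_def by auto
    then show "m \<star> e \<in> {a \<star> e | a. keys a \<subseteq> S}" by blast
  qed
  moreover have "monomials S \<subseteq> monomials (carrier G)" unfolding monomials_def using S by blast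
  ultimately have "finite (monomials S)"
    using finite_monomials_if_finite_translates[OF e] fin finite_subset by blast
  then show ?thesis by (rule finite_span_if_finite_monomials)
qed

text \<open>
  Maschke: averaging a linear projection onto the left ideal generated by \<open>x\<close> over the basis
  \<open>u h\<close> makes it right multiplication by an element \<open>y \<star> x\<close> of the ideal.
\<close>

lemma span_regular_if_finite:
  assumes H: "subgroup H G" "finite H" and card: "of_nat (card H) \<noteq> (0 :: 'k)"
    and x: "x \<in> carrier (A H)"
  shows "\<exists>y\<in>carrier (A H). x \<star> y \<star> x = x"
proof -
  have Hc: "\<And>h. h \<in> H \<Longrightarrow> h \<in> carrier G" using H subgroup.subset by blast
  interpret AH: ring "A H" using ring_A H by blast
  have AR: "a \<in> carrier R" if "a \<in> carrier (A H)" for a using that Hc by auto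
  note Am = AH.m_closed[unfolded A_simps(5)]
  define V where "V = (\<lambda>b. b \<star> x) ` carrier (A H)"
  interpret K: vector_space "scale :: 'k \<Rightarrow> ('g \<Rightarrow>\<^sub>0 'k) \<Rightarrow> _" by (rule vector_space_scale)
  interpret KK: vector_space_pair "scale :: 'k \<Rightarrow> ('g \<Rightarrow>\<^sub>0 'k) \<Rightarrow> _" "scale :: 'k \<Rightarrow> ('g \<Rightarrow>\<^sub>0 'k) \<Rightarrow> _" ..
  have VA: "v \<in> carrier (A H)" if "v \<in> V" for v using that x Am unfolding V_def by blast
  have AV: "a \<star> v \<in> V" if "a \<in> carrier (A H)" "v \<in> V" for a v
    using that x Am tmult_assoc AR unfolding V_def by (auto simp: image_iff) (metis (no_types, lifting) A_simps(1) AR R_simps(1) mem_Collect_eq)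
  have Vsub: "K.subspace V"
  proof (rule K.subspaceI)
    show "0 \<in> V" unfolding V_def by (rule image_eqI[of _ _ 0]) auto
    show "v + w \<in> V" if vw: "v \<in> V" "w \<in> V" for v w
    proof -
      obtain b c where "v = b \<star> x" "w = c \<star> x" "b \<in> carrier (A H)" "c \<in> carrier (A H)"
        using vw unfolding V_def by blast
      then show ?thesis unfolding V_def using AH.a_closed[of b c]
        by (intro image_eqI[of _ _ "b + c"]) (auto simp: tmult_add_left)
    qed
    show "scale c v \<in> V" if v: "v \<in> V" for c v
    proof -
      obtain b where "v = b \<star> x" "b \<in> carrier (A H)" using v unfolding V_def by blast
      then show ?thesis unfolding V_def using keys_scale[of c b]
        by (intro image_eqI[of _ _ "scale c b"]) (auto simp: tmult_scale_left)
    qed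
  qed
  obtain \<pi> where \<pi>: "range \<pi> \<subseteq> V" "Vector_Spaces.linear scale scale \<pi>" "\<And>v. v \<in> V \<Longrightarrow> \<pi> v = v"
    using KK.linear_exists_left_inverse_on[OF K.linear_ident Vsub] by auto
  have \<pi>add: "\<pi> (a + b) = \<pi> a + \<pi> b" and \<pi>scale: "\<pi> (scale c a) = scale c (\<pi> a)" for a b c
    using \<pi>(2) by (auto simp: Vector_Spaces.linear_iff)
  have \<pi>A: "\<pi> b \<in> carrier (A H)" and \<pi>V: "\<pi> b \<in> V" for b using \<pi>(1) VA by auto
  define ui where "ui = (\<lambda>h. inv\<^bsub>R\<^esub> (u h))"
  have uA: "u h \<in> carrier (A H)" "ui h \<in> carrier (A H)" if "h \<in> H" for h
    using that inv_u[OF Hc[OF that]] subgroup.m_inv_closed[OF H(1)] unfolding ui_def u_def by auto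
  have uui: "u h \<star> ui h = \<one>\<^bsub>R\<^esub>" "ui h \<star> u h = \<one>\<^bsub>R\<^esub>" if "h \<in> H" for h
    unfolding ui_def using u_Units[OF Hc[OF that]] R.Units_r_inv R.Units_l_inv by blast+
  define t where "t = (\<lambda>h b. u h \<star> \<pi> (ui h \<star> b))"
  define \<tau> where "\<tau> = (\<lambda>b. scale (inverse (of_nat (card H))) (\<Sum>h\<in>H. t h b))"
  have \<tau>add: "\<tau> (a + b) = \<tau> a + \<tau> b" for a b
    unfolding \<tau>_def t_def by (simp add: tmult_add_right \<pi>add sum.distrib scale_add)
  have \<tau>scale: "\<tau> (scale c a) = scale c (\<tau> a)" for a c
    unfolding \<tau>_def t_def by (simp add: tmult_scale_right \<pi>scale scale_sum mult_ac)
  \<comment> \<open>Conjugating \<open>\<pi>\<close> by a basis element is insensitive to rescaling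
    that element, so the factor \<open>lam k h\<close> from \<open>u k \<star> u h\<close> cancels
    against the one from its inverse. The averaging argument then runs as in the untwisted
    case.\<close>
  have shift: "t (k \<otimes> h) (u k \<star> b) = u k \<star> t h b" if kh: "k \<in> H" "h \<in> H" and b: "b \<in> carrier (A H)" for k h b
  proof -
    have khH: "k \<otimes> h \<in> H" using kh subgroup.m_closed[OF H(1)] by blast
    have nz: "lam k h \<noteq> 0" using kh Hc lam_nonzero by blast
    have uk: "u k \<star> u h = scale (lam k h) (u (k \<otimes> h))" unfolding u_def by simp
    have Rc: "u k \<in> carrier R" "u h \<in> carrier R" "ui k \<in> carrier R" "ui h \<in> carrier R" "b \<in> carrier R"
      using AR uA kh b by blast+
    have "(ui h \<star> ui k) \<star> (u k \<star> u h) = ui h \<star> ((ui k \<star> u k) \<star> u h)"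
      using Rc R.m_assoc R.m_closed by (simp del: R_simps)
    then have "(ui h \<star> ui k) \<star> (u k \<star> u h) = \<one>\<^bsub>R\<^esub>"
      using uui kh Rc by (simp del: R_simps)
    then have inv1: "scale (lam k h) (ui h \<star> ui k) \<star> u (k \<otimes> h) = \<one>\<^bsub>R\<^esub>"
      unfolding uk by (simp add: tmult_scale_left tmult_scale_right del: R_simps)
    have "scale (lam k h) (ui h \<star> ui k) = ui (k \<otimes> h)"
    proof (rule R.inv_unique[OF inv1 uui(1)[OF khH]])
      show "scale (lam k h) (ui h \<star> ui k) \<in> carrier R"
        using R.m_closed[OF Rc(4,3)] keys_scale[of "lam k h" "ui h \<star> ui k"] by auto
    qed (use AR uA khH in blast)+
    then have "ui (k \<otimes> h) \<star> (u k \<star> b) = scale (lam k h) (ui h \<star> ((ui k \<star> u k) \<star> b))"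
      using Rc R.m_assoc R.m_closed by (simp add: tmult_scale_left del: R_simps flip: \<open>_ = ui (k \<otimes> h)\<close>)
    then have e: "ui (k \<otimes> h) \<star> (u k \<star> b) = scale (lam k h) (ui h \<star> b)"
      using uui(2)[OF kh(1)] Rc by (simp del: R_simps)
    have "t (k \<otimes> h) (u k \<star> b) = scale (lam k h) (u (k \<otimes> h)) \<star> \<pi> (ui h \<star> b)"
      unfolding t_def e \<pi>scale by (simp add: tmult_scale_left tmult_scale_right)
    also have "\<dots> = u k \<star> t h b"
      unfolding uk[symmetric] t_def using Rc AR[OF \<pi>A] R.m_assoc by (simp del: R_simps)
    finally show ?thesis .
  qed
  have \<tau>u: "\<tau> (u k \<star> b) = u k \<star> \<tau> b" if k: "k \<in> H" and b: "b \<in> carrier (A H)" for k b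
  proof -
    have "bij_betw (\<lambda>h. k \<otimes> h) H H"
      using k Hc subgroup.m_closed[OF H(1)] subgroup.m_inv_closed[OF H(1)]
      by (intro bij_betwI[of _ _ _ "\<lambda>h. inv k \<otimes> h"]) (auto simp: inv_cancel)
    then have "(\<Sum>h\<in>H. t h (u k \<star> b)) = (\<Sum>h\<in>H. t (k \<otimes> h) (u k \<star> b))"
      by (rule sum.reindex_bij_betw[symmetric])
    also have "\<dots> = u k \<star> (\<Sum>h\<in>H. t h b)"
      using shift k b by (simp add: tmult_sum_right)
    finally show ?thesis unfolding \<tau>_def by (simp add: tmult_scale_right)
  qed
  have \<tau>lin: "\<tau> (a \<star> b) = a \<star> \<tau> b" if a: "a \<in> carrier (A H)" and b: "b \<in> carrier (A H)" for a b
  proof -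
    have "keys a \<subseteq> H" using a by simp
    then show ?thesis
    proof (induction a rule: poly_mapping_span_induct)
      case zero
      have "\<tau> (scale 0 0) = scale 0 (\<tau> 0)" by (rule \<tau>scale)
      moreover have "scale 0 a = 0" for a :: "'g \<Rightarrow>\<^sub>0 'k" by (auto intro: poly_mapping_eqI)
      ultimately show ?case by simp
    next
      case (single g c)
      have "single g c = scale c (u g)" unfolding u_def by simp
      then show ?case using \<tau>u[OF single(1) b] by (simp add: tmult_scale_left \<tau>scale)
    qed (simp add: tmult_add_left \<tau>add)
  qed
  have \<tau>V: "\<tau> b \<in> V" for b
  proof -
    have "(\<Sum>h\<in>H. t h b) \<in> V"
      using Vsub AV uA(1) \<pi>V unfolding t_def by (intro K.subspace_sum) auto
    then show ?thesis unfolding \<tau>_def using Vsub K.subspace_scale by blast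
  qed
  have xV: "x \<in> V" unfolding V_def
    by (rule image_eqI[where f = "\<lambda>b. b \<star> x", OF R.l_one[OF AR[OF x], symmetric]])
       (use AH.one_closed in \<open>simp only: A_simps(4)\<close>)
  have "t h x = x" if h: "h \<in> H" for h
  proof -
    have "t h x = u h \<star> (ui h \<star> x)" unfolding t_def using \<pi>(3) AV[OF uA(2)[OF h] xV] by simp
    also have "\<dots> = (u h \<star> ui h) \<star> x"
      using R.m_assoc[of "u h" "ui h" x] AR uA[OF h] x by (simp del: R_simps A_simps)
    finally show ?thesis using uui(1)[OF h] R.l_one[OF AR[OF x]] by (simp del: R_simps)
  qed
  then have "(\<Sum>h\<in>H. t h x) = (\<Sum>h\<in>H. x)" by (intro sum.cong) auto
  also have "\<dots> = scale (of_nat (card H)) x"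
    by (rule poly_mapping_eqI) (simp add: lookup_sum)
  finally have \<tau>x: "\<tau> x = x" unfolding \<tau>_def using card by simp
  \<comment> \<open>The image of the identity lies in the left ideal, say
    \<open>y \<star> x\<close>. Since \<open>\<tau>\<close> is left linear and fixes
    \<open>x\<close>, one gets
    \<open>x = x \<star> \<tau> 1 = x \<star> y \<star> x\<close>.\<close>
  obtain y where y: "y \<in> carrier (A H)" "\<tau> \<one>\<^bsub>R\<^esub> = y \<star> x" using \<tau>V unfolding V_def by (meson imageE)
  have "x = \<tau> (x \<star> \<one>\<^bsub>R\<^esub>)" using \<tau>x R.r_one[OF AR[OF x]] by (simp del: R_simps)
  also have "\<dots> = x \<star> (y \<star> x)"
    using \<tau>lin[OF x AH.one_closed] y(2) by (simp del: R_simps)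
  also have "\<dots> = x \<star> y \<star> x" using R.m_assoc[of x y x] AR x y by (simp del: R_simps A_simps)
  finally show ?thesis using y by metis
qed

text \<open>Cauchy's theorem, read off from Sylow's with exponent one: if the characteristic divided
  \<open>card H\<close>, it would be a prime and the order of some element of
  \<open>H\<close>.\<close>

lemma card_nonzero_if_torsion:
  assumes H: "subgroup H G" "finite H" "H \<subseteq> torsion G"
    and char: "\<forall>g\<in>torsion G. \<not> CHAR('k) dvd ord g"
  shows "of_nat (card H) \<noteq> (0 :: 'k)"
proof
  assume "of_nat (card H) = (0 :: 'k)"
  then have dvd: "CHAR('k) dvd card H" by (simp add: of_nat_eq_0_iff_char_dvd)
  have "card H > 0" using H subgroup.one_closed by (fastforce simp: card_gt_0_iff)
  then have "CHAR('k) > 0" using dvd by (metis dvd_0_left gr0I less_irrefl)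
  then have p: "Factorial_Ring.prime CHAR('k)" by (rule prime_CHAR_semidom)
  obtain m where m: "card H = CHAR('k) ^ 1 * m" using dvd by auto
  have "group (G\<lparr>carrier := H\<rparr>)" using H subgroup_imp_group by blast
  then obtain P where P: "subgroup P (G\<lparr>carrier := H\<rparr>)" "card P = CHAR('k)"
    using sylow_thm[OF p, of "G\<lparr>carrier := H\<rparr>" 1 m] m H(2) unfolding order_def by auto
  then have PG: "subgroup P G" using incl_subgroup H by blast
  have PH: "P \<subseteq> H" using subgroup.subset[OF P(1)] by simp
  have "card P \<noteq> 1" using P(2) p not_prime_1 by metis
  then have "P \<noteq> {\<one>}" by auto
  then obtain x where x: "x \<in> P" "x \<noteq> \<one>"
    using subgroup.one_closed[OF PG] by blast
  have xc: "x \<in> carrier G" using x PG subgroup.subset by blast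
  interpret P: group "G\<lparr>carrier := P\<rparr>" using PG subgroup_imp_group by blast
  have "x [^]\<^bsub>G\<lparr>carrier := P\<rparr>\<^esub> order (G\<lparr>carrier := P\<rparr>) = \<one>\<^bsub>G\<lparr>carrier := P\<rparr>\<^esub>"
    by (rule P.pow_order_eq_1) (use x in simp)
  then have "x [^] CHAR('k) = \<one>" using P(2) nat_pow_consistent[of x _ P] by (simp add: order_def)
  then have "ord x dvd CHAR('k)" using pow_eq_id xc by blast
  then have "ord x = 1 \<or> ord x = CHAR('k)" using p prime_nat_iff by blast
  moreover have "ord x \<noteq> 1" using x xc ord_eq_1 by blast
  ultimately show False using char x PH H by fastforce
qed

text \<open>Regularity is local: the support of \<open>x\<close> lies in a finite subgroup of
  torsion elements, where Maschke applies.\<close>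

lemma torsion_span_regular:
  assumes FC: "FC_group G" and char: "\<forall>g\<in>torsion G. \<not> CHAR('k) dvd ord g"
    and x: "x \<in> carrier (A (torsion G))"
  shows "\<exists>y\<in>carrier (A (torsion G)). x \<star> y \<star> x = x"
proof -
  obtain H where H: "subgroup H G" "finite H" "keys x \<subseteq> H" "H \<subseteq> torsion G"
    using finite_subgroup_of_torsion[OF FC, of "keys x"] x by auto
  then obtain y where "y \<in> carrier (A H)" "x \<star> y \<star> x = x"
    using span_regular_if_finite[OF H(1,2) card_nonzero_if_torsion[OF H(1,2,4) char], of x] by auto
  then show ?thesis using H by (intro bexI[of _ y]) auto
qed

end

section \<open>Rings whose units have finite conjugacy classes\<close>

context ring
begin

lemma conj_eq_imp_commute:
  assumes v: "v \<in> Units R" "v' \<in> Units R" and w: "w \<in> carrier R"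
    and eq: "v \<otimes> w \<otimes> inv v = v' \<otimes> w \<otimes> inv v'"
  shows "(inv v' \<otimes> v) \<otimes> w = w \<otimes> (inv v' \<otimes> v)"
proof -
  have c: "v \<in> carrier R" "v' \<in> carrier R" "inv v \<in> carrier R" "inv v' \<in> carrier R" using v by auto
  have "(inv v' \<otimes> v) \<otimes> w = inv v' \<otimes> (v \<otimes> w \<otimes> inv v) \<otimes> v" using v c w by (simp add: m_assoc)
  also have "\<dots> = w \<otimes> (inv v' \<otimes> v)"
    unfolding eq using v c w by (simp add: m_assoc Units_inv_cancel)
  finally show ?thesis .
qed

text \<open>A unit of the corner at \<open>e\<close> is completed by the identity of the
  complementary corner; this turns statements about components into statements about units of the
  whole ring.\<close>

lemma corner_unit:
  assumes e: "e \<in> carrier R" and a: "a \<in> carrier R" "e \<otimes> a = a" "a \<otimes> e = a"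
    and b: "b \<in> carrier R" "e \<otimes> b = b" "b \<otimes> e = b" and ab: "a \<otimes> b = e" "b \<otimes> a = e" "e \<otimes> e = e"
  shows "a \<oplus> (\<one> \<ominus> e) \<in> Units R" "inv (a \<oplus> (\<one> \<ominus> e)) = b \<oplus> (\<one> \<ominus> e)"
proof -
  have e1: "e \<oplus> (\<one> \<ominus> e) = \<one>"
    using e by (simp add: minus_eq a_lcomm[of e \<one> "\<ominus> e"] r_neg)
  have 0: "c \<otimes> (\<one> \<ominus> e) = \<zero>" "(\<one> \<ominus> e) \<otimes> c = \<zero>" if "c \<in> carrier R" "c \<otimes> e = c" "e \<otimes> c = c" for c
    using that e by (simp_all add: minus_eq l_distr r_distr l_minus r_minus r_neg)
  have f: "(\<one> \<ominus> e) \<otimes> (\<one> \<ominus> e) = \<one> \<ominus> e"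
    using e ab(3) by (simp add: minus_eq l_distr r_distr l_minus r_minus l_neg r_neg)
  have "(a \<oplus> (\<one> \<ominus> e)) \<otimes> (b \<oplus> (\<one> \<ominus> e)) = \<one>"
    using e a b ab 0[of a] 0[of b] f e1 by (simp add: l_distr r_distr)
  moreover have "(b \<oplus> (\<one> \<ominus> e)) \<otimes> (a \<oplus> (\<one> \<ominus> e)) = \<one>"
    using e a b ab 0[of a] 0[of b] f e1 by (simp add: l_distr r_distr)
  moreover have "a \<oplus> (\<one> \<ominus> e) \<in> carrier R" "b \<oplus> (\<one> \<ominus> e) \<in> carrier R" using e a b by auto
  ultimately show "a \<oplus> (\<one> \<ominus> e) \<in> Units R" "inv (a \<oplus> (\<one> \<ominus> e)) = b \<oplus> (\<one> \<ominus> e)"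
    using inv_unique'[of "a \<oplus> (\<one> \<ominus> e)" "b \<oplus> (\<one> \<ominus> e)"] unfolding Units_def by (blast, metis)
qed

text \<open>
  If \<open>y = e r (1 - e)\<close> were nonzero, infinitely many units \<open>w\<close> would commute with \<open>e\<close>, and
  \<open>e w + (1 - e)\<close> conjugates \<open>1 + y\<close> into \<open>1 + w y\<close>.
\<close>

lemma idempotent_absorbs_if_finite_conjugates:
  assumes FC: "\<And>x. x \<in> carrier R \<Longrightarrow> finite {v \<otimes> x \<otimes> inv v | v. v \<in> Units R}"
    and M: "infinite M" "M \<subseteq> Units R"
    and trans: "\<And>y B. y \<in> carrier R \<Longrightarrow> y \<noteq> \<zero> \<Longrightarrow> B \<subseteq> M \<Longrightarrow> finite ((\<lambda>m. m \<otimes> y) ` B) \<Longrightarrow> finite B"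
    and e: "e \<in> carrier R" "e \<otimes> e = e" and r: "r \<in> carrier R"
  shows "e \<otimes> r \<otimes> (\<one> \<ominus> e) = \<zero>"
proof (rule ccontr)
  define f where "f = \<one> \<ominus> e"
  define y where "y = e \<otimes> r \<otimes> f"
  assume "e \<otimes> r \<otimes> (\<one> \<ominus> e) \<noteq> \<zero>"
  then have ynz: "y \<noteq> \<zero>" unfolding y_def f_def .
  have fc: "f \<in> carrier R" unfolding f_def using e by auto
  have yc: "y \<in> carrier R" unfolding y_def using e r fc by auto
  have fe: "f \<otimes> e = \<zero>" "e \<otimes> f = \<zero>"
    unfolding f_def using e by (simp_all add: minus_eq l_distr r_distr l_minus r_minus r_neg)
  have ff: "f \<otimes> f = f" using fe(1) fc e unfolding f_def by (simp add: minus_eq r_distr r_minus r_zero)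
  have ef: "e \<oplus> f = \<one>" unfolding f_def using e by (simp add: minus_eq a_lcomm[of e \<one> "\<ominus> e"] r_neg)
  have y: "e \<otimes> y = y" "y \<otimes> e = \<zero>" "f \<otimes> y = \<zero>" "y \<otimes> f = y"
  proof -
    show "e \<otimes> y = y" unfolding y_def using e r fc by (simp add: m_assoc[symmetric])
    show "y \<otimes> e = \<zero>" unfolding y_def using e r fc fe by (simp add: m_assoc)
    show "f \<otimes> y = \<zero>" unfolding y_def using e r fc fe by (simp add: m_assoc[symmetric])
    show "y \<otimes> f = y" unfolding y_def using e r fc ff by (simp add: m_assoc)
  qed
  have "(\<lambda>m. m \<otimes> e \<otimes> inv m) ` M \<subseteq> {v \<otimes> e \<otimes> inv v | v. v \<in> Units R}" using M(2) by blast
  then have "finite ((\<lambda>m. m \<otimes> e \<otimes> inv m) ` M)" using FC[OF e(1)] finite_subset by blast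
  \<comment> \<open>Infinitely many \<open>m\<close> conjugate \<open>e\<close> to the same element,
    so all the quotients \<open>inv m0 \<otimes> m\<close> commute with \<open>e\<close>; these are
    the units \<open>w\<close>.\<close>
  then obtain m0 where m0: "m0 \<in> M" and inf: "infinite {m \<in> M. m \<otimes> e \<otimes> inv m = m0 \<otimes> e \<otimes> inv m0}"
    using pigeonhole_infinite[OF M(1)] by blast
  define B where "B = {m \<in> M. m \<otimes> e \<otimes> inv m = m0 \<otimes> e \<otimes> inv m0}"
  have m0U: "m0 \<in> Units R" using m0 M by blast
  have key: "\<one> \<oplus> inv m0 \<otimes> (m \<otimes> y) \<in> {v \<otimes> (\<one> \<oplus> y) \<otimes> inv v | v. v \<in> Units R}" if m: "m \<in> B" for m
  proof -
    have mU: "m \<in> Units R" using m M unfolding B_def by blast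
    define w where "w = inv m0 \<otimes> m"
    have wU: "w \<in> Units R" unfolding w_def using mU m0U by auto
    have wc: "w \<in> carrier R" "inv w \<in> carrier R" using wU by auto
    have we: "w \<otimes> e = e \<otimes> w"
      unfolding w_def using conj_eq_imp_commute[OF mU m0U e(1)] m unfolding B_def by simp
    have wie: "inv w \<otimes> e = e \<otimes> inv w"
    proof -
      have "inv w \<otimes> (w \<otimes> e) \<otimes> inv w = inv w \<otimes> (e \<otimes> w) \<otimes> inv w" using we by simp
      then show ?thesis using wU wc e by (simp add: m_assoc Units_inv_cancel)
    qed
    have 1: "e \<otimes> (e \<otimes> w) = e \<otimes> w" "e \<otimes> (e \<otimes> inv w) = e \<otimes> inv w"
      using e wc by (simp_all add: m_assoc[symmetric])
    have 2: "(e \<otimes> w) \<otimes> e = e \<otimes> w" "(e \<otimes> inv w) \<otimes> e = e \<otimes> inv w"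
      using e wc by (simp_all add: m_assoc we wie) (simp_all add: m_assoc[symmetric])
    have 3: "(e \<otimes> w) \<otimes> (e \<otimes> inv w) = e" "(e \<otimes> inv w) \<otimes> (e \<otimes> w) = e"
    proof -
      have "(e \<otimes> w) \<otimes> (e \<otimes> inv w) = ((e \<otimes> w) \<otimes> e) \<otimes> inv w" using e wc by (simp add: m_assoc)
      then show "(e \<otimes> w) \<otimes> (e \<otimes> inv w) = e" unfolding 2 using e wc wU by (simp add: m_assoc)
      have "(e \<otimes> inv w) \<otimes> (e \<otimes> w) = ((e \<otimes> inv w) \<otimes> e) \<otimes> w" using e wc by (simp add: m_assoc)
      then show "(e \<otimes> inv w) \<otimes> (e \<otimes> w) = e" unfolding 2 using e wc wU by (simp add: m_assoc)
    qed
    define v where "v = e \<otimes> w \<oplus> f"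
    have vU: "v \<in> Units R"
      unfolding v_def f_def using e wc 1 2 3 by (intro corner_unit(1)[of e _ "e \<otimes> inv w"]) auto
    have vc: "v \<in> carrier R" "inv v \<in> carrier R" using vU by auto
    have wy: "w \<otimes> y \<in> carrier R" using wc yc by auto
    have "v \<otimes> y = e \<otimes> w \<otimes> y"
      unfolding v_def using e wc fc yc y(3) by (simp add: l_distr)
    also have "\<dots> = w \<otimes> y" unfolding we[symmetric] using e wc yc y(1) by (simp add: m_assoc)
    finally have vy: "v \<otimes> y = w \<otimes> y" .
    have "y \<otimes> v = (y \<otimes> e) \<otimes> w \<oplus> y \<otimes> f"
      unfolding v_def using e wc fc yc by (simp add: r_distr m_assoc)
    then have yv: "y \<otimes> v = y" using y wc yc by simp
    have "v \<otimes> (\<one> \<oplus> y) = (\<one> \<oplus> w \<otimes> y) \<otimes> v"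
      using vc yc wc vy yv by (simp add: l_distr r_distr m_assoc)
    then have "v \<otimes> (\<one> \<oplus> y) \<otimes> inv v = \<one> \<oplus> w \<otimes> y"
      using vc vU wy by (simp add: m_assoc)
    moreover have "w \<otimes> y = inv m0 \<otimes> (m \<otimes> y)"
      unfolding w_def using mU m0U yc by (simp add: m_assoc Units_closed)
    ultimately show ?thesis using vU by force
  qed
  have "finite ((\<lambda>m. \<one> \<oplus> inv m0 \<otimes> (m \<otimes> y)) ` B)"
    using FC[of "\<one> \<oplus> y"] yc key by (meson a_closed finite_subset image_subsetI one_closed)
  \<comment> \<open>The product \<open>m \<otimes> y\<close> is recovered from the conjugate by
    removing \<open>\<one>\<close> and multiplying by \<open>m0\<close>. Finitely many conjugates
    thus leave finitely many products, and \<open>trans\<close> makes \<open>B\<close>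
    finite.\<close>
  moreover have "(\<lambda>m. m \<otimes> y) ` B \<subseteq> (\<lambda>z. m0 \<otimes> (z \<ominus> \<one>)) ` (\<lambda>m. \<one> \<oplus> inv m0 \<otimes> (m \<otimes> y)) ` B"
  proof
    fix z assume "z \<in> (\<lambda>m. m \<otimes> y) ` B"
    then obtain m where m: "m \<in> B" "z = m \<otimes> y" by blast
    have zc: "z \<in> carrier R" using m M yc unfolding B_def by (auto simp: Units_closed subset_iff)
    have ic: "inv m0 \<otimes> z \<in> carrier R" using m0U zc by auto
    have "(\<one> \<oplus> inv m0 \<otimes> z) \<ominus> \<one> = inv m0 \<otimes> z"
      using ic by (simp add: minus_eq a_ac r_neg) (simp add: a_assoc[symmetric] r_neg)
    then have "m0 \<otimes> ((\<one> \<oplus> inv m0 \<otimes> (m \<otimes> y)) \<ominus> \<one>) = z"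
      using m0U zc m(2) by (simp add: Units_inv_cancel)
    then show "z \<in> (\<lambda>z. m0 \<otimes> (z \<ominus> \<one>)) ` (\<lambda>m. \<one> \<oplus> inv m0 \<otimes> (m \<otimes> y)) ` B" using m by blast
  qed
  ultimately have finBy: "finite ((\<lambda>m. m \<otimes> y) ` B)" by (meson finite_imageI finite_subset)
  have "B \<subseteq> M" unfolding B_def by auto
  then have "finite B" using finBy by (rule trans[OF yc ynz])
  then show False using inf B_def by simp
qed

text \<open>Absorption is applied to \<open>e\<close> and to \<open>\<one> \<ominus> e\<close>, so
  both off-diagonal Peirce parts of \<open>r\<close> vanish.\<close>

lemma idempotents_central_if_finite_conjugates:
  assumes FC: "\<And>x. x \<in> carrier R \<Longrightarrow> finite {v \<otimes> x \<otimes> inv v | v. v \<in> Units R}"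
    and M: "infinite M" "M \<subseteq> Units R"
    and trans: "\<And>y B. y \<in> carrier R \<Longrightarrow> y \<noteq> \<zero> \<Longrightarrow> B \<subseteq> M \<Longrightarrow> finite ((\<lambda>m. m \<otimes> y) ` B) \<Longrightarrow> finite B"
  shows "idempotents R \<subseteq> center R"
proof
  fix e assume "e \<in> idempotents R"
  then have e: "e \<in> carrier R" "e \<otimes> e = e" unfolding idempotents_def by auto
  define f where "f = \<one> \<ominus> e"
  have f: "f \<in> carrier R" "f \<otimes> f = f"
    unfolding f_def using e by (simp_all add: minus_eq l_distr r_distr l_minus r_minus l_neg r_neg)
  have "e \<oplus> f = \<one>" unfolding f_def using e by (simp add: minus_eq a_lcomm[of e \<one> "\<ominus> e"] r_neg)
  then have f': "\<one> \<ominus> f = e" using e f(1) by (metis add.inv_solve_right minus_eq one_closed)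
  have "e \<otimes> r = r \<otimes> e" if r: "r \<in> carrier R" for r
  proof -
    have "e \<otimes> r \<otimes> (\<one> \<ominus> e) = \<zero>"
      by (rule idempotent_absorbs_if_finite_conjugates[OF FC M trans e r])
    then have "e \<otimes> r \<ominus> e \<otimes> r \<otimes> e = \<zero>"
      using e r by (simp add: minus_eq r_distr r_minus)
    then have 1: "e \<otimes> r = e \<otimes> r \<otimes> e" using e r by simp
    have "f \<otimes> r \<otimes> (\<one> \<ominus> f) = \<zero>"
      by (rule idempotent_absorbs_if_finite_conjugates[OF FC M trans f(1,2) r])
    then have "r \<otimes> e \<ominus> e \<otimes> r \<otimes> e = \<zero>"
      unfolding f' unfolding f_def using e r by (simp add: minus_eq l_distr l_minus)
    then have "r \<otimes> e = e \<otimes> r \<otimes> e" using e r by simp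
    then show ?thesis using 1 by simp
  qed
  then show "e \<in> center R" unfolding center_def using e(1) by blast
qed

text \<open>
  The classical proof that noncentral elements of an infinite division ring have infinitely many
  conjugates, for a division ring \<open>D\<close> with identity \<open>e\<close> acting on the ambient ring.
\<close>

lemma infinite_division_subring_commutes:
  assumes FC: "\<And>x. x \<in> carrier R \<Longrightarrow> finite {v \<otimes> x \<otimes> inv v | v. v \<in> Units R}"
    and e: "e \<in> center R" "e \<in> D"
    and D: "D \<subseteq> carrier R" "infinite D" "\<And>a. a \<in> D \<Longrightarrow> e \<otimes> a = a"
      "\<And>a b. a \<in> D \<Longrightarrow> b \<in> D \<Longrightarrow> a \<otimes> b \<in> D" "\<And>a b. a \<in> D \<Longrightarrow> b \<in> D \<Longrightarrow> a \<oplus> b \<in> D"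
      "\<And>a. a \<in> D \<Longrightarrow> \<ominus> a \<in> D"
      "\<And>a. a \<in> D \<Longrightarrow> a \<noteq> \<zero> \<Longrightarrow> \<exists>b\<in>D. a \<otimes> b = e \<and> b \<otimes> a = e"
    and w: "w \<in> carrier R" and y: "y \<in> D"
  shows "y \<otimes> w = w \<otimes> y"
proof (rule ccontr)
  assume yw: "y \<otimes> w \<noteq> w \<otimes> y"
  have ec: "e \<in> carrier R" "e \<otimes> e = e" using e(2) D(1,3) by auto
  have ecom: "\<And>x. x \<in> carrier R \<Longrightarrow> e \<otimes> x = x \<otimes> e" using e(1) unfolding center_def by blast
  have Dc: "\<And>a. a \<in> D \<Longrightarrow> a \<in> carrier R" using D(1) by auto
  have De: "a \<otimes> e = a" if "a \<in> D" for a using ecom[OF Dc[OF that]] D(3)[OF that] by simp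
  \<comment> \<open>Embeds the nonzero elements of \<open>D\<close> multiplicatively into the units
    of the ring; \<open>v a\<close> commutes with \<open>w\<close> only if \<open>a\<close> does,
    because \<open>e\<close> is central.\<close>
  define v where "v = (\<lambda>a. a \<oplus> (\<one> \<ominus> e))"
  have vU: "v a \<in> Units R" and vi: "inv (v a) = v b"
    if "a \<in> D" "b \<in> D" "a \<otimes> b = e" "b \<otimes> a = e" for a b
    using corner_unit[of e a b] that ec Dc D(3) De unfolding v_def by auto
  have vm: "v a \<otimes> v b = v (a \<otimes> b)" if "a \<in> D" "b \<in> D" for a b
  proof -
    have "c \<otimes> (\<one> \<ominus> e) = \<zero>" "(\<one> \<ominus> e) \<otimes> c = \<zero>" if "c \<in> D" for c
      using Dc[OF that] De[OF that] D(3)[OF that] ec by (simp_all add: minus_eq l_distr r_distr l_minus r_minus r_neg)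
    moreover have "(\<one> \<ominus> e) \<otimes> (\<one> \<ominus> e) = \<one> \<ominus> e"
      using ec by (simp add: minus_eq l_distr r_distr l_minus r_minus l_neg r_neg)
    ultimately show ?thesis unfolding v_def using that Dc ec by (simp add: l_distr r_distr)
  qed
  have vcom: "a \<otimes> w = w \<otimes> a" if "a \<in> D" "v a \<otimes> w = w \<otimes> v a" for a
  proof -
    have "(\<one> \<ominus> e) \<otimes> w = w \<otimes> (\<one> \<ominus> e)"
      using ecom[OF w] ec w by (simp add: minus_eq l_distr r_distr l_minus r_minus)
    then have "a \<otimes> w \<oplus> w \<otimes> (\<one> \<ominus> e) = w \<otimes> a \<oplus> w \<otimes> (\<one> \<ominus> e)"
      using that(2) Dc[OF that(1)] w ec unfolding v_def by (simp add: l_distr r_distr)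
    then show ?thesis using Dc[OF that(1)] w ec by (simp add: add.right_cancel)
  qed
  define cj where "cj = (\<lambda>a. v a \<otimes> w \<otimes> inv (v a))"
  \<comment> \<open>Elements of \<open>D\<close> that conjugate \<open>w\<close> alike differ by a
    right factor in the centraliser of \<open>w\<close>.\<close>
  have quot: "\<exists>d\<in>D. a = a' \<otimes> d \<and> d \<otimes> w = w \<otimes> d \<and> (\<exists>b\<in>D. a' \<otimes> b = e \<and> d = b \<otimes> a)"
    if a: "a \<in> D" "a \<noteq> \<zero>" "a' \<in> D" "a' \<noteq> \<zero>" "cj a = cj a'" for a a'
  proof -
    obtain b' where b': "b' \<in> D" "a' \<otimes> b' = e" "b' \<otimes> a' = e" using D(7) a by blast
    obtain b where b: "b \<in> D" "a \<otimes> b = e" "b \<otimes> a = e" using D(7) a by blast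
    have "v (b' \<otimes> a) \<otimes> w = w \<otimes> v (b' \<otimes> a)"
      using conj_eq_imp_commute[OF vU[OF a(1) b] vU[OF a(3) b'] w] a(5)
      unfolding cj_def vi[OF a(3) b'] vm[OF b'(1) a(1)] by blast
    then have "(b' \<otimes> a) \<otimes> w = w \<otimes> (b' \<otimes> a)" using vcom D(4) b' a by blast
    moreover have "a' \<otimes> (b' \<otimes> a) = a" using a b' Dc D(3) by (simp add: m_assoc[symmetric])
    ultimately show ?thesis using D(4)[OF b'(1) a(1)] b' by metis
  qed
  have fincj: "finite (cj ` Y)" if Y: "Y \<subseteq> D - {\<zero>}" for Y
  proof -
    have "cj ` Y \<subseteq> {v \<otimes> w \<otimes> inv v | v. v \<in> Units R}"
    proof
      fix z assume "z \<in> cj ` Y"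
      then obtain a where a: "a \<in> D" "a \<noteq> \<zero>" "z = cj a" using Y by blast
      then obtain b where "b \<in> D" "a \<otimes> b = e" "b \<otimes> a = e" using D(7) by blast
      then show "z \<in> {v \<otimes> w \<otimes> inv v | v. v \<in> Units R}" using vU a unfolding cj_def by blast
    qed
    then show ?thesis using FC[OF w] finite_subset by blast
  qed
  define C where "C = {c \<in> D. c \<otimes> w = w \<otimes> c}"
  \<comment> \<open>Pigeonhole: infinitely many \<open>a\<close> conjugate \<open>w\<close> alike,
    and each is one fixed \<open>a'\<close> times an element of \<open>C\<close>.\<close>
  have infC: "infinite C"
  proof
    assume finC: "finite C"
    have "infinite (D - {\<zero>})" using D(2) by simp
    then obtain a' where a': "a' \<in> D - {\<zero>}" and inf: "infinite {a \<in> D - {\<zero>}. cj a = cj a'}"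
      using pigeonhole_infinite[OF _ fincj[OF subset_refl]] by blast
    have "{a \<in> D - {\<zero>}. cj a = cj a'} \<subseteq> (\<lambda>d. a' \<otimes> d) ` C"
    proof
      fix a assume "a \<in> {a \<in> D - {\<zero>}. cj a = cj a'}"
      then obtain d where "d \<in> D" "a = a' \<otimes> d" "d \<otimes> w = w \<otimes> d" using quot a' by blast
      then show "a \<in> (\<lambda>d. a' \<otimes> d) ` C" unfolding C_def by blast
    qed
    then show False using finC inf by (meson finite_imageI finite_subset)
  qed
  have Cc: "\<And>c. c \<in> C \<Longrightarrow> c \<in> carrier R" and CD: "\<And>c. c \<in> C \<Longrightarrow> c \<in> D" and Cw: "\<And>c. c \<in> C \<Longrightarrow> c \<otimes> w = w \<otimes> c"
    unfolding C_def using Dc by auto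
  have yc: "y \<in> carrier R" using y Dc by auto
  have Cneg: "\<ominus> c \<in> C" if "c \<in> C" for c
    using that D(6) Dc w unfolding C_def by (auto simp: l_minus r_minus)
  have Cadd: "c \<oplus> d \<in> C" if "c \<in> C" "d \<in> C" for c d
    using that D(5) Dc w unfolding C_def by (auto simp: l_distr r_distr)
  have Cmul: "c \<otimes> d \<in> C" if cd: "c \<in> C" "d \<in> C" for c d
  proof -
    have "c \<otimes> d \<otimes> w = c \<otimes> (d \<otimes> w)" using cd Cc w by (simp add: m_assoc)
    also have "\<dots> = (c \<otimes> w) \<otimes> d" unfolding Cw[OF cd(2)] using cd Cc w by (simp add: m_assoc)
    also have "\<dots> = w \<otimes> (c \<otimes> d)" unfolding Cw[OF cd(1)] using cd Cc w by (simp add: m_assoc)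
    finally show ?thesis using D(4) CD cd unfolding C_def by blast
  qed
  have yC: "y \<notin> C" using yw C_def by auto
  have ycnz: "y \<oplus> c \<noteq> \<zero>" if c: "c \<in> C" for c
  proof
    assume "y \<oplus> c = \<zero>"
    then have "y = \<ominus> c" using yc Cc[OF c] minus_equality by auto
    then show False using Cneg[OF c] yC by simp
  qed
  have ycD: "y \<oplus> c \<in> D" if "c \<in> C" for c using that y D(5) CD by blast
  have "finite ((\<lambda>c. cj (y \<oplus> c)) ` C)"
  proof -
    have "(\<lambda>c. y \<oplus> c) ` C \<subseteq> D - {\<zero>}" by (intro image_subsetI DiffI ycD) (simp_all add: ycnz)
    from fincj[OF this] show ?thesis by (simp add: image_image)
  qed
  \<comment> \<open>A second pigeonhole, on the translates of \<open>y\<close> by \<open>C\<close>: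
    two distinct ones conjugate \<open>w\<close> alike and hence differ by a right factor
    \<open>d\<close> in \<open>C\<close>. This is a linear equation for \<open>y\<close> over
    \<open>C\<close>.\<close>
  then obtain c' where c': "c' \<in> C" and inf: "infinite {c \<in> C. cj (y \<oplus> c) = cj (y \<oplus> c')}"
    using pigeonhole_infinite[OF infC] by blast
  have "\<not> {c \<in> C. cj (y \<oplus> c) = cj (y \<oplus> c')} \<subseteq> {c'}" using inf by (meson finite.simps finite_subset)
  then obtain c where c: "c \<in> C" "cj (y \<oplus> c) = cj (y \<oplus> c')" "c \<noteq> c'" by blast
  obtain d where d: "d \<in> D" "y \<oplus> c = (y \<oplus> c') \<otimes> d" "d \<otimes> w = w \<otimes> d"
    using quot[OF ycD[OF c(1)] ycnz[OF c(1)] ycD[OF c'] ycnz[OF c'] c(2)] by blast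
  have dC: "d \<in> C" unfolding C_def using d by auto
  have eC: "e \<in> C" unfolding C_def using e ecom[OF w] by auto
  have cc: "c \<in> carrier R" "c' \<in> carrier R" "d \<in> carrier R" using c c' dC Cc by auto
  define g where "g = e \<oplus> \<ominus> d"
  have gC: "g \<in> C" unfolding g_def using eC dC Cneg Cadd by blast
  have gnz: "g \<noteq> \<zero>"
  proof
    assume "g = \<zero>"
    then have "d = e" unfolding g_def using ec cc by (metis minus_eq r_right_minus_eq)
    then have "y \<oplus> c = y \<oplus> c'" using d(2) De[OF ycD[OF c']] by simp
    then show False using yc cc c(3) by simp
  qed
  obtain k where k: "k \<in> D" "g \<otimes> k = e" "k \<otimes> g = e" using D(7)[OF CD[OF gC] gnz] by blast
  have kc: "k \<in> carrier R" and gc: "g \<in> carrier R" using k Dc gC Cc by auto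
  have kC: "k \<in> C"
  proof -
    have "k \<otimes> w = (k \<otimes> w) \<otimes> (g \<otimes> k)" using k(2) ecom[of "k \<otimes> w"] D(3)[OF k(1)] kc w ec by (simp add: m_assoc[symmetric])
    also have "\<dots> = k \<otimes> (w \<otimes> g) \<otimes> k" using kc w gc by (simp add: m_assoc)
    also have "\<dots> = (k \<otimes> g) \<otimes> w \<otimes> k" unfolding Cw[OF gC, symmetric] using kc w gc by (simp add: m_assoc)
    also have "\<dots> = (w \<otimes> e) \<otimes> k" using k(3) ecom[OF w] by simp
    also have "\<dots> = w \<otimes> k" using kc w ec D(3)[OF k(1)] by (simp add: m_assoc)
    finally show ?thesis unfolding C_def using k by auto
  qed
  \<comment> \<open>The equation \<open>y \<oplus> c = (y \<oplus> c') \<otimes> d\<close> solved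
    for \<open>y\<close>, with \<open>g = e - d\<close>. As \<open>g\<close> is invertible within
    \<open>C\<close>, \<open>y\<close> would lie in \<open>C\<close>.\<close>
  have "y \<otimes> g = c' \<otimes> d \<oplus> \<ominus> c"
  proof -
    have "y \<otimes> d \<oplus> c' \<otimes> d = y \<oplus> c" using d(2) yc cc by (simp add: l_distr)
    then have "y \<oplus> (c \<oplus> (\<ominus> (y \<otimes> d) \<oplus> \<ominus> c)) = (y \<otimes> d \<oplus> c' \<otimes> d) \<oplus> (\<ominus> (y \<otimes> d) \<oplus> \<ominus> c)"
      using yc cc by (simp add: a_assoc)
    moreover have "c \<oplus> (\<ominus> (y \<otimes> d) \<oplus> \<ominus> c) = \<ominus> (y \<otimes> d)"
      using yc cc by (simp add: a_lcomm[of c] r_neg)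
    moreover have "(y \<otimes> d \<oplus> c' \<otimes> d) \<oplus> (\<ominus> (y \<otimes> d) \<oplus> \<ominus> c) = c' \<otimes> d \<oplus> \<ominus> c"
    proof -
      define p q where "p = y \<otimes> d" and "q = c' \<otimes> d"
      have "p \<in> carrier R" "q \<in> carrier R" unfolding p_def q_def using yc cc by auto
      then show ?thesis unfolding p_def[symmetric] q_def[symmetric] using cc
        by (simp add: a_comm[of p q] a_assoc) (simp add: a_assoc[symmetric] r_neg)
    qed
    ultimately show ?thesis unfolding g_def using yc cc De[OF y] ec by (simp add: r_distr r_minus)
  qed
  then have "y \<otimes> g \<in> C" using Cadd Cmul Cneg c c' dC by simp
  then have "y \<otimes> g \<otimes> k \<in> C" using Cmul kC by blast
  moreover have "y \<otimes> g \<otimes> k = y" using yc gc kc k(2) De[OF y] by (simp add: m_assoc)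
  ultimately show False using yC by simp
qed

end

section \<open>From FC units to the conditions\<close>

context twisted_algebra
begin

lemma finsum_A:
  assumes H: "subgroup H G" and E: "finite E" "\<And>e. e \<in> E \<Longrightarrow> f e \<in> carrier (A H)"
  shows "finsum (A H) f E = sum f E"
proof -
  interpret AH: ring "A H" using ring_A H by blast
  show ?thesis using E
  proof (induction E rule: finite_induct)
    case empty show ?case by simp
  next
    case (insert e E)
    then show ?case by (subst AH.finsum_insert) (auto simp: Pi_def)
  qed
qed

lemma conj_u:
  assumes "h \<in> carrier G" "g \<in> carrier G"
  shows "\<exists>c. c \<noteq> 0 \<and> u h \<star> u g \<star> inv\<^bsub>R\<^esub> (u h) = single (h \<otimes> g \<otimes> inv h) c"
proof -
  let ?c = "lam h g * inverse (lam h (inv h) * lam \<one> \<one>) * lam (h \<otimes> g) (inv h)"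
  have "?c \<noteq> 0" using assms lam_nonzero by simp
  moreover have "u h \<star> u g \<star> inv\<^bsub>R\<^esub> (u h) = single (h \<otimes> g \<otimes> inv h) ?c"
    using assms by (subst inv_u) (auto simp: u_def)
  ultimately show ?thesis by blast
qed

text \<open>The origin of condition 2: apart from the constant
  \<open>inverse (lam \<one> \<one>)\<close>, the coefficient is the expression whose values are
  required to be finite in number.\<close>

lemma inv_conj_u:
  assumes "h \<in> carrier G" "g \<in> carrier G"
  shows "inv\<^bsub>R\<^esub> (u h) \<star> u g \<star> u h = single (inv h \<otimes> g \<otimes> h)
    (inverse (lam h (inv h)) * lam (inv h) g * lam (inv h \<otimes> g) h * inverse (lam \<one> \<one>))"
  using assms by (subst inv_u) (auto simp: u_def mult_ac)

lemma FC_units_iff: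
  "FC_group (units_of R) \<longleftrightarrow> (\<forall>x\<in>Units R. finite {v \<star> x \<star> inv\<^bsub>R\<^esub> v | v. v \<in> Units R})"
proof -
  have "{h \<otimes>\<^bsub>units_of R\<^esub> x \<otimes>\<^bsub>units_of R\<^esub> inv\<^bsub>units_of R\<^esub> h | h. h \<in> carrier (units_of R)} =
      {v \<star> x \<star> inv\<^bsub>R\<^esub> v | v. v \<in> Units R}" for x
    unfolding units_of_carrier units_of_mult using R.units_of_inv by (metis (no_types, lifting))
  then show ?thesis
    unfolding FC_group_def using R.units_group by (simp add: units_of_carrier)
qed

text \<open>Extends finiteness from units to all elements: each is a sum of monomials, which are
  units, and a conjugate of a sum is a sum of conjugates.\<close>

lemma finite_conjugates_if_FC_units:
  assumes FC: "FC_group (units_of R)" and a: "a \<in> carrier R"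
  shows "finite {v \<star> a \<star> inv\<^bsub>R\<^esub> v | v. v \<in> Units R}"
proof -
  have "keys a \<subseteq> carrier G" using a by simp
  then show ?thesis
  proof (induction a rule: poly_mapping_span_induct)
    case zero
    have "{v \<star> 0 \<star> inv\<^bsub>R\<^esub> v | v. v \<in> Units R} \<subseteq> {0}" by auto
    then show ?case by (rule finite_subset) simp
  next
    case (single g c)
    then show ?case using FC inv_single(1) unfolding FC_units_iff by blast
  next
    case (add a b)
    have "{v \<star> (a + b) \<star> inv\<^bsub>R\<^esub> v | v. v \<in> Units R} \<subseteq>
      (\<lambda>(p, q). p + q) ` ({v \<star> a \<star> inv\<^bsub>R\<^esub> v | v. v \<in> Units R} \<times> {v \<star> b \<star> inv\<^bsub>R\<^esub> v | v. v \<in> Units R})"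
      by (auto simp: tmult_add_left tmult_add_right image_iff)
    then show ?case using add by (meson finite_SigmaI finite_imageI finite_subset)
  qed
qed

text \<open>A conjugate of \<open>u g\<close> by a basis element is supported at the corresponding
  group conjugate, and finitely many elements have finitely many support points.\<close>

lemma FC_group_if_FC_units:
  assumes "FC_group (units_of R)"
  shows "FC_group G"
  unfolding FC_group_def
proof (intro conjI ballI)
  show "group G" by (rule group_axioms)
  fix g assume g: "g \<in> carrier G"
  have fin: "finite {v \<star> u g \<star> inv\<^bsub>R\<^esub> v | v. v \<in> Units R}"
    using assms u_Units[OF g] unfolding FC_units_iff by blast
  have "{h \<otimes> g \<otimes> inv h | h. h \<in> carrier G} \<subseteq>
      (\<Union>z\<in>{v \<star> u g \<star> inv\<^bsub>R\<^esub> v | v. v \<in> Units R}. keys z)"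
  proof
    fix k assume "k \<in> {h \<otimes> g \<otimes> inv h | h. h \<in> carrier G}"
    then obtain h where h: "h \<in> carrier G" "k = h \<otimes> g \<otimes> inv h" by blast
    obtain c where "c \<noteq> 0" "u h \<star> u g \<star> inv\<^bsub>R\<^esub> (u h) = single k c"
      using conj_u[OF h(1) g] h(2) by blast
    then have "k \<in> keys (u h \<star> u g \<star> inv\<^bsub>R\<^esub> (u h))" by simp
    then show "k \<in> (\<Union>z\<in>{v \<star> u g \<star> inv\<^bsub>R\<^esub> v | v. v \<in> Units R}. keys z)"
      using u_Units[OF h(1)] by blast
  qed
  then show "finite {h \<otimes> g \<otimes> inv h | h. h \<in> carrier G}"
    using fin by (meson finite_UN finite_keys finite_subset)
qed

abbreviation cocycle_conj :: "'g \<Rightarrow> 'k set" where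
  "cocycle_conj g \<equiv> {inverse (lam h (inv h)) * lam (inv h) g * lam (inv h \<otimes> g) h | h. h \<in> carrier G}"

text \<open>Up to the factor \<open>lam \<one> \<one>\<close>, the values are coefficients of
  conjugates of \<open>u g\<close>, and finitely many conjugates have finitely many coefficients in
  all.\<close>

lemma finite_cocycle_conj_if_FC_units:
  assumes "FC_group (units_of R)" and g: "g \<in> carrier G"
  shows "finite (cocycle_conj g)"
proof -
  let ?F = "{v \<star> u g \<star> inv\<^bsub>R\<^esub> v | v. v \<in> Units R}"
  have fin: "finite ?F" using assms(1) u_Units[OF g] unfolding FC_units_iff by blast
  have "cocycle_conj g \<subseteq> (\<Union>z\<in>?F. (\<lambda>k. lookup z k * lam \<one> \<one>) ` keys z)"
  proof
    fix c assume "c \<in> cocycle_conj g"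
    then obtain h where h: "h \<in> carrier G"
      "c = inverse (lam h (inv h)) * lam (inv h) g * lam (inv h \<otimes> g) h" by blast
    let ?z = "inv\<^bsub>R\<^esub> (u h) \<star> u g \<star> u h" and ?k = "inv h \<otimes> g \<otimes> h"
    have l: "lookup ?z ?k = c * inverse (lam \<one> \<one>)"
      using inv_conj_u[OF h(1) g] h(2) by simp
    have nz: "lam \<one> \<one> \<noteq> 0" "c \<noteq> 0" using h g lam_nonzero by auto
    then have "?k \<in> keys ?z" "c = lookup ?z ?k * lam \<one> \<one>"
      using l by (auto simp: in_keys_iff)
    moreover have "?z \<in> ?F"
      using R.Units_inv_Units[OF u_Units[OF h(1)]] R.Units_inv_inv[OF u_Units[OF h(1)]] by force
    ultimately show "c \<in> (\<Union>z\<in>?F. (\<lambda>k. lookup z k * lam \<one> \<one>) ` keys z)"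
      by blast
  qed
  then show ?thesis by (rule finite_subset) (intro finite_UN_I fin finite_imageI finite_keys)
qed

text \<open>The FC property bounds the supports and condition 2 bounds the coefficients.\<close>

lemma finite_inv_conj:
  assumes FC: "FC_group G" and cc: "\<And>g. g \<in> carrier G \<Longrightarrow> finite (cocycle_conj g)" and g: "g \<in> carrier G"
  shows "finite {inv\<^bsub>R\<^esub> (u h) \<star> single g c \<star> u h | h. h \<in> carrier G}"
proof -
  let ?C = "{h \<otimes> g \<otimes> inv h | h. h \<in> carrier G}"
  have "{inv\<^bsub>R\<^esub> (u h) \<star> single g c \<star> u h | h. h \<in> carrier G} \<subseteq>
     (\<lambda>(k, d). scale c (single k (d * inverse (lam \<one> \<one>)))) ` (?C \<times> cocycle_conj g)"
  proof
    fix z assume "z \<in> {inv\<^bsub>R\<^esub> (u h) \<star> single g c \<star> u h | h. h \<in> carrier G}"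
    then obtain h where h: "h \<in> carrier G" "z = inv\<^bsub>R\<^esub> (u h) \<star> single g c \<star> u h" by blast
    have "single g c = scale c (u g)" unfolding u_def by simp
    then have "z = scale c (inv\<^bsub>R\<^esub> (u h) \<star> u g \<star> u h)"
      using h(2) by (simp add: tmult_scale_left tmult_scale_right)
    moreover have "inv h \<otimes> g \<otimes> h \<in> ?C" using h(1) by (force intro: exI[of _ "inv h"])
    ultimately show "z \<in> (\<lambda>(k, d). scale c (single k (d * inverse (lam \<one> \<one>)))) ` (?C \<times> cocycle_conj g)"
      unfolding inv_conj_u[OF h(1) g] using h(1)
      by (intro image_eqI[of _ _ "(inv h \<otimes> g \<otimes> h, inverse (lam h (inv h)) * lam (inv h) g * lam (inv h \<otimes> g) h)"]) auto
  qed
  moreover have "finite ?C" using FC g unfolding FC_group_def by blast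
  ultimately show ?thesis using cc[OF g] by (meson finite_SigmaI finite_imageI finite_subset)
qed

lemma A_idempotents_subset: "H \<subseteq> carrier G \<Longrightarrow> idempotents (A H) \<subseteq> idempotents R"
  unfolding idempotents_def by auto

lemma torsion_span_locale:
  assumes FC: "FC_group G" and char: "\<forall>g\<in>torsion G. \<not> CHAR('k) dvd ord g"
    and fin: "finite (idempotents (A (torsion G)))"
    and cen: "idempotents (A (torsion G)) \<subseteq> center R"
  shows "finite_central_idempotents_regular (A (torsion G))"
proof -
  have sub: "subgroup (torsion G) G" using torsion_subgroup[OF FC] .
  interpret AT: ring "A (torsion G)" using ring_A[OF sub] .
  show ?thesis
  proof
    show "finite (idempotents (A (torsion G)))" by fact
    show "idempotents (A (torsion G)) \<subseteq> center (A (torsion G))"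
    proof
      fix e assume e: "e \<in> idempotents (A (torsion G))"
      then have "e \<in> carrier (A (torsion G))" unfolding idempotents_def by blast
      moreover have "e \<star> x = x \<star> e" if "x \<in> carrier (A (torsion G))" for x
        using cen e that torsion_subset unfolding center_def by (auto simp: subset_iff)
      ultimately show "e \<in> center (A (torsion G))" unfolding center_def by simp
    qed
    show "\<exists>y\<in>carrier (A (torsion G)). x \<otimes>\<^bsub>A (torsion G)\<^esub> y \<otimes>\<^bsub>A (torsion G)\<^esub> x = x"
      if "x \<in> carrier (A (torsion G))" for x
      using torsion_span_regular[OF FC char that] by simp
  qed
qed

lemma idempotents_central_if_FC_units:
  assumes inf: "infinite (carrier R)" and FC: "FC_group (units_of R)"
  shows "idempotents R \<subseteq> center R"
proof (rule R.idempotents_central_if_finite_conjugates)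
  show "finite {v \<star> x \<star> inv\<^bsub>R\<^esub> v | v. v \<in> Units R}" if "x \<in> carrier R" for x
    using finite_conjugates_if_FC_units[OF FC that] .
  show "infinite (monomials (carrier G))" using inf finite_span_if_finite_monomials by auto
  show "monomials (carrier G) \<subseteq> Units R" unfolding monomials_def using inv_single(1) by blast
  show "finite B" if "y \<in> carrier R" "y \<noteq> \<zero>\<^bsub>R\<^esub>" "B \<subseteq> monomials (carrier G)" "finite ((\<lambda>m. m \<star> y) ` B)" for y B
    using finite_monomials_if_finite_translates that by simp
qed

lemma torsion_span_structure_if_FC_units:
  assumes inf: "infinite (carrier R)"
    and char: "\<forall>g\<in>torsion G. \<not> CHAR('k) dvd ord g"
    and fin: "finite (idempotents (A (torsion G)))"
    and FCU: "FC_group (units_of R)"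
  shows "direct_sum_of_fields (A (torsion G))"
    "infinite (carrier (A (torsion G))) \<Longrightarrow> carrier (A (torsion G)) \<subseteq> center R"
proof -
  have FC: "FC_group G" using FC_group_if_FC_units[OF FCU] .
  have sub: "subgroup (torsion G) G" using torsion_subgroup[OF FC] .
  have cen: "idempotents (A (torsion G)) \<subseteq> center R"
    using A_idempotents_subset[OF torsion_subset] idempotents_central_if_FC_units[OF inf FCU] by blast
  interpret AT: finite_central_idempotents_regular "A (torsion G)"
    using torsion_span_locale[OF FC char fin cen] .
  have AR: "x \<in> carrier R" if "x \<in> carrier (A (torsion G))" for x using that torsion_subset by auto
  show central: "carrier (A (torsion G)) \<subseteq> center R" if infA: "infinite (carrier (A (torsion G)))"
  proof
    fix x assume x: "x \<in> carrier (A (torsion G))"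
    have comm: "y \<star> w = w \<star> y"
      if e: "e \<in> AT.E" and y: "y \<in> carrier (A (torsion G))" "e \<star> y = y" and w: "w \<in> carrier R" for e y w
    proof -
      define D where "D = {y \<in> carrier (A (torsion G)). e \<star> y = y}"
      have eA: "e \<in> carrier (A (torsion G))" "e \<star> e = e"
        using AT.E_idempotent[OF e] AT.idempotentD by auto
      have ecR: "e \<in> center R" using cen AT.E_idempotent[OF e] by blast
      have ecom: "e \<star> z = z \<star> e" if "z \<in> carrier R" for z using ecR that unfolding center_def by blast
      have enz: "e \<noteq> 0" using e unfolding primitive_idempotents_def by simp
      \<comment> \<open>\<open>D\<close> contains all multiples of \<open>e\<close> by the span; a
        finite \<open>D\<close> would make the whole span finite, as \<open>e\<close> is
        nonzero.\<close>
      have "infinite D"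
      proof
        assume "finite D"
        moreover have "{a \<star> e | a. keys a \<subseteq> torsion G} \<subseteq> D"
        proof
          fix z assume "z \<in> {a \<star> e | a. keys a \<subseteq> torsion G}"
          then obtain a where a: "a \<in> carrier (A (torsion G))" "z = a \<star> e" by auto
          have "z \<in> carrier (A (torsion G))" using AT.m_closed[OF a(1) eA(1)] a(2) by (simp del: A_simps add: A_simps(5))
          moreover have "e \<star> z = z"
            using ecom[OF AR[OF a(1)]] a(2) eA(2) AR[OF a(1)] AR[OF eA(1)] ecom R.m_assoc R.m_closed by metis
          ultimately show "z \<in> D" unfolding D_def by blast
        qed
        ultimately have "finite {a \<star> e | a. keys a \<subseteq> torsion G}" using finite_subset by blast
        then show False
          using finite_span_if_finite_ideal[OF torsion_subset AR[OF eA(1)] enz] infA by simp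
      qed
      have "y \<in> D" unfolding D_def using y by blast
      show ?thesis
      proof (rule R.infinite_division_subring_commutes[OF finite_conjugates_if_FC_units[OF FCU] ecR _ _ \<open>infinite D\<close> _ _ _ _ _ w \<open>y \<in> D\<close>])
        show "e \<in> D" "D \<subseteq> carrier R" unfolding D_def using eA AR by auto
        fix a assume a: "a \<in> D"
        then have aA: "a \<in> carrier (A (torsion G))" "e \<star> a = a" unfolding D_def by blast+
        show "e \<star> a = a" by fact
        show "\<ominus>\<^bsub>R\<^esub> a \<in> D"
        proof -
          have neg: "\<ominus>\<^bsub>R\<^esub> a = - a" using AR[OF aA(1)] by (intro R.minus_equality) auto
          moreover have "e \<star> (\<ominus>\<^bsub>R\<^esub> a) = \<ominus>\<^bsub>R\<^esub> a"
            using R.r_minus[OF AR[OF eA(1)] AR[OF aA(1)]] aA(2) by simp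
          ultimately show ?thesis using aA(1) unfolding D_def by simp
        qed
        show "\<exists>b\<in>D. a \<star> b = e \<and> b \<star> a = e" if "a \<noteq> \<zero>\<^bsub>R\<^esub>"
        proof -
          have 1: "e \<otimes>\<^bsub>A (torsion G)\<^esub> a = a" and 2: "a \<noteq> \<zero>\<^bsub>A (torsion G)\<^esub>"
            using aA(2) that by simp_all
          obtain b where "b \<in> carrier (A (torsion G))" "e \<otimes>\<^bsub>A (torsion G)\<^esub> b = b"
            "a \<otimes>\<^bsub>A (torsion G)\<^esub> b = e" "b \<otimes>\<^bsub>A (torsion G)\<^esub> a = e"
            by (rule AT.E_corner_division[OF e aA(1) 1 2 AT.regular[OF aA(1)]])
          then show ?thesis unfolding D_def A_simps(5) by blast
        qed
        fix b assume "b \<in> D"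
        then have bA: "b \<in> carrier (A (torsion G))" "e \<star> b = b" unfolding D_def by blast+
        have "a \<star> b \<in> carrier (A (torsion G))" using AT.m_closed[OF aA(1) bA(1)] by (simp only: A_simps(5))
        moreover have "e \<star> (a \<star> b) = a \<star> b"
          using R.m_assoc[OF AR[OF eA(1)] AR[OF aA(1)] AR[OF bA(1)]] aA(2) by simp
        ultimately show "a \<star> b \<in> D" unfolding D_def by blast
        have "a \<oplus>\<^bsub>R\<^esub> b \<in> carrier (A (torsion G))" using AT.a_closed[OF aA(1) bA(1)] by simp
        then show "a \<oplus>\<^bsub>R\<^esub> b \<in> D" unfolding D_def using aA(2) bA(2) by (simp add: tmult_add_right)
      qed
    qed
    have xE: "x = (\<Sum>e\<in>AT.E. e \<star> x)"
      using AT.E_decomposition[OF x] finsum_A[OF sub AT.finite_E, of "\<lambda>e. e \<otimes>\<^bsub>A (torsion G)\<^esub> x"]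
        AT.m_closed[OF AT.E_carrier x] by (simp only: A_simps(5))
    have "x \<star> w = w \<star> x" if w: "w \<in> carrier R" for w
    proof -
      have "(e \<star> x) \<star> w = w \<star> (e \<star> x)" if e: "e \<in> AT.E" for e
      proof (rule comm[OF e _ _ w])
        have eA: "e \<in> carrier (A (torsion G))" "e \<star> e = e"
          using AT.E_idempotent[OF e] AT.idempotentD by auto
        show "e \<star> x \<in> carrier (A (torsion G))" using AT.m_closed[OF eA(1) x] by (simp only: A_simps(5))
        show "e \<star> (e \<star> x) = e \<star> x" using R.m_assoc[OF AR[OF eA(1)] AR[OF eA(1)] AR[OF x]] eA(2) by simp
      qed
      then have "(\<Sum>e\<in>AT.E. e \<star> x) \<star> w = w \<star> (\<Sum>e\<in>AT.E. e \<star> x)"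
        by (simp add: tmult_sum_left tmult_sum_right)
      then show ?thesis using xE by simp
    qed
    then show "x \<in> center R" unfolding center_def using AR[OF x] by blast
  qed
  show "direct_sum_of_fields (A (torsion G))"
  proof (rule AT.direct_sum_of_fieldsI)
    fix x y assume xy: "x \<in> carrier (A (torsion G))" "y \<in> carrier (A (torsion G))"
    show "x \<otimes>\<^bsub>A (torsion G)\<^esub> y = y \<otimes>\<^bsub>A (torsion G)\<^esub> x"
    proof (cases "finite (carrier (A (torsion G)))")
      case True
      show ?thesis
      proof (rule AT.commute_if_corners_commute[OF _ xy])
        fix e x y assume *: "e \<in> AT.E" "x \<in> carrier (A (torsion G))" "e \<otimes>\<^bsub>A (torsion G)\<^esub> x = x"
          "y \<in> carrier (A (torsion G))" "e \<otimes>\<^bsub>A (torsion G)\<^esub> y = y"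
        show "x \<otimes>\<^bsub>A (torsion G)\<^esub> y = y \<otimes>\<^bsub>A (torsion G)\<^esub> x"
          by (rule AT.finite_corner_commute[OF *(1) _ *(2-5)])
             (rule finite_subset[OF _ True], auto simp del: A_simps)
      qed
    next
      case False
      then show ?thesis using central xy AR[OF xy(2)] unfolding center_def by (auto simp del: R_simps A_simps simp: A_simps(5))
    qed
  qed
qed

end

section \<open>Homogeneity of units\<close>

definition cut :: "'g set \<Rightarrow> ('g \<Rightarrow>\<^sub>0 'k::comm_monoid_add) \<Rightarrow> ('g \<Rightarrow>\<^sub>0 'k)" where
  "cut S x = (\<Sum>k\<in>keys x \<inter> S. single k (lookup x k))"

lemma lookup_cut: "lookup (cut S x) k = (if k \<in> S then lookup x k else 0)"
proof -
  have "lookup (cut S x) k =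
      (\<Sum>j\<in>keys x \<inter> S. if j = k then lookup x j else 0)"
    unfolding cut_def by (simp add: lookup_sum lookup_single when_def)
  also have "\<dots> = (if k \<in> keys x \<inter> S then lookup x k else 0)"
    by (rule sum.delta) simp
  finally show ?thesis by (auto simp: in_keys_iff)
qed

lemma keys_cut: "keys (cut S x) = keys x \<inter> S"
  by (auto simp: in_keys_iff lookup_cut split: if_splits)

lemma cut_add_cut_Compl: "cut S x + cut (- S) x = x"
  by (rule poly_mapping_eqI) (simp add: lookup_add lookup_cut)

text \<open>
  A component \<open>e \<star> R\<close> behaves like a crossed product of the division ring \<open>e \<star> A (torsion G)\<close>
  with the orderable group of cosets of the torsion subgroup, so its units are homogeneous.
\<close>

locale twisted_component = twisted_algebra +
  fixes e
  assumes FC: "FC_group G"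
    and e_central: "e \<in> center R" and e_idem: "e \<star> e = e" and e_nonzero: "e \<noteq> 0"
    and e_torsion: "keys e \<subseteq> torsion G"
    and division: "\<And>a. a \<in> carrier (A (torsion G)) \<Longrightarrow> e \<star> a = a \<Longrightarrow> a \<noteq> 0 \<Longrightarrow>
      \<exists>b\<in>carrier (A (torsion G)). e \<star> b = b \<and> a \<star> b = e \<and> b \<star> a = e"
begin

lemma e_carrier: "e \<in> carrier R"
  using e_torsion torsion_subset by auto

lemma e_commute: "x \<in> carrier R \<Longrightarrow> e \<star> x = x \<star> e"
  using e_central unfolding center_def by blast

lemma torsion_carrier: "a \<in> carrier (A (torsion G)) \<Longrightarrow> a \<in> carrier R"
  using torsion_subset by auto

lemma torsion_mult_closed: "s \<in> torsion G \<Longrightarrow> t \<in> torsion G \<Longrightarrow> s \<otimes> t \<in> torsion G"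
  using subgroup.m_closed[OF torsion_subgroup[OF FC]] .

text \<open>For every \<open>biinvariant_preorder\<close> on \<open>G\<close> this is the
  equivalence class of \<open>g\<close>, so homogeneous parts do not depend on the chosen
  order.\<close>

definition tcoset :: "'a \<Rightarrow> 'a set" where
  "tcoset g = {k \<in> carrier G. inv g \<otimes> k \<in> torsion G}"

lemma tcoset_self: "g \<in> carrier G \<Longrightarrow> g \<in> tcoset g"
  unfolding tcoset_def using one_in_torsion by simp

text \<open>The torsion subgroup is normal, so its left cosets absorb torsion factors from the left
  too.\<close>

lemma tcoset_mult_torsion:
  assumes g: "g \<in> carrier G" and t: "t \<in> torsion G" and k: "k \<in> carrier G"
  shows "t \<otimes> k \<in> tcoset g \<longleftrightarrow> k \<in> tcoset g"
proof -
  define s where "s = inv g \<otimes> t \<otimes> inv (inv g)"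
  have tc: "t \<in> carrier G" using t torsion_subset by auto
  have sT: "s \<in> torsion G" unfolding s_def using conj_in_torsion[OF t] g by blast
  then have sc: "s \<in> carrier G" using torsion_subset by auto
  have "inv g \<otimes> (t \<otimes> k) = s \<otimes> (inv g \<otimes> k)"
    unfolding s_def using g tc k by (simp add: m_assoc inv_cancel)
  moreover have "s \<otimes> (inv g \<otimes> k) \<in> torsion G \<longleftrightarrow> inv g \<otimes> k \<in> torsion G"
  proof
    assume "s \<otimes> (inv g \<otimes> k) \<in> torsion G"
    then have "inv s \<otimes> (s \<otimes> (inv g \<otimes> k)) \<in> torsion G" using torsion_mult_closed inv_in_torsion sT by blast
    then show "inv g \<otimes> k \<in> torsion G" using sc g k by (simp add: inv_cancel)
  qed (use torsion_mult_closed sT in blast)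
  ultimately show ?thesis unfolding tcoset_def using tc k by simp
qed

text \<open>The algebra is graded by the cosets of the torsion subgroup; \<open>a\<close> has
  trivial degree, so multiplication by it preserves homogeneous parts.\<close>

lemma cut_tmult:
  assumes g: "g \<in> carrier G" and a: "a \<in> carrier (A (torsion G))" and x: "x \<in> carrier R"
  shows "cut (tcoset g) (a \<star> x) = a \<star> cut (tcoset g) x"
proof -
  let ?C = "tcoset g"
  have a': "keys a \<subseteq> torsion G" and x': "keys x \<subseteq> carrier G" using a x by auto
  have ax: "a \<star> x = a \<star> cut ?C x + a \<star> cut (- ?C) x"
    unfolding tmult_add_right[symmetric] cut_add_cut_Compl ..
  have "keys (a \<star> cut ?C x) \<subseteq> {t \<otimes> k | t k. t \<in> torsion G \<and> k \<in> carrier G \<inter> ?C}"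
    using x' by (intro keys_tmult[OF a']) (auto simp: keys_cut)
  then have 1: "keys (a \<star> cut ?C x) \<subseteq> ?C" using tcoset_mult_torsion[OF g] by blast
  have "keys (a \<star> cut (- ?C) x) \<subseteq> {t \<otimes> k | t k. t \<in> torsion G \<and> k \<in> carrier G - ?C}"
    using x' by (intro keys_tmult[OF a']) (auto simp: keys_cut)
  then have 2: "keys (a \<star> cut (- ?C) x) \<inter> ?C = {}" using tcoset_mult_torsion[OF g] by blast
  show ?thesis
  proof (rule poly_mapping_eqI)
    fix k
    show "lookup (cut ?C (a \<star> x)) k = lookup (a \<star> cut ?C x) k"
    proof (cases "k \<in> ?C")
      case True
      then have "lookup (a \<star> cut (- ?C) x) k = 0" using 2 by (auto simp: in_keys_iff)
      then show ?thesis using True by (simp add: lookup_cut ax lookup_add)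
    next
      case False
      then have "lookup (a \<star> cut ?C x) k = 0" using 1 by (auto simp: in_keys_iff)
      then show ?thesis using False by (simp add: lookup_cut)
    qed
  qed
qed

text \<open>Dividing by \<open>u g\<close> moves a homogeneous element to trivial degree, where the
  division ring is available.\<close>

lemma homogeneous_factor:
  assumes g: "g \<in> carrier G" and x: "x \<in> carrier R" "keys x \<subseteq> tcoset g" "e \<star> x = x"
  shows "x \<star> inv\<^bsub>R\<^esub> (u g) \<in> carrier (A (torsion G))" "e \<star> (x \<star> inv\<^bsub>R\<^esub> (u g)) = x \<star> inv\<^bsub>R\<^esub> (u g)"
    "x \<star> inv\<^bsub>R\<^esub> (u g) \<star> u g = x"
proof -
  have ug: "u g \<in> Units R" and uc: "u g \<in> carrier R" "inv\<^bsub>R\<^esub> (u g) \<in> carrier R"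
    using u_Units[OF g] R.Units_closed R.Units_inv_closed by blast+
  have "keys (x \<star> inv\<^bsub>R\<^esub> (u g)) \<subseteq> {k \<otimes> h | k h. k \<in> tcoset g \<and> h \<in> {inv g}}"
    by (rule keys_tmult[OF x(2)]) (auto simp: inv_u[OF g])
  moreover have "k \<otimes> inv g \<in> torsion G" if "k \<in> tcoset g" for k
  proof -
    have k: "k \<in> carrier G" "inv g \<otimes> k \<in> torsion G" using that unfolding tcoset_def by auto
    have "g \<otimes> (inv g \<otimes> k) \<otimes> inv g \<in> torsion G" using conj_in_torsion[OF k(2) g] .
    then show ?thesis using g k by (simp add: m_assoc inv_cancel)
  qed
  ultimately show "x \<star> inv\<^bsub>R\<^esub> (u g) \<in> carrier (A (torsion G))" by auto
  show "e \<star> (x \<star> inv\<^bsub>R\<^esub> (u g)) = x \<star> inv\<^bsub>R\<^esub> (u g)"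
    using R.m_assoc[OF e_carrier x(1) uc(2)] x(3) by simp
  show "x \<star> inv\<^bsub>R\<^esub> (u g) \<star> u g = x"
    using R.m_assoc[OF x(1) uc(2,1)] R.Units_l_inv[OF ug] R.r_one[OF x(1)] by simp
qed

text \<open>The product of the two leading homogeneous parts is nonzero, and no other pair of terms
  reaches their coset, so nothing cancels it. Leaving \<open>leq\<close> arbitrary covers trailing
  terms through the reversed order.\<close>

lemma leading_coset:
  assumes leq: "biinvariant_preorder G leq"
    and x: "x \<in> carrier R" "e \<star> x = x" and y: "y \<in> carrier R" "e \<star> y = y"
    and g: "g \<in> keys x" "\<And>k. k \<in> keys x \<Longrightarrow> leq k g"
    and h: "h \<in> keys y" "\<And>k. k \<in> keys y \<Longrightarrow> leq k h"
  shows "\<exists>k\<in>keys (x \<star> y). leq k (g \<otimes> h) \<and> leq (g \<otimes> h) k"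
proof -
  note L = leq[unfolded biinvariant_preorder_def]
  have tot: "leq a b \<or> leq b a" if "a \<in> carrier G" "b \<in> carrier G" for a b
    using conjunct1[OF L] that by blast
  have refl: "leq a a" if "a \<in> carrier G" for a using tot[OF that that] by simp
  have tr: "leq a c" if "leq a b" "leq b c" "a \<in> carrier G" "b \<in> carrier G" "c \<in> carrier G" for a b c
    using conjunct1[OF conjunct2[OF L]] that by blast
  have mono: "leq (a \<otimes> c) (b \<otimes> d)"
    if "leq a b" "leq c d" "a \<in> carrier G" "b \<in> carrier G" "c \<in> carrier G" "d \<in> carrier G" for a b c d
    using conjunct1[OF conjunct2[OF conjunct2[OF L]]] that by blast
  have coset: "k \<in> tcoset m \<longleftrightarrow> leq m k \<and> leq k m" if "m \<in> carrier G" "k \<in> carrier G" for m k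
    using conjunct2[OF conjunct2[OF conjunct2[OF L]]] that unfolding tcoset_def by blast
  have xk: "\<And>k. k \<in> keys x \<Longrightarrow> k \<in> carrier G" and yk: "\<And>k. k \<in> keys y \<Longrightarrow> k \<in> carrier G"
    using x y by auto
  have gc: "g \<in> carrier G" and hc: "h \<in> carrier G" using g h xk yk by auto
  define x1 x2 y1 y2 where "x1 = cut (tcoset g) x" and "x2 = cut (- tcoset g) x"
    and "y1 = cut (tcoset h) y" and "y2 = cut (- tcoset h) y"
  have xs: "x = x1 + x2" and ys: "y = y1 + y2"
    unfolding x1_def x2_def y1_def y2_def by (simp_all add: cut_add_cut_Compl)
  have ks: "keys x1 \<subseteq> carrier G" "keys y1 \<subseteq> carrier G"
    "keys x1 \<subseteq> tcoset g" "keys y1 \<subseteq> tcoset h"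
    using xk yk unfolding x1_def y1_def by (auto simp: keys_cut)
  have eA: "e \<in> carrier (A (torsion G))" using e_torsion by simp
  have ex1: "e \<star> x1 = x1" unfolding x1_def cut_tmult[OF gc eA x(1), symmetric] x(2) ..
  have ey1: "e \<star> y1 = y1" unfolding y1_def cut_tmult[OF hc eA y(1), symmetric] y(2) ..
  have x1c: "x1 \<in> carrier R" and y1c: "y1 \<in> carrier R" using ks by auto
  have nz: "x1 \<noteq> 0" "y1 \<noteq> 0"
    using g(1) h(1) tcoset_self gc hc unfolding x1_def y1_def by (auto simp flip: keys_eq_empty simp: keys_cut)
  have ug: "u g \<in> Units R" and uc: "u g \<in> carrier R" "inv\<^bsub>R\<^esub> (u g) \<in> carrier R"
    using u_Units[OF gc] R.Units_closed R.Units_inv_closed by blast+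
  \<comment> \<open>Write \<open>x1\<close> as \<open>a \<star> u g\<close> with \<open>a\<close>
    nonzero in the division ring, and let \<open>b \<star> a = e\<close>. Multiplying
    \<open>x1 \<star> y1\<close> by \<open>b\<close> gives \<open>u g \<star> y1\<close>, which
    vanishes only if \<open>y1\<close> does.\<close>
  have "x1 \<star> y1 \<noteq> 0"
  proof
    assume 0: "x1 \<star> y1 = 0"
    define a where "a = x1 \<star> inv\<^bsub>R\<^esub> (u g)"
    note a = homogeneous_factor[OF gc x1c ks(3) ex1, folded a_def]
    have "a \<noteq> 0" using a(3) nz by auto
    then obtain b where b: "b \<in> carrier (A (torsion G))" "b \<star> a = e" using division[OF a(1,2)] by blast
    have bc: "b \<in> carrier R" and ac: "a \<in> carrier R" using b a torsion_carrier by blast+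
    have "b \<star> (x1 \<star> y1) = (b \<star> a) \<star> (u g \<star> y1)"
      unfolding a(3)[symmetric] using bc ac uc(1) y1c R.m_assoc R.m_closed by (simp del: R_simps)
    also have "\<dots> = u g \<star> (e \<star> y1)"
      using b(2) e_commute[OF uc(1)] R.m_assoc[OF e_carrier uc(1) y1c] R.m_assoc[OF uc(1) e_carrier y1c] by simp
    finally have "u g \<star> y1 = 0" unfolding 0 ey1 by simp
    then have "inv\<^bsub>R\<^esub> (u g) \<star> (u g \<star> y1) = 0" by simp
    then have "y1 = 0" using R.Units_inv_cancel(1)[OF ug y1c] by simp
    then show False using nz by simp
  qed
  then obtain k where k: "k \<in> keys (x1 \<star> y1)" by fastforce
  obtain g1 h1 where gh1: "g1 \<in> tcoset g" "h1 \<in> tcoset h" "k = g1 \<otimes> h1"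
    using k keys_tmult[OF ks(3,4)] by blast
  have c1: "g1 \<in> carrier G" "h1 \<in> carrier G" using gh1 unfolding tcoset_def by auto
  have kc: "k \<in> carrier G" using gh1 c1 by simp
  have kgh: "leq k (g \<otimes> h)" "leq (g \<otimes> h) k"
    using gh1 coset[OF gc c1(1)] coset[OF hc c1(2)] mono c1 gc hc by auto
  \<comment> \<open>A term of \<open>y\<close> outside its leading coset is strictly below
    \<open>h\<close>, so its products with terms of \<open>x1\<close> stay strictly below
    \<open>g \<otimes> h\<close> and cannot cancel at \<open>k\<close>.\<close>
  have "k \<notin> keys (x1 \<star> y2)"
  proof
    assume "k \<in> keys (x1 \<star> y2)"
    then obtain g2 h2 where gh2: "g2 \<in> tcoset g" "h2 \<in> keys y2" "k = g2 \<otimes> h2"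
      using keys_tmult[OF ks(3) subset_refl, of y2] by blast
    have h2: "h2 \<in> keys y" "h2 \<notin> tcoset h" using gh2(2) unfolding y2_def by (auto simp: keys_cut)
    have c2: "g2 \<in> carrier G" "h2 \<in> carrier G" using gh2 h2 yk unfolding tcoset_def by auto
    have "leq g2 g" using gh2(1) coset gc c2 by blast
    then have "leq (g2 \<otimes> h2) (g \<otimes> h2)" using mono refl c2 gc by blast
    then have "leq (g \<otimes> h) (g \<otimes> h2)" using kgh(2) gh2(3) tr gc hc c2 by (meson m_closed)
    then have "leq h h2" using biinvariant_preorder_cancel(2)[OF leq hc c2(2) gc] by blast
    then show False using h2 h(2) coset hc c2 by blast
  qed
  moreover have "k \<notin> keys (x2 \<star> y)"
  proof
    assume "k \<in> keys (x2 \<star> y)"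
    then obtain g2 h2 where gh2: "g2 \<in> keys x2" "h2 \<in> keys y" "k = g2 \<otimes> h2"
      using keys_tmult[OF subset_refl subset_refl, of x2 y] by blast
    have g2: "g2 \<in> keys x" "g2 \<notin> tcoset g" using gh2(1) unfolding x2_def by (auto simp: keys_cut)
    have c2: "g2 \<in> carrier G" "h2 \<in> carrier G" using gh2 g2 xk yk by auto
    have "leq (g2 \<otimes> h2) (g2 \<otimes> h)" using mono refl h(2)[OF gh2(2)] c2 hc by blast
    then have "leq (g \<otimes> h) (g2 \<otimes> h)" using kgh(2) gh2(3) tr gc hc c2 by (meson m_closed)
    then have "leq g g2" using biinvariant_preorder_cancel(1)[OF leq gc c2(1) hc] by blast
    then show False using g2 g(2) coset gc c2 by blast
  qed
  moreover have "x \<star> y = x1 \<star> y1 + (x1 \<star> y2 + x2 \<star> y)"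
    by (subst xs) (simp add: tmult_add_left tmult_add_right ys)
  ultimately have "k \<in> keys (x \<star> y)"
    using k by (simp add: in_keys_iff lookup_add)
  then show ?thesis using kgh by blast
qed

text \<open>Take leading terms \<open>g\<close>, \<open>h\<close> and trailing terms
  \<open>g'\<close>, \<open>h'\<close> of \<open>x\<close> and \<open>y\<close>. Both
  \<open>g \<otimes> h\<close> and \<open>g' \<otimes> h'\<close> are equivalent to torsion
  elements, since \<open>e\<close> is supported there. Thus \<open>g \<otimes> h\<close> is below
  \<open>g' \<otimes> h'\<close>, which is below \<open>g' \<otimes> h\<close>, and cancelling
  \<open>h\<close> puts the top of \<open>x\<close> below its bottom.\<close>

lemma invertible_homogeneous:
  assumes x: "x \<in> carrier R" "e \<star> x = x" and y: "y \<in> carrier R" "e \<star> y = y" and xy: "x \<star> y = e"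
  shows "\<exists>g\<in>carrier G. keys x \<subseteq> tcoset g"
proof -
  obtain leq where leq: "biinvariant_preorder G leq" using FC_group_preorder[OF FC] by blast
  note rev = biinvariant_preorder_reverse[OF leq]
  note L = leq[unfolded biinvariant_preorder_def]
  have tr: "leq a c" if "leq a b" "leq b c" "a \<in> carrier G" "b \<in> carrier G" "c \<in> carrier G" for a b c
    using conjunct1[OF conjunct2[OF L]] that by blast
  have mono: "leq (a \<otimes> c) (b \<otimes> d)"
    if "leq a b" "leq c d" "a \<in> carrier G" "b \<in> carrier G" "c \<in> carrier G" "d \<in> carrier G" for a b c d
    using conjunct1[OF conjunct2[OF conjunct2[OF L]]] that by blast
  have equiv: "leq m k \<and> leq k m \<longleftrightarrow> inv m \<otimes> k \<in> torsion G" if "m \<in> carrier G" "k \<in> carrier G" for m k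
    using conjunct2[OF conjunct2[OF conjunct2[OF L]]] that by blast
  have refl: "leq a a" if "a \<in> carrier G" for a using equiv[OF that that] that one_in_torsion by simp
  have xk: "keys x \<subseteq> carrier G" and yk: "keys y \<subseteq> carrier G" using x y by auto
  have ne: "keys x \<noteq> {}" "keys y \<noteq> {}" using xy e_nonzero by auto
  obtain g where g: "g \<in> keys x" "\<And>k. k \<in> keys x \<Longrightarrow> leq k g"
    using exists_greatest[OF leq finite_keys ne(1) xk] by blast
  obtain h where h: "h \<in> keys y" "\<And>k. k \<in> keys y \<Longrightarrow> leq k h"
    using exists_greatest[OF leq finite_keys ne(2) yk] by blast
  obtain g' where g': "g' \<in> keys x" "\<And>k. k \<in> keys x \<Longrightarrow> leq g' k"
    using exists_greatest[OF rev finite_keys ne(1) xk] by blast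
  obtain h' where h': "h' \<in> keys y" "\<And>k. k \<in> keys y \<Longrightarrow> leq h' k"
    using exists_greatest[OF rev finite_keys ne(2) yk] by blast
  have c: "g \<in> carrier G" "h \<in> carrier G" "g' \<in> carrier G" "h' \<in> carrier G" using g h g' h' xk yk by auto
  obtain k where k: "k \<in> torsion G" "leq (g \<otimes> h) k"
    using leading_coset[OF leq x y g h] xy e_torsion by blast
  obtain k' where k': "k' \<in> torsion G" "leq k' (g' \<otimes> h')"
    using leading_coset[OF rev x y g' h'] xy e_torsion by blast
  have kc: "k \<in> carrier G" "k' \<in> carrier G" using k k' torsion_subset by auto
  have "leq k k'" using equiv[OF kc] torsion_mult_closed inv_in_torsion k k' by blast
  then have "leq (g \<otimes> h) (g' \<otimes> h')" using k k' kc c tr by (meson m_closed)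
  moreover have "leq (g' \<otimes> h') (g' \<otimes> h)" using mono refl h'(2)[OF h(1)] c by blast
  ultimately have "leq (g \<otimes> h) (g' \<otimes> h)" using tr c by (meson m_closed)
  then have gg': "leq g g'" using biinvariant_preorder_cancel(1)[OF leq c(1,3,2)] by blast
  have "k \<in> tcoset g" if "k \<in> keys x" for k
  proof -
    have "k \<in> carrier G" using that xk by auto
    then show ?thesis using equiv[of g k] g(2)[OF that] tr[OF gg' g'(2)[OF that]] c unfolding tcoset_def by auto
  qed
  then show ?thesis using c by blast
qed

lemma unit_component:
  assumes v: "v \<in> Units R"
  obtains h a a' where "h \<in> carrier G" "a \<in> carrier (A (torsion G))" "e \<star> a = a" "e \<star> v = a \<star> inv\<^bsub>R\<^esub> (u h)"
    "a' \<in> carrier (A (torsion G))" "a \<star> a' = e" "e \<star> inv\<^bsub>R\<^esub> v = u h \<star> a'"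
proof -
  have vc: "v \<in> carrier R" "inv\<^bsub>R\<^esub> v \<in> carrier R" using v R.Units_closed R.Units_inv_closed by blast+
  let ?x = "e \<star> v" and ?y = "e \<star> inv\<^bsub>R\<^esub> v"
  have xc: "?x \<in> carrier R" "?y \<in> carrier R" using vc e_carrier R.m_closed by blast+
  have ee: "e \<star> (e \<star> z) = e \<star> z" if "z \<in> carrier R" for z
    using R.m_assoc[OF e_carrier e_carrier that] e_idem by simp
  have prod: "(e \<star> z) \<star> (e \<star> w) = e \<star> (z \<star> w)" if "z \<in> carrier R" "w \<in> carrier R" for z w
  proof -
    have "(e \<star> z) \<star> (e \<star> w) = ((e \<star> z) \<star> e) \<star> w"
      using that e_carrier R.m_assoc R.m_closed by (simp del: R_simps)
    also have "(e \<star> z) \<star> e = e \<star> z"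
      using e_commute[OF R.m_closed[OF e_carrier that(1)]] ee[OF that(1)] by simp
    finally show ?thesis using R.m_assoc[OF e_carrier that] by simp
  qed
  have xy: "?x \<star> ?y = e"
    unfolding prod[OF vc] using R.Units_r_inv[OF v] R.r_one[OF e_carrier] by simp
  obtain k where k: "k \<in> carrier G" "keys ?x \<subseteq> tcoset k"
    using invertible_homogeneous[OF xc(1) ee[OF vc(1)] xc(2) ee[OF vc(2)] xy] by blast
  \<comment> \<open>The inverse of the coset representative is used so that conjugation by
    \<open>v\<close> involves \<open>inv (u h)\<close> on the left and \<open>u h\<close> on the
    right, the order occurring in condition 2.\<close>
  define h where "h = inv k"
  have h: "h \<in> carrier G" unfolding h_def using k by simp
  have uU: "u h \<in> Units R" and uc: "u h \<in> carrier R" "inv\<^bsub>R\<^esub> (u h) \<in> carrier R"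
    using u_Units[OF h] R.Units_closed R.Units_inv_closed by blast+
  define a where "a = ?x \<star> u h"
  have ac: "a \<in> carrier R" unfolding a_def using xc uc R.m_closed by blast
  have "keys a \<subseteq> {m \<otimes> l | m l. m \<in> tcoset k \<and> l \<in> {h}}"
    unfolding a_def by (rule keys_tmult[OF k(2)]) (simp add: u_def)
  moreover have "m \<otimes> h \<in> torsion G" if "m \<in> tcoset k" for m
  proof -
    have m: "m \<in> carrier G" "inv k \<otimes> m \<in> torsion G" using that unfolding tcoset_def by auto
    have "k \<otimes> (inv k \<otimes> m) \<otimes> inv k \<in> torsion G" using conj_in_torsion[OF m(2) k(1)] .
    then show ?thesis unfolding h_def using k m by (simp add: m_assoc inv_cancel)
  qed
  ultimately have aA: "a \<in> carrier (A (torsion G))" by auto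
  have ea: "e \<star> a = a" unfolding a_def using R.m_assoc[OF e_carrier xc(1) uc(1)] ee[OF vc(1)] by simp
  have xa: "?x = a \<star> inv\<^bsub>R\<^esub> (u h)"
    unfolding a_def using R.m_assoc[OF xc(1) uc] R.Units_r_inv[OF uU] R.r_one[OF xc(1)] by simp
  have "a \<noteq> 0" using xa xy e_nonzero by auto
  then obtain a' where a': "a' \<in> carrier (A (torsion G))" "e \<star> a' = a'" "a \<star> a' = e" "a' \<star> a = e"
    using division[OF aA ea] by blast
  have a'c: "a' \<in> carrier R" using a' torsion_carrier by blast
  have yx: "?y \<star> ?x = e"
    unfolding prod[OF vc(2,1)] using R.Units_l_inv[OF v] R.r_one[OF e_carrier] by simp
  have "?y = ?y \<star> (a \<star> a')"
    unfolding a'(3) using e_commute[OF xc(2)] ee[OF vc(2)] by simp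
  also have "\<dots> = (?y \<star> ?x) \<star> (u h \<star> a')"
    unfolding a_def using xc uc a'c R.m_assoc R.m_closed by (simp del: R_simps)
  also have "\<dots> = u h \<star> (e \<star> a')"
    unfolding yx using e_commute[OF uc(1)] R.m_assoc[OF e_carrier uc(1) a'c] R.m_assoc[OF uc(1) e_carrier a'c] by simp
  finally have "?y = u h \<star> a'" unfolding a'(2) .
  then show thesis using that[OF h aA ea xa a'(1,3)] by blast
qed

text \<open>Each component of a conjugate is a product \<open>a p q a'\<close> with
  \<open>a a' = e\<close>, where \<open>p\<close> and \<open>q\<close> are the conjugates by
  \<open>u h\<close> of \<open>b\<close> and of the inverse of \<open>u g\<close>. Condition 2
  leaves finitely many \<open>q\<close>. If \<open>A\<close> is finite, so are the choices of
  \<open>a\<close>, \<open>p\<close>, \<open>a'\<close>; if \<open>A\<close> is infinite, its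
  centrality gives \<open>p = b\<close> and merges \<open>a\<close> and \<open>a'\<close> into
  \<open>e\<close>.\<close>

lemma finite_component_conjugates:
  assumes cc: "\<And>g. g \<in> carrier G \<Longrightarrow> finite (cocycle_conj g)"
    and fin: "infinite (carrier (A (torsion G))) \<Longrightarrow> carrier (A (torsion G)) \<subseteq> center R"
    and x: "x \<in> Units R"
  shows "finite {e \<star> (v \<star> x \<star> inv\<^bsub>R\<^esub> v) | v. v \<in> Units R}"
proof -
  have xc: "x \<in> carrier R" using x R.Units_closed by blast
  obtain g b where g: "g \<in> carrier G" and b: "b \<in> carrier (A (torsion G))" "e \<star> b = b" "e \<star> x = b \<star> inv\<^bsub>R\<^esub> (u g)"
    using unit_component[OF x] by blast
  have bc: "b \<in> carrier R" using b torsion_carrier by blast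
  obtain c where c: "inv\<^bsub>R\<^esub> (u g) = single (inv g) c" using inv_u[OF g] by blast
  let ?i = "inv\<^bsub>R\<^esub> (u g)"
  have ic: "?i \<in> carrier R" using u_Units[OF g] R.Units_inv_closed by blast
  define Q where "Q = {inv\<^bsub>R\<^esub> (u h) \<star> ?i \<star> u h | h. h \<in> carrier G}"
  have finQ: "finite Q" unfolding Q_def c using finite_inv_conj[OF FC cc, of "inv g" c] g by simp
  have form: "\<exists>h\<in>carrier G. \<exists>a\<in>carrier (A (torsion G)). \<exists>a'\<in>carrier (A (torsion G)). a \<star> a' = e \<and>
      e \<star> (v \<star> x \<star> inv\<^bsub>R\<^esub> v) = a \<star> (inv\<^bsub>R\<^esub> (u h) \<star> b \<star> u h) \<star> (inv\<^bsub>R\<^esub> (u h) \<star> ?i \<star> u h) \<star> a'"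
    if v: "v \<in> Units R" for v
  proof -
    obtain h a a' where h: "h \<in> carrier G" and a: "a \<in> carrier (A (torsion G))" "e \<star> a = a"
      "e \<star> v = a \<star> inv\<^bsub>R\<^esub> (u h)" "a' \<in> carrier (A (torsion G))" "a \<star> a' = e" "e \<star> inv\<^bsub>R\<^esub> v = u h \<star> a'"
      using unit_component[OF v] by blast
    have vc: "v \<in> carrier R" "inv\<^bsub>R\<^esub> v \<in> carrier R" using v R.Units_closed R.Units_inv_closed by blast+
    have uU: "u h \<in> Units R" and uc: "u h \<in> carrier R" "inv\<^bsub>R\<^esub> (u h) \<in> carrier R"
      using u_Units[OF h] R.Units_closed R.Units_inv_closed by blast+
    have ac: "a \<in> carrier R" "a' \<in> carrier R" using a torsion_carrier by blast+
    have "e \<star> (v \<star> x \<star> inv\<^bsub>R\<^esub> v) = (e \<star> v) \<star> (e \<star> x) \<star> (e \<star> inv\<^bsub>R\<^esub> v)"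
    proof -
      have "(e \<star> v) \<star> (e \<star> x) \<star> (e \<star> inv\<^bsub>R\<^esub> v) = (e \<star> v) \<star> (e \<star> x) \<star> (inv\<^bsub>R\<^esub> v \<star> e)"
        using e_commute[OF vc(2)] by simp
      also have "\<dots> = (e \<star> v) \<star> (x \<star> e) \<star> (inv\<^bsub>R\<^esub> v \<star> e)" using e_commute[OF xc] by simp
      also have "\<dots> = e \<star> (v \<star> x) \<star> (e \<star> (inv\<^bsub>R\<^esub> v \<star> e))"
        using vc xc e_carrier R.m_assoc R.m_closed by (simp del: R_simps)
      also have "e \<star> (inv\<^bsub>R\<^esub> v \<star> e) = inv\<^bsub>R\<^esub> v \<star> e"
        using e_commute[OF vc(2)] R.m_assoc[OF e_carrier e_carrier vc(2)] e_idem by simp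
      also have "e \<star> (v \<star> x) \<star> (inv\<^bsub>R\<^esub> v \<star> e) = (e \<star> (v \<star> x \<star> inv\<^bsub>R\<^esub> v)) \<star> e"
        using vc xc e_carrier R.m_assoc R.m_closed by (simp del: R_simps)
      also have "\<dots> = e \<star> (e \<star> (v \<star> x \<star> inv\<^bsub>R\<^esub> v))"
        using e_commute[of "e \<star> (v \<star> x \<star> inv\<^bsub>R\<^esub> v)"] vc xc e_carrier R.m_closed by (simp del: R_simps)
      also have "\<dots> = e \<star> (v \<star> x \<star> inv\<^bsub>R\<^esub> v)"
        using R.m_assoc[OF e_carrier e_carrier, of "v \<star> x \<star> inv\<^bsub>R\<^esub> v"] e_idem vc xc R.m_closed by (simp del: R_simps)
      finally show ?thesis by simp
    qed
    \<comment> \<open>Inserting \<open>u h\<close> and its inverse after \<open>b\<close> lets the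
      two factors of the component of \<open>x\<close> be conjugated separately.\<close>
    also have "\<dots> = (a \<star> inv\<^bsub>R\<^esub> (u h)) \<star> (b \<star> ((u h \<star> inv\<^bsub>R\<^esub> (u h)) \<star> ?i)) \<star> (u h \<star> a')"
      unfolding a(3,6) b(3) R.Units_r_inv[OF uU] R.l_one[OF ic] ..
    also have "\<dots> = a \<star> (inv\<^bsub>R\<^esub> (u h) \<star> b \<star> u h) \<star> (inv\<^bsub>R\<^esub> (u h) \<star> ?i \<star> u h) \<star> a'"
      using ac uc bc ic R.m_assoc R.m_closed by (simp del: R_simps)
    finally show ?thesis using h a by blast
  qed
  show ?thesis
  proof (cases "finite (carrier (A (torsion G)))")
    case True
    have "{e \<star> (v \<star> x \<star> inv\<^bsub>R\<^esub> v) | v. v \<in> Units R} \<subseteq> (\<lambda>(a, p, q, a'). a \<star> p \<star> q \<star> a') `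
        (carrier (A (torsion G)) \<times> carrier (A (torsion G)) \<times> Q \<times> carrier (A (torsion G)))"
    proof
      fix z assume "z \<in> {e \<star> (v \<star> x \<star> inv\<^bsub>R\<^esub> v) | v. v \<in> Units R}"
      then obtain h a a' where h: "h \<in> carrier G" and a: "a \<in> carrier (A (torsion G))" "a' \<in> carrier (A (torsion G))"
        "z = a \<star> (inv\<^bsub>R\<^esub> (u h) \<star> b \<star> u h) \<star> (inv\<^bsub>R\<^esub> (u h) \<star> ?i \<star> u h) \<star> a'"
        using form by blast
      have "keys (inv\<^bsub>R\<^esub> (u h) \<star> b) \<subseteq> {k \<otimes> t | k t. k \<in> {inv h} \<and> t \<in> torsion G}"
        using b(1) by (intro keys_tmult) (auto simp: inv_u[OF h])
      then have "keys (inv\<^bsub>R\<^esub> (u h) \<star> b \<star> u h) \<subseteq>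
          {m \<otimes> l | m l. m \<in> {k \<otimes> t | k t. k \<in> {inv h} \<and> t \<in> torsion G} \<and> l \<in> {h}}"
        by (rule keys_tmult) (simp add: u_def)
      moreover have "inv h \<otimes> t \<otimes> h \<in> torsion G" if "t \<in> torsion G" for t
        using conj_in_torsion[OF that inv_closed[OF h]] h by simp
      ultimately have "inv\<^bsub>R\<^esub> (u h) \<star> b \<star> u h \<in> carrier (A (torsion G))" by auto
      moreover have "inv\<^bsub>R\<^esub> (u h) \<star> ?i \<star> u h \<in> Q" unfolding Q_def using h by blast
      ultimately show "z \<in> (\<lambda>(a, p, q, a'). a \<star> p \<star> q \<star> a') `
        (carrier (A (torsion G)) \<times> carrier (A (torsion G)) \<times> Q \<times> carrier (A (torsion G)))"
        using a by (intro image_eqI[of _ _ "(a, inv\<^bsub>R\<^esub> (u h) \<star> b \<star> u h, inv\<^bsub>R\<^esub> (u h) \<star> ?i \<star> u h, a')"])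
          (simp_all del: A_simps)
    qed
    then show ?thesis by (rule finite_subset) (intro finite_imageI finite_cartesian_product True finQ)
  next
    case False
    then have com: "a \<star> z = z \<star> a" if "a \<in> carrier (A (torsion G))" "z \<in> carrier R" for a z
      using fin that unfolding center_def by blast
    have "{e \<star> (v \<star> x \<star> inv\<^bsub>R\<^esub> v) | v. v \<in> Units R} \<subseteq> (\<lambda>q. e \<star> (b \<star> q)) ` Q"
    proof
      fix z assume "z \<in> {e \<star> (v \<star> x \<star> inv\<^bsub>R\<^esub> v) | v. v \<in> Units R}"
      then obtain h a a' where h: "h \<in> carrier G" and a: "a \<in> carrier (A (torsion G))" "a' \<in> carrier (A (torsion G))"
        "a \<star> a' = e" "z = a \<star> (inv\<^bsub>R\<^esub> (u h) \<star> b \<star> u h) \<star> (inv\<^bsub>R\<^esub> (u h) \<star> ?i \<star> u h) \<star> a'"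
        using form by blast
      have uU: "u h \<in> Units R" and uc: "u h \<in> carrier R" "inv\<^bsub>R\<^esub> (u h) \<in> carrier R"
        using u_Units[OF h] R.Units_closed R.Units_inv_closed by blast+
      have ac: "a \<in> carrier R" "a' \<in> carrier R" using a torsion_carrier by blast+
      define q where "q = inv\<^bsub>R\<^esub> (u h) \<star> ?i \<star> u h"
      have qc: "q \<in> carrier R" unfolding q_def using uc ic R.m_closed by blast
      have "inv\<^bsub>R\<^esub> (u h) \<star> b \<star> u h = b"
        using com[OF b(1) uc(2)] R.m_assoc[OF bc uc(2,1)] R.Units_l_inv[OF uU] R.r_one[OF bc] by simp
      then have "z = a \<star> b \<star> q \<star> a'" using a(4) q_def by simp
      also have "\<dots> = a \<star> (b \<star> (q \<star> a'))" using ac bc qc R.m_assoc R.m_closed by (simp del: R_simps)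
      also have "q \<star> a' = a' \<star> q" using com[OF a(2) qc] by simp
      also have "b \<star> (a' \<star> q) = a' \<star> (b \<star> q)"
        using R.m_assoc[OF bc ac(2) qc] R.m_assoc[OF ac(2) bc qc] com[OF b(1) ac(2)] by simp
      also have "a \<star> (a' \<star> (b \<star> q)) = e \<star> (b \<star> q)"
        using R.m_assoc[OF ac R.m_closed[OF bc qc]] a(3) by simp
      finally show "z \<in> (\<lambda>q. e \<star> (b \<star> q)) ` Q" using h unfolding Q_def q_def by blast
    qed
    then show ?thesis by (rule finite_subset) (intro finite_imageI finQ)
  qed
qed

end

section \<open>Recombining the components\<close>

context twisted_algebra
begin

text \<open>The primitive idempotents sum to one, so a conjugate is the sum of its components; each
  component has finitely many values, hence so has the sum.\<close>

lemma FC_units_if_central_torsion_span: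
  assumes char: "\<forall>g\<in>torsion G. \<not> CHAR('k) dvd ord g"
    and fin: "finite (idempotents (A (torsion G)))"
    and FC: "FC_group G"
    and cen: "idempotents (A (torsion G)) \<subseteq> center R"
    and cc: "\<And>g. g \<in> carrier G \<Longrightarrow> finite (cocycle_conj g)"
    and inf: "infinite (carrier (A (torsion G))) \<Longrightarrow> carrier (A (torsion G)) \<subseteq> center R"
  shows "FC_group (units_of R)"
  unfolding FC_units_iff
proof
  fix x assume x: "x \<in> Units R"
  have sub: "subgroup (torsion G) G" using torsion_subgroup[OF FC] .
  interpret AT: finite_central_idempotents_regular "A (torsion G)"
    using torsion_span_locale[OF FC char fin cen] .
  have component: "finite {e \<star> (v \<star> x \<star> inv\<^bsub>R\<^esub> v) | v. v \<in> Units R}" if e: "e \<in> AT.E" for e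
  proof -
    have eA: "e \<in> carrier (A (torsion G))" "e \<star> e = e"
      using AT.E_idempotent[OF e] AT.idempotentD by auto
    interpret twisted_component G lam e
    proof
      show "FC_group G" by fact
      show "e \<in> center R" using cen AT.E_idempotent[OF e] by blast
      show "e \<star> e = e" "e \<noteq> 0" "keys e \<subseteq> torsion G"
        using eA e unfolding primitive_idempotents_def by auto
      fix a assume a: "a \<in> carrier (A (torsion G))" "e \<star> a = a" "a \<noteq> 0"
      have 1: "e \<otimes>\<^bsub>A (torsion G)\<^esub> a = a" and 2: "a \<noteq> \<zero>\<^bsub>A (torsion G)\<^esub>" using a by simp_all
      obtain b where "b \<in> carrier (A (torsion G))" "e \<otimes>\<^bsub>A (torsion G)\<^esub> b = b"
        "a \<otimes>\<^bsub>A (torsion G)\<^esub> b = e" "b \<otimes>\<^bsub>A (torsion G)\<^esub> a = e"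
        by (rule AT.E_corner_division[OF e a(1) 1 2 AT.regular[OF a(1)]])
      then show "\<exists>b\<in>carrier (A (torsion G)). e \<star> b = b \<and> a \<star> b = e \<and> b \<star> a = e"
        unfolding A_simps(5) by blast
    qed
    show ?thesis using finite_component_conjugates[OF cc inf x] by blast
  qed
  have one: "(\<Sum>e\<in>AT.E. e) = \<one>\<^bsub>R\<^esub>"
    using AT.sum_E finsum_A[OF sub AT.finite_E, of "\<lambda>e. e"] AT.E_carrier by (simp only: A_simps(4))
  have "{v \<star> x \<star> inv\<^bsub>R\<^esub> v | v. v \<in> Units R} \<subseteq> (\<lambda>f. \<Sum>e\<in>AT.E. f e) `
      (PiE AT.E (\<lambda>e. {e \<star> (v \<star> x \<star> inv\<^bsub>R\<^esub> v) | v. v \<in> Units R}))"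
  proof
    fix z assume "z \<in> {v \<star> x \<star> inv\<^bsub>R\<^esub> v | v. v \<in> Units R}"
    then obtain v where v: "v \<in> Units R" "z = v \<star> x \<star> inv\<^bsub>R\<^esub> v" by blast
    have zc: "z \<in> carrier R"
      unfolding v(2) using v(1) x R.Units_closed R.Units_inv_closed R.m_closed by blast
    have "z = (\<Sum>e\<in>AT.E. e) \<star> z" unfolding one using R.l_one[OF zc] by simp
    then have "z = (\<Sum>e\<in>AT.E. restrict (\<lambda>e. e \<star> z) AT.E e)" by (simp add: tmult_sum_left)
    moreover have "restrict (\<lambda>e. e \<star> z) AT.E \<in> PiE AT.E (\<lambda>e. {e \<star> (v \<star> x \<star> inv\<^bsub>R\<^esub> v) | v. v \<in> Units R})"
      using v by auto
    ultimately show "z \<in> (\<lambda>f. \<Sum>e\<in>AT.E. f e) `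
      (PiE AT.E (\<lambda>e. {e \<star> (v \<star> x \<star> inv\<^bsub>R\<^esub> v) | v. v \<in> Units R}))" by (rule image_eqI)
  qed
  moreover have "finite (PiE AT.E (\<lambda>e. {e \<star> (v \<star> x \<star> inv\<^bsub>R\<^esub> v) | v. v \<in> Units R}))"
    using component AT.finite_E by (intro finite_PiE)
  ultimately show "finite {v \<star> x \<star> inv\<^bsub>R\<^esub> v | v. v \<in> Units R}" by (meson finite_imageI finite_subset)
qed

end

theorem theorem4:
  fixes G :: "('g, 'm) monoid_scheme"
    and lam :: "'g \<Rightarrow> 'g \<Rightarrow> 'k::field"
  assumes "group G"
    and "two_cocycle G lam"
    and "infinite (carrier (twisted_group_algebra G lam))"
    and "\<forall>g\<in>torsion G. \<not> CHAR('k) dvd group.ord G g"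
    and "finite (idempotents (twisted_span G lam (torsion G)))"
  shows "FC_group (units_of (twisted_group_algebra G lam)) \<longleftrightarrow>
    FC_group G \<and>
    idempotents (twisted_span G lam (torsion G)) \<subseteq> center (twisted_group_algebra G lam) \<and>
    (\<forall>g\<in>carrier G.
       finite {inverse (lam h (inv\<^bsub>G\<^esub> h)) * lam (inv\<^bsub>G\<^esub> h) g * lam (inv\<^bsub>G\<^esub> h \<otimes>\<^bsub>G\<^esub> g) h | h.
         h \<in> carrier G}) \<and>
    direct_sum_of_fields (twisted_span G lam (torsion G)) \<and>
    (infinite (carrier (twisted_span G lam (torsion G))) \<longrightarrow>
       carrier (twisted_span G lam (torsion G)) \<subseteq> center (twisted_group_algebra G lam))"
proof -
  interpret twisted_algebra G lam
    using assms(1,2) by (intro twisted_algebra.intro twisted_algebra_axioms.intro)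
  show ?thesis
  proof (intro iffI conjI ballI impI)
    assume FCU: "FC_group (units_of R)"
    show "FC_group G" using FC_group_if_FC_units[OF FCU] .
    show "idempotents (A (torsion G)) \<subseteq> center R"
      using A_idempotents_subset[OF torsion_subset] idempotents_central_if_FC_units[OF assms(3) FCU] by blast
    show "finite (cocycle_conj g)" if "g \<in> carrier G" for g
      using finite_cocycle_conj_if_FC_units[OF FCU that] .
    show "direct_sum_of_fields (A (torsion G))" using torsion_span_structure_if_FC_units(1)[OF assms(3-5) FCU] .
    show "carrier (A (torsion G)) \<subseteq> center R" if "infinite (carrier (A (torsion G)))"
      using torsion_span_structure_if_FC_units(2)[OF assms(3-5) FCU that] .
  next
    assume *: "FC_group G \<and> idempotents (A (torsion G)) \<subseteq> center R \<and>
      (\<forall>g\<in>carrier G. finite (cocycle_conj g)) \<and> direct_sum_of_fields (A (torsion G)) \<and>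
      (infinite (carrier (A (torsion G))) \<longrightarrow> carrier (A (torsion G)) \<subseteq> center R)"
    show "FC_group (units_of R)"
      by (rule FC_units_if_central_torsion_span[OF assms(4,5)]) (use * in blast)+
  qed
qed

end
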